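(* Consider the two-player delay system $\dot x(t)=A_0x(t)+A_1x(t-h)+B_1u_1(t)+B_2u_2(t)$ with, for $i=1,2$, the performance indices $$J_i=\int_0^\infty\Big\{x^T(t)\Phi_{i,0}x(t)+2x^T(t)\int_{-h}^0\Phi_{i,1}(\theta)x(t+\theta)\,d\theta+\int_{-h}^0\int_{-h}^0x^T(t+\xi)\Phi_{i,2}(\xi,\theta)x(t+\theta)\,d\xi\,d\theta+u_1^T(t)R_{i,1}u_1(t)+u_2^T(t)R_{i,2}u_2(t)\Big\}dt,$$ and the associated coupled equations (E1)–(E5) for $\Pi_{i,0},\Pi_{i,1},\Pi_{i,2}$ given in the context. If the weights are $$\Phi_{i,0}=N_i+2\Pi_{i,0}C_{-i}\Pi_{-i,0}-\Pi_{-i,0}D_{i,-i}\Pi_{-i,0}-2\Pi_{i,1}(0),$$ $$\Phi_{i,1}(\theta)=-\Pi_{i,2}(0,\theta)-\Pi_{-i,0}D_{i,-i}\Pi_{-i,1}(\theta)+\Pi_{i,0}C_{-i}\Pi_{-i,1}(\theta)+\Pi_{-i,0}C_{-i}\Pi_{i,1}(\theta),$$ $$\Phi_{i,2}(\xi,\theta)=-\Pi_{i,1}^T(\xi)\left[D_{i,i}-2C_i\right]\Pi_{i,1}(\theta)-\Pi_{-i,1}^T(\xi)D_{i,-i}\Pi_{-i,1}(\theta)+2\Pi_{-i,1}^T(\xi)C_{-i}\Pi_{i,1}(\theta),$$ where $N_i\in\mathbb{R}^{n\times n}$ are positive definite (free parameter) matrices, then $\Pi_{i,0}$ (satisfying (E1))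 is a solution of the algebraic Riccati equation $$\Pi_{i,0}A_0+A_0^T\Pi_{i,0}+\Pi_{i,0}(D_{i,i}-2C_i)\Pi_{i,0}=-N_i,$$ and equations (E2)–(E5) have the solution $$\Pi_{i,1}(\theta)=e^{F_i(\theta+h)}\,\Pi_{i,0}A_1,\qquad\theta\in[-h,0],$$ $$\Pi_{i,2}(\xi,\theta)=\begin{cases}\Psi_i(\xi)\,\Pi_{i,1}(\theta),&(\xi,\theta)\in\Omega_1,\\ \Pi_{i,1}^T(\xi)\,\Psi_i^T(\theta),&(\xi,\theta)\in\Omega_2,\end{cases}$$ where $F_i:=A_0^T+\Pi_{i,0}[D_{i,i}-2C_i]$, $\Psi_i(\xi)=A_1^Te^{-F_i(\xi+h)}$ (so $\Psi_i(-h)=A_1^T$), $\Omega_1=\{(\xi,\theta)\in[-h,0]\times[-h,0]:\xi-\theta<0\}$ and $\Omega_2=\{(\xi,\theta)\in[-h,0]\times[-h,0]:\xi-\theta>0\}$. Moreover, the closed-loop Nash strategies of the system can be constructed as $$u_i^*(x_t)=-R_{i,i}^{-1}B_i^T\Pi_{i,0}x(t)-R_{i,i}^{-1}B_i^T\int_{-h}^0\Pi_{i,1}(\theta)x(t+\theta)\,d\theta,\qquad i=1,2.$$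
   Context: Here $h>0$, $A_0,A_1\in\mathbb{R}^{n\times n}$, $B_i\in\mathbb{R}^{n\times m_i}$, $m_i\le n$, $x(t)\in\mathbb{R}^n$, $u_i(t)\in\mathbb{R}^{m_i}$, $i=1,2$; the subscript $-i$ denotes the player other than $i$; initial functions are piecewise continuous on $[-h,0]$ and the state is $x_t$, $x_t(\theta)=x(t+\theta)$, $\theta\in[-h,0]$. The matrices $R_{i,j}$ are symmetric and $R_{i,i}$ is positive definite. In the performance indices, $\Phi_{i,0}$ is symmetric positive definite, $\Phi_{i,1}$ and $\Phi_{i,2}$ are continuous $n\times n$ matrix functions on $[-h,0]$ and $[-h,0]^2$, and $\Phi_{i,2}^T(\xi,\theta)=\Phi_{i,2}(\theta,\xi)$. The unknowns $\Pi_{i,0}$ are symmetric positive definite $n\times n$ matrices, $\Pi_{i,1}$ continuous on $[-h,0]$, $\Pi_{i,2}$ continuous on $[-h,0]^2$ with $\Pi_{i,2}^T(\xi,\theta)=\Pi_{i,2}(\theta,\xi)$. Notation: $C_j=B_jR_{j,j}^{-1}B_j^T$, $D_{i,j}=B_jR_{j,j}^{-1}R_{i,j}R_{j,j}^{-1}B_j^T$, $i,j\in\{1,2\}$. Coupled equations ($i=1,2$): (E1) $-\Phi_{i,0}=\Pi_{i,0}A_0+A_0^T\Pi_{i,0}-2\Pi_{i,0}C_i\Pi_{i,0}-2\Pi_{i,0}C_{-i}\Pi_{-i,0}+\Pi_{i,0}D_{i,i}\Pi_{i,0}+\Pi_{-i,0}D_{i,-i}\Pi_{-i,0}+2\Pi_{i,1}(0)$;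 (E2) $\frac{d\Pi_{i,1}(\theta)}{d\theta}=A_0^T\Pi_{i,1}(\theta)+\Phi_{i,1}(\theta)+\Pi_{i,2}(0,\theta)+\Pi_{i,0}D_{i,i}\Pi_{i,1}(\theta)+\Pi_{-i,0}D_{i,-i}\Pi_{-i,1}(\theta)-2\Pi_{i,0}C_i\Pi_{i,1}(\theta)-\Pi_{i,0}C_{-i}\Pi_{-i,1}(\theta)-\Pi_{-i,0}C_{-i}\Pi_{i,1}(\theta)$; (E3) $\frac{\partial\Pi_{i,2}(\xi,\theta)}{\partial\xi}+\frac{\partial\Pi_{i,2}(\xi,\theta)}{\partial\theta}=\Phi_{i,2}(\xi,\theta)+\Pi_{i,1}^T(\xi)D_{i,i}\Pi_{i,1}(\theta)+\Pi_{-i,1}^T(\xi)D_{i,-i}\Pi_{-i,1}(\theta)-2\Pi_{i,1}^T(\xi)C_i\Pi_{i,1}(\theta)-2\Pi_{-i,1}^T(\xi)C_{-i}\Pi_{i,1}(\theta)$; (E4) $A_1^T\Pi_{i,1}(\theta)=\Pi_{i,2}(-h,\theta)$; (E5) $\Pi_{i,0}A_1=\Pi_{i,1}(-h)$. Nash strategies are a pair of admissible strategies $(u_1^*,u_2^* )$ such that, for $i=1,2$, $u_i^*$ minimizes $J_i(\varphi,u_i,u_{-i}^* )$ over admissible $u_i$. Admissible means: (i) $u_i(t)=u_i(x_t)$ is a function of the state; (ii) the solution of the system exists and is unique for all $t\ge0$ and any initial function $\varphi$; (iii) the trivial solution of the closed-loop system is asymptotically stable; (iv) $u_i(x_t)$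 is continuous for all $t\ge0$.
   Formalization: The Nash claim is proved assuming the closed loop under (u_1^*,u_2^* ) is asymptotically stable (admissibility (iii)), which the other hypotheses do not imply; asymptotic stability includes attraction of every initial function, and (E3) is required for ξ≠θ. *)

theory Defs
  imports "HOL-Analysis.Analysis"
begin

section \<open>Matrices\<close>

definition symmetric_matrix :: "real^'n^'n \<Rightarrow> bool" where
  "symmetric_matrix M \<longleftrightarrow> transpose M = M"

definition positive_definite :: "real^'n^'n \<Rightarrow> bool" where
  "positive_definite M \<longleftrightarrow> symmetric_matrix M \<and> (\<forall>v. v \<noteq> 0 \<longrightarrow> v \<bullet> (M *v v) > 0)"

primrec matrix_power :: "real^'n^'n \<Rightarrow> nat \<Rightarrow> real^'n^'n" where
  "matrix_power M 0 = mat 1"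
| "matrix_power M (Suc k) = M ** matrix_power M k"

(* The library's exp needs a normed algebra with unit; square matrices are not an instance. *)
definition matrix_exp :: "real^'n^'n \<Rightarrow> real^'n^'n" where
  "matrix_exp M = (\<Sum>k. (1 / fact k) *\<^sub>R matrix_power M k)"


section \<open>The delay game\<close>

datatype player = P1 | P2

fun opp :: "player \<Rightarrow> player" where
  "opp P1 = P2"
| "opp P2 = P1"

(* The matrices R_{i,j} have size m_j x m_j, so they are stored by the second index:
   R1 G i is R_{i,1} and R2 G i is R_{i,2}. *)
record ('n::finite, 'm1::finite, 'm2::finite) delay_game =
  delay :: real
  A0 :: "real^'n^'n"
  A1 :: "real^'n^'n"
  B1 :: "real^'m1^'n"
  B2 :: "real^'m2^'n"
  R1 :: "player \<Rightarrow> real^'m1^'m1"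
  R2 :: "player \<Rightarrow> real^'m2^'m2"
  Phi0 :: "player \<Rightarrow> real^'n^'n"
  Phi1 :: "player \<Rightarrow> real \<Rightarrow> real^'n^'n"
  Phi2 :: "player \<Rightarrow> real \<Rightarrow> real \<Rightarrow> real^'n^'n"

definition delay_interval :: "('n::finite,'m1::finite,'m2::finite) delay_game \<Rightarrow> real set" where
  "delay_interval G = {- delay G..0}"

definition well_formed_game :: "('n::finite,'m1::finite,'m2::finite) delay_game \<Rightarrow> bool" where
  "well_formed_game G \<longleftrightarrow>
     delay G > 0 \<and> CARD('m1) \<le> CARD('n) \<and> CARD('m2) \<le> CARD('n) \<and>
     (\<forall>i. symmetric_matrix (R1 G i)) \<and> (\<forall>i. symmetric_matrix (R2 G i)) \<and>
     positive_definite (R1 G P1) \<and> positive_definite (R2 G P2) \<and>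
     (\<forall>i. positive_definite (Phi0 G i)) \<and>
     (\<forall>i. continuous_on (delay_interval G) (Phi1 G i)) \<and>
     (\<forall>i. continuous_on (delay_interval G \<times> delay_interval G) (\<lambda>(\<xi>, \<theta>). Phi2 G i \<xi> \<theta>)) \<and>
     (\<forall>i. \<forall>\<xi>\<in>delay_interval G. \<forall>\<theta>\<in>delay_interval G.
        transpose (Phi2 G i \<xi> \<theta>) = Phi2 G i \<theta> \<xi>)"

fun Cmat :: "('n::finite,'m1::finite,'m2::finite) delay_game \<Rightarrow> player \<Rightarrow> real^'n^'n" where
  "Cmat G P1 = B1 G ** matrix_inv (R1 G P1) ** transpose (B1 G)"
| "Cmat G P2 = B2 G ** matrix_inv (R2 G P2) ** transpose (B2 G)"

fun Dmat :: "('n::finite,'m1::finite,'m2::finite) delay_game \<Rightarrow> player \<Rightarrow> player \<Rightarrow> real^'n^'n" where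
  "Dmat G i P1 =
     B1 G ** matrix_inv (R1 G P1) ** R1 G i ** matrix_inv (R1 G P1) ** transpose (B1 G)"
| "Dmat G i P2 =
     B2 G ** matrix_inv (R2 G P2) ** R2 G i ** matrix_inv (R2 G P2) ** transpose (B2 G)"


section \<open>The coupled equations\<close>

definition regular_unknowns ::
  "('n::finite,'m1::finite,'m2::finite) delay_game \<Rightarrow> (player \<Rightarrow> real^'n^'n) \<Rightarrow>
   (player \<Rightarrow> real \<Rightarrow> real^'n^'n) \<Rightarrow> (player \<Rightarrow> real \<Rightarrow> real \<Rightarrow> real^'n^'n) \<Rightarrow> bool" where
  "regular_unknowns G Pi0 Pi1 Pi2 \<longleftrightarrow> (\<forall>i.
     positive_definite (Pi0 i) \<and>
     continuous_on (delay_interval G) (Pi1 i) \<and>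
     continuous_on (delay_interval G \<times> delay_interval G) (\<lambda>(\<xi>, \<theta>). Pi2 i \<xi> \<theta>) \<and>
     (\<forall>\<xi>\<in>delay_interval G. \<forall>\<theta>\<in>delay_interval G. transpose (Pi2 i \<xi> \<theta>) = Pi2 i \<theta> \<xi>))"

definition E1 ::
  "('n::finite,'m1::finite,'m2::finite) delay_game \<Rightarrow> (player \<Rightarrow> real^'n^'n) \<Rightarrow>
   (player \<Rightarrow> real \<Rightarrow> real^'n^'n) \<Rightarrow> player \<Rightarrow> bool" where
  "E1 G Pi0 Pi1 i \<longleftrightarrow>
     - Phi0 G i =
         Pi0 i ** A0 G + transpose (A0 G) ** Pi0 i
         - 2 *\<^sub>R (Pi0 i ** Cmat G i ** Pi0 i)
         - 2 *\<^sub>R (Pi0 i ** Cmat G (opp i) ** Pi0 (opp i))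
         + Pi0 i ** Dmat G i i ** Pi0 i
         + Pi0 (opp i) ** Dmat G i (opp i) ** Pi0 (opp i)
         + 2 *\<^sub>R Pi1 i 0"

definition E2 ::
  "('n::finite,'m1::finite,'m2::finite) delay_game \<Rightarrow> (player \<Rightarrow> real^'n^'n) \<Rightarrow>
   (player \<Rightarrow> real \<Rightarrow> real^'n^'n) \<Rightarrow> (player \<Rightarrow> real \<Rightarrow> real \<Rightarrow> real^'n^'n) \<Rightarrow> player \<Rightarrow> bool" where
  "E2 G Pi0 Pi1 Pi2 i \<longleftrightarrow> (\<forall>\<theta>\<in>delay_interval G.
     (Pi1 i has_vector_derivative
        (transpose (A0 G) ** Pi1 i \<theta> + Phi1 G i \<theta> + Pi2 i 0 \<theta>
         + Pi0 i ** Dmat G i i ** Pi1 i \<theta>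
         + Pi0 (opp i) ** Dmat G i (opp i) ** Pi1 (opp i) \<theta>
         - 2 *\<^sub>R (Pi0 i ** Cmat G i ** Pi1 i \<theta>)
         - Pi0 i ** Cmat G (opp i) ** Pi1 (opp i) \<theta>
         - Pi0 (opp i) ** Cmat G (opp i) ** Pi1 i \<theta>))
     (at \<theta> within delay_interval G))"

(* Classical partial derivatives are required off the diagonal only: a continuous solution
   that is symmetric in the sense of regular_unknowns has in general a kink on the line \<xi> = \<theta>. *)
definition E3 ::
  "('n::finite,'m1::finite,'m2::finite) delay_game \<Rightarrow>
   (player \<Rightarrow> real \<Rightarrow> real^'n^'n) \<Rightarrow> (player \<Rightarrow> real \<Rightarrow> real \<Rightarrow> real^'n^'n) \<Rightarrow> player \<Rightarrow> bool" where
  "E3 G Pi1 Pi2 i \<longleftrightarrow> (\<forall>\<xi>\<in>delay_interval G. \<forall>\<theta>\<in>delay_interval G. \<xi> \<noteq> \<theta> \<longrightarrow>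
     (\<exists>D\<^sub>\<xi> D\<^sub>\<theta>.
        ((\<lambda>s. Pi2 i s \<theta>) has_vector_derivative D\<^sub>\<xi>) (at \<xi> within delay_interval G) \<and>
        ((\<lambda>s. Pi2 i \<xi> s) has_vector_derivative D\<^sub>\<theta>) (at \<theta> within delay_interval G) \<and>
        D\<^sub>\<xi> + D\<^sub>\<theta> =
          Phi2 G i \<xi> \<theta>
          + transpose (Pi1 i \<xi>) ** Dmat G i i ** Pi1 i \<theta>
          + transpose (Pi1 (opp i) \<xi>) ** Dmat G i (opp i) ** Pi1 (opp i) \<theta>
          - 2 *\<^sub>R (transpose (Pi1 i \<xi>) ** Cmat G i ** Pi1 i \<theta>)
          - 2 *\<^sub>R (transpose (Pi1 (opp i) \<xi>) ** Cmat G (opp i) ** Pi1 i \<theta>)))"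

definition E4 ::
  "('n::finite,'m1::finite,'m2::finite) delay_game \<Rightarrow>
   (player \<Rightarrow> real \<Rightarrow> real^'n^'n) \<Rightarrow> (player \<Rightarrow> real \<Rightarrow> real \<Rightarrow> real^'n^'n) \<Rightarrow> player \<Rightarrow> bool" where
  "E4 G Pi1 Pi2 i \<longleftrightarrow>
     (\<forall>\<theta>\<in>delay_interval G. transpose (A1 G) ** Pi1 i \<theta> = Pi2 i (- delay G) \<theta>)"

definition E5 ::
  "('n::finite,'m1::finite,'m2::finite) delay_game \<Rightarrow> (player \<Rightarrow> real^'n^'n) \<Rightarrow>
   (player \<Rightarrow> real \<Rightarrow> real^'n^'n) \<Rightarrow> player \<Rightarrow> bool" where
  "E5 G Pi0 Pi1 i \<longleftrightarrow> Pi0 i ** A1 G = Pi1 i (- delay G)"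

definition Fmat ::
  "('n::finite,'m1::finite,'m2::finite) delay_game \<Rightarrow> (player \<Rightarrow> real^'n^'n) \<Rightarrow> player \<Rightarrow> real^'n^'n" where
  "Fmat G Pi0 i = transpose (A0 G) + Pi0 i ** (Dmat G i i - 2 *\<^sub>R Cmat G i)"

(* For Pi1(\<theta>) = exp (F(\<theta>+h)) Pi0 A1, Psi(\<xi>) Pi1(\<theta>) and its counterpart Pi1(\<xi>)^T Psi(\<theta>)^T both equal
   A1^T Pi0 A1 at \<xi> = \<theta>; either one gives the continuous value of Pi2 on the diagonal. *)
definition Psi ::
  "('n::finite,'m1::finite,'m2::finite) delay_game \<Rightarrow> (player \<Rightarrow> real^'n^'n) \<Rightarrow> player \<Rightarrow> real \<Rightarrow> real^'n^'n" where
  "Psi G Pi0 i \<xi> = transpose (A1 G) ** matrix_exp (- ((\<xi> + delay G) *\<^sub>R Fmat G Pi0 i))"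


section \<open>Trajectories, admissibility and Nash strategies\<close>

definition piecewise_continuous_on :: "real \<Rightarrow> real \<Rightarrow> (real \<Rightarrow> 'a::topological_space) \<Rightarrow> bool" where
  "piecewise_continuous_on a b f \<longleftrightarrow>
     (\<exists>S. finite S \<and> continuous_on ({a..b} - S) f) \<and>
     (\<forall>s\<in>{a<..b}. \<exists>l. (f \<longlongrightarrow> l) (at_left s)) \<and>
     (\<forall>s\<in>{a..<b}. \<exists>l. (f \<longlongrightarrow> l) (at_right s))"

definition initial_function ::
  "('n::finite,'m1::finite,'m2::finite) delay_game \<Rightarrow> (real \<Rightarrow> real^'n) \<Rightarrow> bool" where
  "initial_function G \<phi> \<longleftrightarrow> piecewise_continuous_on (- delay G) 0 \<phi>"

(* The state x_t. Because of restrict it carries no information on x outside [t-h, t], so every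
   HOL function of it is a feedback of the state. *)
definition state ::
  "('n::finite,'m1::finite,'m2::finite) delay_game \<Rightarrow> (real \<Rightarrow> real^'n) \<Rightarrow> real \<Rightarrow> (real \<Rightarrow> real^'n)" where
  "state G x t = restrict (\<lambda>\<theta>. x (t + \<theta>)) (delay_interval G)"

(* A jump of \<phi> at s produces a corner of x at s + h, hence the finite exceptional set. *)
definition closed_loop_solution ::
  "('n::finite,'m1::finite,'m2::finite) delay_game \<Rightarrow>
   ((real \<Rightarrow> real^'n) \<Rightarrow> real^'m1) \<Rightarrow> ((real \<Rightarrow> real^'n) \<Rightarrow> real^'m2) \<Rightarrow>
   (real \<Rightarrow> real^'n) \<Rightarrow> (real \<Rightarrow> real^'n) \<Rightarrow> bool" where
  "closed_loop_solution G u1 u2 \<phi> x \<longleftrightarrow>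
     (\<forall>\<theta>\<in>delay_interval G. x \<theta> = \<phi> \<theta>) \<and>
     continuous_on {0..} x \<and>
     (\<exists>S. finite S \<and> (\<forall>t\<in>{0..} - S.
        (x has_vector_derivative
           (A0 G *v x t + A1 G *v x (t - delay G)
            + B1 G *v u1 (state G x t) + B2 G *v u2 (state G x t)))
        (at t within {0..})))"

(* Attraction is required for every initial function: the performance indices are compared
   for all of them. *)
definition asymptotically_stable ::
  "('n::finite,'m1::finite,'m2::finite) delay_game \<Rightarrow>
   ((real \<Rightarrow> real^'n) \<Rightarrow> real^'m1) \<Rightarrow> ((real \<Rightarrow> real^'n) \<Rightarrow> real^'m2) \<Rightarrow> bool" where
  "asymptotically_stable G u1 u2 \<longleftrightarrow>
     closed_loop_solution G u1 u2 (\<lambda>_. 0) (\<lambda>_. 0) \<and>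
     (\<forall>\<epsilon>>0. \<exists>\<delta>>0. \<forall>\<phi> x.
        initial_function G \<phi> \<longrightarrow> closed_loop_solution G u1 u2 \<phi> x \<longrightarrow>
        (\<forall>\<theta>\<in>delay_interval G. norm (\<phi> \<theta>) < \<delta>) \<longrightarrow> (\<forall>t\<ge>0. norm (x t) < \<epsilon>)) \<and>
     (\<forall>\<phi> x. initial_function G \<phi> \<longrightarrow> closed_loop_solution G u1 u2 \<phi> x \<longrightarrow>
        (x \<longlongrightarrow> 0) at_top)"

definition admissible ::
  "('n::finite,'m1::finite,'m2::finite) delay_game \<Rightarrow>
   ((real \<Rightarrow> real^'n) \<Rightarrow> real^'m1) \<Rightarrow> ((real \<Rightarrow> real^'n) \<Rightarrow> real^'m2) \<Rightarrow> bool" where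
  "admissible G u1 u2 \<longleftrightarrow>
     (\<forall>\<phi>. initial_function G \<phi> \<longrightarrow>
        (\<exists>x. closed_loop_solution G u1 u2 \<phi> x) \<and>
        (\<forall>x y. closed_loop_solution G u1 u2 \<phi> x \<longrightarrow> closed_loop_solution G u1 u2 \<phi> y \<longrightarrow>
           (\<forall>t\<ge>- delay G. x t = y t))) \<and>
     asymptotically_stable G u1 u2 \<and>
     (\<forall>\<phi> x. initial_function G \<phi> \<longrightarrow> closed_loop_solution G u1 u2 \<phi> x \<longrightarrow>
        continuous_on {0..} (\<lambda>t. u1 (state G x t)) \<and>
        continuous_on {0..} (\<lambda>t. u2 (state G x t)))"

definition running_cost ::
  "('n::finite,'m1::finite,'m2::finite) delay_game \<Rightarrow> player \<Rightarrow>
   (real \<Rightarrow> real^'n) \<Rightarrow> (real \<Rightarrow> real^'m1) \<Rightarrow> (real \<Rightarrow> real^'m2) \<Rightarrow> real \<Rightarrow> real" where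
  "running_cost G i x v1 v2 t =
     x t \<bullet> (Phi0 G i *v x t)
     + 2 * (x t \<bullet> integral (delay_interval G) (\<lambda>\<theta>. Phi1 G i \<theta> *v x (t + \<theta>)))
     + integral (delay_interval G) (\<lambda>\<theta>. integral (delay_interval G) (\<lambda>\<xi>.
         x (t + \<xi>) \<bullet> (Phi2 G i \<xi> \<theta> *v x (t + \<theta>))))
     + v1 t \<bullet> (R1 G i *v v1 t) + v2 t \<bullet> (R2 G i *v v2 t)"

(* J is the value of the performance index J_i(\<phi>, u1, u2), an improper integral. The integrand
   need not have a sign, and the value may be infinite. *)
definition has_performance ::
  "('n::finite,'m1::finite,'m2::finite) delay_game \<Rightarrow> player \<Rightarrow> (real \<Rightarrow> real^'n) \<Rightarrow>
   ((real \<Rightarrow> real^'n) \<Rightarrow> real^'m1) \<Rightarrow> ((real \<Rightarrow> real^'n) \<Rightarrow> real^'m2) \<Rightarrow> ereal \<Rightarrow> bool" where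
  "has_performance G i \<phi> u1 u2 J \<longleftrightarrow>
     (\<exists>x. closed_loop_solution G u1 u2 \<phi> x \<and>
        (let L = running_cost G i x (\<lambda>t. u1 (state G x t)) (\<lambda>t. u2 (state G x t))
         in (\<forall>T\<ge>0. L integrable_on {0..T}) \<and>
            ((\<lambda>T. ereal (integral {0..T} L)) \<longlongrightarrow> J) at_top))"

definition nash_strategies ::
  "('n::finite,'m1::finite,'m2::finite) delay_game \<Rightarrow>
   ((real \<Rightarrow> real^'n) \<Rightarrow> real^'m1) \<Rightarrow> ((real \<Rightarrow> real^'n) \<Rightarrow> real^'m2) \<Rightarrow> bool" where
  "nash_strategies G u1 u2 \<longleftrightarrow>
     admissible G u1 u2 \<and>
     (\<forall>\<phi>. initial_function G \<phi> \<longrightarrow>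
        (\<exists>J::real. has_performance G P1 \<phi> u1 u2 (ereal J) \<and>
           (\<forall>w. admissible G w u2 \<longrightarrow>
              (\<exists>J'. has_performance G P1 \<phi> w u2 J' \<and> ereal J \<le> J'))) \<and>
        (\<exists>J::real. has_performance G P2 \<phi> u1 u2 (ereal J) \<and>
           (\<forall>w. admissible G u1 w \<longrightarrow>
              (\<exists>J'. has_performance G P2 \<phi> u1 w J' \<and> ereal J \<le> J'))))"

definition feedback1 ::
  "('n::finite,'m1::finite,'m2::finite) delay_game \<Rightarrow> (player \<Rightarrow> real^'n^'n) \<Rightarrow>
   (player \<Rightarrow> real \<Rightarrow> real^'n^'n) \<Rightarrow> (real \<Rightarrow> real^'n) \<Rightarrow> real^'m1" where
  "feedback1 G Pi0 Pi1 s =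
     - ((matrix_inv (R1 G P1) ** transpose (B1 G) ** Pi0 P1) *v s 0)
     - (matrix_inv (R1 G P1) ** transpose (B1 G))
         *v integral (delay_interval G) (\<lambda>\<theta>. Pi1 P1 \<theta> *v s \<theta>)"

definition feedback2 ::
  "('n::finite,'m1::finite,'m2::finite) delay_game \<Rightarrow> (player \<Rightarrow> real^'n^'n) \<Rightarrow>
   (player \<Rightarrow> real \<Rightarrow> real^'n^'n) \<Rightarrow> (real \<Rightarrow> real^'n) \<Rightarrow> real^'m2" where
  "feedback2 G Pi0 Pi1 s =
     - ((matrix_inv (R2 G P2) ** transpose (B2 G) ** Pi0 P2) *v s 0)
     - (matrix_inv (R2 G P2) ** transpose (B2 G))
         *v integral (delay_interval G) (\<lambda>\<theta>. Pi1 P2 \<theta> *v s \<theta>)"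

end

theory Submission
  imports Defs
begin

text \<open>
  For these weights the terms of (E1)--(E3) that couple the two players cancel, leaving a Riccati equation
  and the linear transport equations solved by the matrix exponential. On such a solution the functional
  \<open>V\<^sub>i(x\<^sub>t) = x\<^sup>T \<Pi>\<^sub>i\<^sub>0 x + 2 x\<^sup>T \<integral> \<Pi>\<^sub>i\<^sub>1 x + \<integral>\<integral> x\<^sup>T \<Pi>\<^sub>i\<^sub>2 x\<close> satisfies, when the opponent plays its
  feedback, \<open>dV\<^sub>i/dt + L\<^sub>i = (u\<^sub>i - u\<^sub>i\<^sup>*)\<^sup>T R\<^sub>i\<^sub>i (u\<^sub>i - u\<^sub>i\<^sup>*)\<close> for the integrand \<open>L\<^sub>i\<close> of \<open>J\<^sub>i\<close>. Integrating, and using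
  \<open>V\<^sub>i \<rightarrow> 0\<close> along an asymptotically stable closed loop, gives \<open>J\<^sub>i = V\<^sub>i(\<phi>) + \<integral> (u\<^sub>i - u\<^sub>i\<^sup>*)\<^sup>T R\<^sub>i\<^sub>i (u\<^sub>i - u\<^sub>i\<^sup>*)\<close>.
  As all kernels are exponentials, the delay integrals are increments of primitives multiplied by an
  exponential, hence differentiable wherever \<open>x(t)\<close> and \<open>x(t-h)\<close> are continuous.
\<close>

subsection \<open>Matrix products and the matrix exponential\<close>

text \<open>Initial functions may jump, so a trajectory satisfies its equation only off finitely
  many times, and its delayed values jump again one delay later. The value functional is therefore
  differentiated only at times where \<open>x\<close> is continuous at both \<open>t\<close> and
  \<open>t - h\<close>; being continuous throughout, it still obeys the fundamental theorem of
  calculus with a finite exceptional set. The square can be completed because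
  \<open>Dmat G i i = Cmat G i\<close>, so that the bracket in the Riccati equation is
  \<open>- Cmat G i\<close>, and because the feedback is the inverse control weight applied to half
  the gradient of the functional in \<open>x t\<close>. The square along a deviation may have
  infinite integral, so its limit is taken in the extended reals; only the part coming from the
  functional has to stay finite. Deviations are arbitrary feedback laws and enter through the
  trajectory they produce, its decay and the continuity of the control. Stability of the closed loop
  is a premise. Existence, uniqueness and continuity of the controls are derived, by a contraction
  in a norm weighted with a decaying exponential.\<close>

lemma bounded_bilinear_matrix_vector_mult:
  "bounded_bilinear ((*v) :: real^'n^'m \<Rightarrow> real^'n \<Rightarrow> real^'m)"
  unfolding bilinear_conv_bounded_bilinear[symmetric] bilinear_def
  by (auto intro!: linearI simp: algebra_simps scaleR_matrix_vector_assoc)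

lemma matrix_mult_scaleR_left: "(c *\<^sub>R A) ** B = c *\<^sub>R (A ** B)" for A :: "real^'n^'m"
  by (simp add: matrix_matrix_mult_def vec_eq_iff sum_distrib_left mult.assoc)

lemma matrix_mult_scaleR_right: "A ** (c *\<^sub>R B) = c *\<^sub>R (A ** B)" for A :: "real^'n^'m"
  by (simp add: matrix_matrix_mult_def vec_eq_iff sum_distrib_left mult.left_commute)

lemma matrix_add_rdistrib': "(A + B) ** C = A ** C + B ** C" for A :: "real^'n^'m"
  by (simp add: matrix_matrix_mult_def vec_eq_iff distrib_right sum.distrib)

lemma bounded_bilinear_matrix_mult:
  "bounded_bilinear ((**) :: real^'n^'m \<Rightarrow> real^'k^'n \<Rightarrow> real^'k^'m)"
  unfolding bilinear_conv_bounded_bilinear[symmetric] bilinear_def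
  by (auto intro!: linearI simp: matrix_mult_scaleR_left matrix_mult_scaleR_right
      matrix_add_ldistrib matrix_add_rdistrib')

lemmas matrix_mult_diff_left = bounded_bilinear.diff_left[OF bounded_bilinear_matrix_mult]
lemmas matrix_mult_diff_right = bounded_bilinear.diff_right[OF bounded_bilinear_matrix_mult]
lemmas matrix_mult_minus_left = bounded_bilinear.minus_left[OF bounded_bilinear_matrix_mult]
lemmas matrix_mult_minus_right = bounded_bilinear.minus_right[OF bounded_bilinear_matrix_mult]
lemmas matrix_vector_minus_left = bounded_bilinear.minus_left[OF bounded_bilinear_matrix_vector_mult]
lemmas matrix_vector_minus_right = bounded_bilinear.minus_right[OF bounded_bilinear_matrix_vector_mult]
lemmas continuous_on_matrix_mult = bounded_bilinear.continuous_on[OF bounded_bilinear_matrix_mult]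
lemmas continuous_on_matrix_vector_mult =
  bounded_bilinear.continuous_on[OF bounded_bilinear_matrix_vector_mult]

lemma inner_matrix_left: "(A *v x) \<bullet> y = x \<bullet> (transpose A *v y)" for A :: "real^'n^'m"
  by (metis dot_lmul_matrix vector_transpose_matrix inner_commute)

lemma bounded_linear_transpose: "bounded_linear (transpose :: real^'n^'m \<Rightarrow> real^'m^'n)"
  unfolding linear_conv_bounded_linear[symmetric]
  by (rule linearI) (auto simp: transpose_def vec_eq_iff)

lemmas transpose_scaleR = linear_scale[OF bounded_linear.linear[OF bounded_linear_transpose]]
lemmas transpose_minus = linear_neg[OF bounded_linear.linear[OF bounded_linear_transpose]]
lemmas continuous_on_transpose = bounded_linear.continuous_on[OF bounded_linear_transpose]

section \<open>Matrix powers, the exponential series and its group law\<close>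

lemma matrix_power_commute: "matrix_power M k ** M = M ** matrix_power M k"
  by (induction k) (simp_all add: matrix_mul_assoc[symmetric])

lemma matrix_power_scaleR: "matrix_power (t *\<^sub>R M) k = t ^ k *\<^sub>R matrix_power M k"
  by (induction k) (simp_all add: matrix_mult_scaleR_left matrix_mult_scaleR_right)

lemma transpose_matrix_power: "transpose (matrix_power M k) = matrix_power (transpose M) k"
  by (induction k) (simp_all add: matrix_transpose_mul matrix_power_commute transpose_mat)

text \<open>The matrix norm in use is bounded on products only up to a constant \<open>K\<close>,
  which the base \<open>C\<close> of the geometric bound absorbs; the factor
  \<open>norm (mat 1)\<close> is the case \<open>k = 0\<close>.\<close>

lemma matrix_power_bound:
  fixes M :: "real^'n^'n"
  obtains C where "C > 0" "\<And>k. norm (matrix_power M k) \<le> norm (mat 1 :: real^'n^'n) * C ^ k"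
proof -
  obtain K where K: "K > 0" "\<And>(A :: real^'n^'n) (B :: real^'n^'n). norm (A ** B) \<le> norm A * norm B * K"
    using bounded_bilinear.pos_bounded[OF bounded_bilinear_matrix_mult] by blast
  \<comment> \<open>The \<open>+ 1\<close> keeps \<open>C\<close> positive even for
    \<open>M = 0\<close>.\<close>
  define C where "C = norm M * K + 1"
  have C: "C > 0" using K(1) by (simp add: C_def add_nonneg_pos)
  have "norm (matrix_power M k) \<le> norm (mat 1 :: real^'n^'n) * C ^ k" for k
  proof (induction k)
    case (Suc k)
    have "norm (matrix_power M (Suc k)) \<le> (norm M * K) * norm (matrix_power M k)"
      using K(2)[of M "matrix_power M k"] by (simp add: ac_simps)
    also have "\<dots> \<le> C * (norm (mat 1 :: real^'n^'n) * C ^ k)"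
      using Suc K(1) C by (intro mult_mono) (auto simp: C_def)
    finally show ?case by (simp add: ac_simps)
  qed simp
  with C show thesis using that by blast
qed

text \<open>The scalar exponential series of \<open>\<bar>t\<bar> * C\<close> dominates, with
  \<open>C\<close> the base of the geometric bound on powers.\<close>

lemma summable_matrix_exp:
  fixes M :: "real^'n^'n"
  shows "summable (\<lambda>k. (t ^ k / fact k) *\<^sub>R matrix_power M k)"
proof -
  obtain C where C: "C > 0" "\<And>k. norm (matrix_power M k) \<le> norm (mat 1 :: real^'n^'n) * C ^ k"
    using matrix_power_bound by blast
  show ?thesis
  proof (rule summable_comparison_test')
    show "summable (\<lambda>k. norm (mat 1 :: real^'n^'n) * (inverse (fact k) * (\<bar>t\<bar> * C) ^ k))"
      by (intro summable_mult summable_exp)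
    show "norm ((t ^ k / fact k) *\<^sub>R matrix_power M k)
        \<le> norm (mat 1 :: real^'n^'n) * (inverse (fact k) * (\<bar>t\<bar> * C) ^ k)" if "k \<ge> 0" for k
    proof -
      have "norm ((t ^ k / fact k) *\<^sub>R matrix_power M k) = (\<bar>t\<bar> ^ k / fact k) * norm (matrix_power M k)"
        by (simp add: power_abs)
      also have "\<dots> \<le> (\<bar>t\<bar> ^ k / fact k) * (norm (mat 1 :: real^'n^'n) * C ^ k)"
        using C(2) by (intro mult_left_mono) auto
      finally show ?thesis
        by (simp add: power_mult_distrib divide_inverse ac_simps)
    qed
  qed
qed

lemma matrix_exp_scaleR: "matrix_exp (t *\<^sub>R M) = (\<Sum>k. (t ^ k / fact k) *\<^sub>R matrix_power M k)"
  unfolding matrix_exp_def matrix_power_scaleR by simp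

lemma matrix_exp_sums: "(\<lambda>k. (t ^ k / fact k) *\<^sub>R matrix_power M k) sums matrix_exp (t *\<^sub>R M)"
  unfolding matrix_exp_scaleR by (rule summable_sums[OF summable_matrix_exp])

text \<open>A matrix is a vector of rows, so two applications reduce differentiation of a matrix
  function to that of its real entries.\<close>

lemma has_vector_derivative_vec:
  fixes f :: "real \<Rightarrow> 'a::euclidean_space^'m"
  assumes "\<And>i. ((\<lambda>t. f t $ i) has_vector_derivative f' $ i) (at t within S)"
  shows "(f has_vector_derivative f') (at t within S)"
  unfolding has_vector_derivative_def has_derivative_componentwise_within[of f]
proof
  fix b :: "'a^'m" assume "b \<in> Basis"
  then obtain i u where b: "b = axis i u" by (auto simp: Basis_vec_def)
  have "((\<lambda>t. f t $ i \<bullet> u) has_vector_derivative f' $ i \<bullet> u) (at t within S)"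
    by (rule bounded_linear.has_vector_derivative[OF bounded_linear_inner_left assms])
  then show "((\<lambda>x. f x \<bullet> b) has_derivative (\<lambda>x. (x *\<^sub>R f') \<bullet> b)) (at t within S)"
    by (simp add: b inner_axis has_vector_derivative_def)
qed

text \<open>Entrywise, the exponential series is a real power series in \<open>t\<close>.\<close>

lemma matrix_exp_has_vector_derivative_at:
  "((\<lambda>t. matrix_exp (t *\<^sub>R M)) has_vector_derivative M ** matrix_exp (t *\<^sub>R M)) (at t)"
proof (intro has_vector_derivative_vec)
  fix i j
  define c where "c k = matrix_power M k $ i $ j / fact k" for k
  have entry: "matrix_exp (s *\<^sub>R M) $ i $ j = (\<Sum>k. c k * s ^ k)"
    and summ: "summable (\<lambda>k. c k * s ^ k)" for s
  proof -
    have "(\<lambda>k. ((s ^ k / fact k) *\<^sub>R matrix_power M k) $ i $ j) sums (matrix_exp (s *\<^sub>R M) $ i $ j)"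
      by (intro bounded_linear.sums[OF bounded_linear_vec_nth] matrix_exp_sums)
    then have "(\<lambda>k. c k * s ^ k) sums (matrix_exp (s *\<^sub>R M) $ i $ j)"
      by (simp add: c_def ac_simps)
    then show "matrix_exp (s *\<^sub>R M) $ i $ j = (\<Sum>k. c k * s ^ k)" "summable (\<lambda>k. c k * s ^ k)"
      by (auto simp: sums_iff)
  qed
  \<comment> \<open>The index shift of the differentiated power series turns
    \<open>(k+1) / (k+1)!\<close> into \<open>1 / k!\<close> and the power \<open>k+1\<close> into
    \<open>M\<close> times the power \<open>k\<close>.\<close>
  have diffs: "diffs c k * t ^ k = (M ** ((t ^ k / fact k) *\<^sub>R matrix_power M k)) $ i $ j" for k
    by (simp add: diffs_def c_def matrix_mult_scaleR_right fact_Suc del: of_nat_Suc)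
  have "(\<lambda>k. M ** ((t ^ k / fact k) *\<^sub>R matrix_power M k)) sums (M ** matrix_exp (t *\<^sub>R M))"
    by (intro bounded_linear.sums[OF bounded_bilinear.bounded_linear_right[OF bounded_bilinear_matrix_mult]]
        matrix_exp_sums)
  then have "(\<lambda>k. (M ** ((t ^ k / fact k) *\<^sub>R matrix_power M k)) $ i $ j)
      sums ((M ** matrix_exp (t *\<^sub>R M)) $ i $ j)"
    by (intro bounded_linear.sums[OF bounded_linear_vec_nth])
  then have "(\<Sum>k. diffs c k * t ^ k) = (M ** matrix_exp (t *\<^sub>R M)) $ i $ j"
    unfolding diffs[symmetric] by (auto simp: sums_iff)
  then show "((\<lambda>s. matrix_exp (s *\<^sub>R M) $ i $ j) has_vector_derivative
      (M ** matrix_exp (t *\<^sub>R M)) $ i $ j) (at t)"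
    using termdiffs_strong_converges_everywhere[of c t, OF summ]
    by (simp add: entry has_real_derivative_iff_has_vector_derivative)
qed

lemma matrix_exp_commute: "matrix_exp (t *\<^sub>R M) ** M = M ** matrix_exp (t *\<^sub>R M)"
proof -
  have "(\<lambda>k. ((t ^ k / fact k) *\<^sub>R matrix_power M k) ** M) sums (matrix_exp (t *\<^sub>R M) ** M)"
    by (intro bounded_linear.sums[OF bounded_bilinear.bounded_linear_left[OF bounded_bilinear_matrix_mult]]
        matrix_exp_sums)
  moreover have "(\<lambda>k. M ** ((t ^ k / fact k) *\<^sub>R matrix_power M k)) sums (M ** matrix_exp (t *\<^sub>R M))"
    by (intro bounded_linear.sums[OF bounded_bilinear.bounded_linear_right[OF bounded_bilinear_matrix_mult]]
        matrix_exp_sums)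
  ultimately show ?thesis
    by (simp add: matrix_mult_scaleR_left matrix_mult_scaleR_right matrix_power_commute sums_iff)
qed

lemma matrix_exp_has_vector_derivative:
  fixes M :: "real^'n^'n"
  assumes "(g has_real_derivative c) (at t within S)"
  shows "((\<lambda>t. matrix_exp (g t *\<^sub>R M)) has_vector_derivative c *\<^sub>R (M ** matrix_exp (g t *\<^sub>R M)))
    (at t within S)"
  using vector_diff_chain_within[of g c t S, OF _ has_vector_derivative_at_within[OF
      matrix_exp_has_vector_derivative_at[of M "g t"]]] assms
  by (simp add: has_real_derivative_iff_has_vector_derivative o_def)

lemma continuous_on_matrix_exp:
  assumes "continuous_on S g"
  shows "continuous_on S (\<lambda>t. matrix_exp (g t *\<^sub>R M))"
proof -
  have "continuous_on UNIV (\<lambda>t. matrix_exp (t *\<^sub>R M))"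
    by (intro continuous_at_imp_continuous_on ballI
        has_vector_derivative_continuous[OF matrix_exp_has_vector_derivative_at])
  from continuous_on_compose2[OF this assms] show ?thesis by simp
qed

lemma matrix_exp_zero [simp]: "matrix_exp (0 :: real^'n^'n) = mat 1"
proof -
  have "(\<lambda>k. (0 ^ k / fact k) *\<^sub>R matrix_power (0 :: real^'n^'n) k)
      = (\<lambda>k. if k = 0 then mat 1 else 0)"
    by (auto simp: fun_eq_iff)
  then have "(\<lambda>k. if k = 0 then mat 1 else 0) sums matrix_exp (0 :: real^'n^'n)"
    using matrix_exp_sums[of 0 "0 :: real^'n^'n"] by simp
  from sums_unique2[OF this sums_single[of 0 "\<lambda>_. mat 1"]] show ?thesis .
qed

text \<open>The left side has zero derivative in \<open>t\<close>, since \<open>M\<close> commutes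
  with its exponential, and so equals its value at \<open>t = 0\<close>. This gives the group law
  and the inverse together, without a product of series.\<close>

lemma matrix_exp_neg_mult: "matrix_exp ((- t) *\<^sub>R M) ** matrix_exp ((t + s) *\<^sub>R M) = matrix_exp (s *\<^sub>R M)"
proof -
  have "((\<lambda>t. matrix_exp ((- t) *\<^sub>R M) ** matrix_exp ((t + s) *\<^sub>R M)) has_vector_derivative 0)
      (at r within UNIV)" for r
  proof -
    have "((\<lambda>t. matrix_exp ((- t) *\<^sub>R M) ** matrix_exp ((t + s) *\<^sub>R M)) has_vector_derivative
        (matrix_exp ((- r) *\<^sub>R M) ** (1 *\<^sub>R (M ** matrix_exp ((r + s) *\<^sub>R M)))
         + ((- 1) *\<^sub>R (M ** matrix_exp ((- r) *\<^sub>R M))) ** matrix_exp ((r + s) *\<^sub>R M)))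
      (at r within UNIV)"
      by (intro bounded_bilinear.has_vector_derivative[OF bounded_bilinear_matrix_mult]
          matrix_exp_has_vector_derivative) (auto intro!: derivative_eq_intros)
    moreover have "matrix_exp ((- r) *\<^sub>R M) ** (1 *\<^sub>R (M ** matrix_exp ((r + s) *\<^sub>R M)))
         + ((- 1) *\<^sub>R (M ** matrix_exp ((- r) *\<^sub>R M))) ** matrix_exp ((r + s) *\<^sub>R M) = 0"
      unfolding matrix_exp_commute[of "- r", symmetric] matrix_mul_assoc matrix_mult_scaleR_left
      by (simp add: matrix_mul_assoc)
    ultimately show ?thesis by (simp only:)
  qed
  note deriv = this
  obtain c where c: "\<And>x. x \<in> UNIV \<Longrightarrow> matrix_exp ((- x) *\<^sub>R M) ** matrix_exp ((x + s) *\<^sub>R M) = c"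
    by (rule has_vector_derivative_zero_constant[OF convex_UNIV deriv]) blast
  have "matrix_exp ((- t) *\<^sub>R M) ** matrix_exp ((t + s) *\<^sub>R M)
      = matrix_exp ((- 0) *\<^sub>R M) ** matrix_exp ((0 + s) *\<^sub>R M)"
    by (rule trans[OF c[OF UNIV_I] c[OF UNIV_I, symmetric]])
  then show ?thesis by simp
qed

lemma matrix_exp_add: "matrix_exp ((s + t) *\<^sub>R M) = matrix_exp (s *\<^sub>R M) ** matrix_exp (t *\<^sub>R M)"
  using matrix_exp_neg_mult[of "- s" M "s + t"] by simp

lemma transpose_matrix_exp: "transpose (matrix_exp M) = matrix_exp (transpose M)"
proof -
  have "(\<lambda>k. transpose ((1 ^ k / fact k) *\<^sub>R matrix_power M k)) sums transpose (matrix_exp (1 *\<^sub>R M))"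
    by (rule bounded_linear.sums[OF bounded_linear_transpose matrix_exp_sums])
  then have "(\<lambda>k. (1 ^ k / fact k) *\<^sub>R matrix_power (transpose M) k) sums transpose (matrix_exp (1 *\<^sub>R M))"
    unfolding transpose_scaleR transpose_matrix_power .
  from sums_unique2[OF this matrix_exp_sums] show ?thesis
    unfolding scaleR_one .
qed

subsection \<open>Piecewise continuous functions\<close>

text \<open>Local boundedness stands in for one-sided limits: it suffices for integrability and
  survives products, sums, shifts and integration. At \<open>a\<close> itself only boundedness is
  asked. One finite exceptional set serves the whole half line, as the jumps of a trajectory all
  stem from its initial function.\<close>

definition pw_cont :: "real \<Rightarrow> (real \<Rightarrow> 'a::real_normed_vector) \<Rightarrow> bool" where
  "pw_cont a f \<longleftrightarrow>
     (\<exists>S. finite S \<and> (\<forall>t>a. t \<notin> S \<longrightarrow> isCont f t)) \<and> (\<forall>b. bounded (f ` {a..b}))"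

lemma pw_cont_bounded: "pw_cont a f \<Longrightarrow> bounded (f ` {a..b})"
  by (simp add: pw_cont_def)

lemma pw_cont_obtain_bound:
  assumes "pw_cont a f"
  obtains B where "B \<ge> 0" "\<And>t. t \<in> {a..b} \<Longrightarrow> norm (f t) \<le> B"
proof -
  obtain B where "B > 0" "\<forall>y\<in>f ` {a..b}. norm y \<le> B"
    using pw_cont_bounded[OF assms] bounded_pos by blast
  then show thesis by (intro that[of B]) auto
qed

lemma pw_cont_mono: "pw_cont a f \<Longrightarrow> a \<le> b \<Longrightarrow> pw_cont b f"
proof -
  assume f: "pw_cont a f" and ab: "a \<le> b"
  have "bounded (f ` {b..c})" for c
    by (rule bounded_subset[OF pw_cont_bounded[OF f, of c]]) (use ab in auto)
  moreover obtain S where "finite S" "\<forall>t>a. t \<notin> S \<longrightarrow> isCont f t"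
    using f unfolding pw_cont_def by blast
  ultimately show "pw_cont b f"
    unfolding pw_cont_def using order_le_less_trans[OF ab] by blast
qed

lemma continuous_imp_pw_cont: "continuous_on UNIV f \<Longrightarrow> pw_cont a f"
  unfolding pw_cont_def
  by (auto intro!: exI[of _ "{}"] compact_imp_bounded compact_continuous_image
      continuous_at_imp_continuous_on simp: continuous_on_eq_continuous_at)

lemma pw_cont_bilinear:
  assumes "bounded_bilinear m" "pw_cont a f" "pw_cont a g"
  shows "pw_cont a (\<lambda>t. m (f t) (g t))"
proof -
  interpret bounded_bilinear m by fact
  obtain S T where "finite S" "\<forall>t>a. t \<notin> S \<longrightarrow> isCont f t" "finite T" "\<forall>t>a. t \<notin> T \<longrightarrow> isCont g t"
    using assms by (auto simp: pw_cont_def)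
  then have "finite (S \<union> T)" "\<forall>t>a. t \<notin> S \<union> T \<longrightarrow> isCont (\<lambda>t. m (f t) (g t)) t"
    by (auto intro!: continuous)
  moreover have "bounded ((\<lambda>t. m (f t) (g t)) ` {a..b})" for b
  proof -
    obtain F where F: "\<And>t. t \<in> {a..b} \<Longrightarrow> norm (f t) \<le> F"
      using pw_cont_obtain_bound[OF assms(2)] by blast
    obtain H where H: "\<And>t. t \<in> {a..b} \<Longrightarrow> norm (g t) \<le> H"
      using pw_cont_obtain_bound[OF assms(3)] by blast
    obtain K where K: "0 \<le> K" "\<And>u v. norm (m u v) \<le> norm u * norm v * K"
      using nonneg_bounded by blast
    have "norm (m (f t) (g t)) \<le> F * H * K" if "t \<in> {a..b}" for t
      using F[OF that] H[OF that] K(1) order_trans[OF norm_ge_zero F[OF that]]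
        order_trans[OF norm_ge_zero H[OF that]]
      by (intro order_trans[OF K(2)] mult_mono) auto
    then show ?thesis
      unfolding bounded_iff ball_simps(9) by (intro exI[of _ "F * H * K"] ballI)
  qed
  ultimately show ?thesis unfolding pw_cont_def by blast
qed

lemma pw_cont_linear:
  assumes "bounded_linear l" "pw_cont a f"
  shows "pw_cont a (\<lambda>t. l (f t))"
proof -
  interpret bounded_linear l by fact
  obtain S where "finite S" "\<forall>t>a. t \<notin> S \<longrightarrow> isCont f t"
    using assms(2) unfolding pw_cont_def by blast
  then show ?thesis
    using bounded_linear_image[OF pw_cont_bounded[OF assms(2)] assms(1)]
    unfolding pw_cont_def by (auto intro!: exI[of _ S] continuous simp: image_image)
qed

lemma pw_cont_add:
  assumes "pw_cont a f" "pw_cont a g"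
  shows "pw_cont a (\<lambda>t. f t + g t)"
proof -
  obtain S T where "finite S" "\<forall>t>a. t \<notin> S \<longrightarrow> isCont f t" "finite T" "\<forall>t>a. t \<notin> T \<longrightarrow> isCont g t"
    using assms by (auto simp: pw_cont_def)
  then have "finite (S \<union> T)" "\<forall>t>a. t \<notin> S \<union> T \<longrightarrow> isCont (\<lambda>t. f t + g t) t"
    by (auto intro!: continuous_intros)
  moreover have "bounded ((\<lambda>t. f t + g t) ` {a..b})" for b
    using assms by (intro bounded_plus_comp pw_cont_bounded)
  ultimately show ?thesis unfolding pw_cont_def by blast
qed

lemma pw_cont_minus: "pw_cont a f \<Longrightarrow> pw_cont a (\<lambda>t. - f t)"
  by (rule pw_cont_linear[OF bounded_linear_minus[OF bounded_linear_ident]])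

lemma pw_cont_diff: "pw_cont a f \<Longrightarrow> pw_cont a g \<Longrightarrow> pw_cont a (\<lambda>t. f t - g t)"
  using pw_cont_add[OF _ pw_cont_minus, of a f g] by simp

lemmas pw_cont_matrix_vector = pw_cont_bilinear[OF bounded_bilinear_matrix_vector_mult]
lemmas pw_cont_const_matrix_vector = pw_cont_linear[OF matrix_vector_mul_bounded_linear]

lemma pw_cont_shift:
  assumes "pw_cont a f"
  shows "pw_cont (a - c) (\<lambda>t. f (c + t))"
proof -
  obtain S where S: "finite S" "\<forall>t>a. t \<notin> S \<longrightarrow> isCont f t"
    using assms by (auto simp: pw_cont_def)
  have "isCont (\<lambda>t. f (c + t)) t" if "t > a - c" "t \<notin> (\<lambda>s. s - c) ` S" for t
  proof (rule isCont_o2[where f = "\<lambda>t. c + t"])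
    show "isCont (\<lambda>t. c + t) t" by (intro continuous_intros)
    show "isCont f (c + t)" using that S(2) by (force simp: image_iff)
  qed
  moreover have "(\<lambda>t. f (c + t)) ` {a - c..b} \<subseteq> f ` {a..b + c}" for b
    by auto
  ultimately show ?thesis
    unfolding pw_cont_def
    by (intro conjI exI[of _ "(\<lambda>s. s - c) ` S"] allI impI finite_imageI S(1)
        bounded_subset[OF pw_cont_bounded[OF assms]])
qed

text \<open>Continuity off a finite set gives measurability there, boundedness then gives
  integrability, and the finite set is negligible.\<close>

lemma bounded_continuous_imp_integrable:
  fixes f :: "real \<Rightarrow> 'a::euclidean_space"
  assumes "finite S" "continuous_on ({a..b} - S) f" "bounded (f ` {a..b})"
  shows "f integrable_on {a..b}"
proof -
  obtain B where B: "\<And>t. t \<in> {a..b} \<Longrightarrow> norm (f t) \<le> B"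
    using assms(3) by (metis bounded_iff imageI)
  have S: "{a..b} - S \<in> sets lebesgue"
    using assms(1) by (intro sets.Diff) (auto intro: negligible_imp_sets)
  have "negligible (({a..b} - S) - {a..b} \<union> ({a..b} - ({a..b} - S)))"
    by (rule negligible_finite, rule finite_subset[OF _ assms(1)]) auto
  note spike = integrable_spike_set_eq[OF this]
  have "f integrable_on ({a..b} - S)"
    by (rule measurable_bounded_by_integrable_imp_integrable[where g = "\<lambda>_. B"])
      (use assms(2) S B in \<open>auto intro: continuous_imp_measurable_on_sets_lebesgue simp: spike\<close>)
  then show ?thesis by (simp add: spike)
qed

lemma pw_cont_integrable:
  fixes f :: "real \<Rightarrow> 'a::euclidean_space"
  assumes "pw_cont a f" "a \<le> c"
  shows "f integrable_on {c..d}"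
proof -
  obtain S where S: "finite S" "\<forall>t>a. t \<notin> S \<longrightarrow> isCont f t"
    using assms by (auto simp: pw_cont_def)
  show ?thesis
  proof (rule bounded_continuous_imp_integrable)
    \<comment> \<open>\<open>pw_cont\<close> says nothing about continuity at \<open>a\<close>, so
      \<open>a\<close> joins the exceptional points.\<close>
    show "finite (insert a S)" using S by simp
    show "continuous_on ({c..d} - insert a S) f"
    proof (rule continuous_at_imp_continuous_on, rule ballI)
      fix t assume "t \<in> {c..d} - insert a S"
      with S(2) assms(2) show "isCont f t" by (metis DiffD1 DiffD2 atLeastAtMost_iff insertCI order.trans order_le_less)
    qed
    show "bounded (f ` {c..d})"
      using pw_cont_bounded[OF pw_cont_mono[OF assms]] .
  qed
qed

text \<open>One-sided limits bound \<open>f\<close> near each point on either side, the point itself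
  adds one value, and finitely many such neighbourhoods cover the compact interval.\<close>

lemma piecewise_continuous_on_imp_bounded:
  fixes f :: "real \<Rightarrow> 'a::real_normed_vector"
  assumes "piecewise_continuous_on a b f"
  shows "bounded (f ` {a..b})"
proof -
  have "\<exists>U. open U \<and> s \<in> U \<and> bounded (f ` (U \<inter> {a..b}))" if s: "s \<in> {a..b}" for s
  proof -
    have left: "\<exists>U. open U \<and> s \<in> U \<and> bounded (f ` (U \<inter> {a..<s}))"
    proof (cases "s = a")
      case True
      then show ?thesis by (intro exI[of _ UNIV]) auto
    next
      case False
      with s have "s \<in> {a<..b}" by auto
      with assms obtain l where "(f \<longlongrightarrow> l) (at_left s)"
        unfolding piecewise_continuous_on_def by blast
      then have "eventually (\<lambda>t. dist (f t) l < 1) (at_left s)"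
        by (rule tendstoD) simp
      then obtain U where "open U" "s \<in> U" "\<forall>t\<in>U. t \<noteq> s \<longrightarrow> t \<in> {..<s} \<longrightarrow> dist (f t) l < 1"
        by (auto simp: eventually_at_topological)
      then have "f ` (U \<inter> {a..<s}) \<subseteq> ball l 1"
        by (auto simp: dist_commute)
      with \<open>open U\<close> \<open>s \<in> U\<close> show ?thesis
        by (intro exI[of _ U] conjI bounded_subset[OF bounded_ball])
    qed
    have right: "\<exists>U. open U \<and> s \<in> U \<and> bounded (f ` (U \<inter> {s<..b}))"
    proof (cases "s = b")
      case True
      then show ?thesis by (intro exI[of _ UNIV]) auto
    next
      case False
      with s have "s \<in> {a..<b}" by auto
      with assms obtain l where "(f \<longlongrightarrow> l) (at_right s)"
        unfolding piecewise_continuous_on_def by blast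
      then have "eventually (\<lambda>t. dist (f t) l < 1) (at_right s)"
        by (rule tendstoD) simp
      then obtain U where "open U" "s \<in> U" "\<forall>t\<in>U. t \<noteq> s \<longrightarrow> t \<in> {s<..} \<longrightarrow> dist (f t) l < 1"
        by (auto simp: eventually_at_topological)
      then have "f ` (U \<inter> {s<..b}) \<subseteq> ball l 1"
        by (auto simp: dist_commute)
      with \<open>open U\<close> \<open>s \<in> U\<close> show ?thesis
        by (intro exI[of _ U] conjI bounded_subset[OF bounded_ball])
    qed
    from left right obtain U V where UV: "open U" "s \<in> U" "bounded (f ` (U \<inter> {a..<s}))"
      "open V" "s \<in> V" "bounded (f ` (V \<inter> {s<..b}))" by blast
    have "(U \<inter> V) \<inter> {a..b} \<subseteq> (U \<inter> {a..<s}) \<union> (V \<inter> {s<..b}) \<union> {s}"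
      by auto
    then have "f ` ((U \<inter> V) \<inter> {a..b}) \<subseteq> f ` (U \<inter> {a..<s}) \<union> f ` (V \<inter> {s<..b}) \<union> {f s}"
      by blast
    moreover have "bounded (f ` (U \<inter> {a..<s}) \<union> f ` (V \<inter> {s<..b}) \<union> {f s})"
      using UV by (simp add: bounded_Un)
    ultimately show ?thesis
      using bounded_subset UV(1,2,4,5) by (intro exI[of _ "U \<inter> V"] conjI open_Int IntI)
  qed
  then have "\<forall>s\<in>{a..b}. \<exists>U. open U \<and> s \<in> U \<and> bounded (f ` (U \<inter> {a..b}))" by (intro ballI)
  from bchoice[OF this] obtain U
    where U: "\<forall>s\<in>{a..b}. open (U s) \<and> s \<in> U s \<and> bounded (f ` (U s \<inter> {a..b}))" ..
  obtain D where D: "D \<subseteq> {a..b}" "finite D" "{a..b} \<subseteq> (\<Union>s\<in>D. U s)"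
    by (rule compactE_image[of "{a..b}" "{a..b}" U]) (use U in auto)
  have "f ` {a..b} \<subseteq> (\<Union>s\<in>D. f ` (U s \<inter> {a..b}))"
    using D(3) by blast
  moreover have "bounded (\<Union>s\<in>D. f ` (U s \<inter> {a..b}))"
    using D U by (intro bounded_UN) auto
  ultimately show ?thesis by (rule bounded_subset[rotated])
qed

text \<open>Agreement is asked at negative times only, which admits the candidates of the
  fixed-point argument, whose value at \<open>0\<close> is not yet \<open>\<phi> 0\<close>. The time
  \<open>0\<close> becomes exceptional because \<open>\<phi>\<close> need not be left continuous
  there.\<close>

lemma pw_cont_extension:
  fixes x :: "real \<Rightarrow> 'a::real_normed_vector"
  assumes h: "h > 0" and "piecewise_continuous_on (-h) 0 \<phi>"
    and eq: "\<And>t. t \<in> {-h..<0} \<Longrightarrow> x t = \<phi> t" and cont: "continuous_on {0..} x"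
  shows "pw_cont (-h) x"
proof -
  obtain S where S: "finite S" "continuous_on ({-h..0} - S) \<phi>"
    using assms(2) by (auto simp: piecewise_continuous_on_def)
  have "isCont x t" if t: "t > -h" "t \<notin> insert 0 S" for t
  proof (cases "t > 0")
    case True
    then show ?thesis
      using cont by (metis continuous_on_interior greaterThan_iff interior_real_atLeast)
  next
    case False
    define U where "U = {-h<..<0} - S"
    have U: "open U" "t \<in> U" using t False S(1) by (auto simp: U_def finite_imp_closed open_Diff)
    have "continuous_on U \<phi>"
      by (rule continuous_on_subset[OF S(2)]) (auto simp: U_def)
    then have "continuous_on U x"
      by (rule continuous_on_eq) (auto simp: U_def eq)
    with U show ?thesis by (simp add: continuous_on_eq_continuous_at)
  qed
  then have "\<forall>t>-h. t \<notin> insert 0 S \<longrightarrow> isCont x t" by blast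
  moreover have "bounded (x ` {-h..b})" for b
  proof -
    have sub: "x ` {-h..b} \<subseteq> \<phi> ` {-h..0} \<union> x ` {0..b}"
    proof
      fix y assume "y \<in> x ` {-h..b}"
      then obtain t where t: "y = x t" "t \<in> {-h..b}" by blast
      then show "y \<in> \<phi> ` {-h..0} \<union> x ` {0..b}"
        using eq[of t] by (cases "t < 0") auto
    qed
    moreover have "bounded (x ` {0..b})"
      by (intro compact_imp_bounded compact_continuous_image continuous_on_subset[OF cont]) auto
    ultimately have "bounded (\<phi> ` {-h..0} \<union> x ` {0..b})"
      using piecewise_continuous_on_imp_bounded[OF assms(2)] by simp
    with sub show ?thesis by (rule bounded_subset[rotated])
  qed
  ultimately show ?thesis
    unfolding pw_cont_def using finite.insertI[OF S(1)] by blast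
qed

section \<open>Indefinite integrals of piecewise continuous functions\<close>

lemma integral_const_bound:
  fixes f :: "real \<Rightarrow> 'a::euclidean_space"
  assumes "f integrable_on {a..b}" "\<And>t. t \<in> {a..b} \<Longrightarrow> norm (f t) \<le> B" "a \<le> b"
  shows "norm (integral {a..b} f) \<le> B * (b - a)"
  using integral_norm_bound_integral[OF assms(1) integrable_const_ivl assms(2)] assms(3)
  by (simp add: mult.commute)

lemma integral_initial_diff:
  fixes f :: "real \<Rightarrow> 'a::euclidean_space"
  assumes "pw_cont a f" "a \<le> s" "s \<le> t"
  shows "integral {a..t} f - integral {a..s} f = integral {s..t} f"
  using Henstock_Kurzweil_Integration.integral_combine[OF assms(2,3) pw_cont_integrable[OF assms(1) order_refl]]
  by (simp add: algebra_simps)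

lemma continuous_on_integral_initial:
  fixes f :: "real \<Rightarrow> 'a::euclidean_space"
  assumes "pw_cont a f"
  shows "continuous_on {a..} (\<lambda>t. integral {a..t} f)"
  unfolding continuous_on_eq_continuous_within
proof
  fix t assume t: "t \<in> {a..}"
  have "continuous_on {a..t+1} (\<lambda>t. integral {a..t} f)"
    by (intro indefinite_integral_continuous_1 pw_cont_integrable[OF assms]) simp
  then have "continuous (at t within {a..t+1}) (\<lambda>t. integral {a..t} f)"
    using t by (simp add: continuous_on_eq_continuous_within)
  moreover have "at t within {a..t+1} = at t within {a..}"
    by (rule at_within_nhd[of _ "{..<t+1}"]) auto
  ultimately show "continuous (at t within {a..}) (\<lambda>t. integral {a..t} f)" by simp
qed

lemma integral_initial_derivative:
  fixes f :: "real \<Rightarrow> 'a::euclidean_space"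
  assumes "pw_cont a f" "a < t" "isCont f t"
  shows "((\<lambda>t. integral {a..t} f) has_vector_derivative f t) (at t)"
proof -
  have "((\<lambda>t. integral {a..t} f) has_vector_derivative f t) (at t within {a..t+1} - {})"
  proof (rule integral_has_vector_derivative_continuous_at)
    show "f integrable_on {a..t+1}" by (rule pw_cont_integrable[OF assms(1) order_refl])
    show "continuous (at t within {a..t+1} - {}) f"
      by (rule continuous_at_imp_continuous_within[OF assms(3)])
  qed (use assms(2) in auto)
  then show ?thesis
    using assms(2) by (simp add: at_within_Icc_at)
qed

lemma integral_initial_shift_derivative:
  fixes f :: "real \<Rightarrow> 'a::euclidean_space"
  assumes "pw_cont a f" "a < t - h" "isCont f (t - h)"
  shows "((\<lambda>t. integral {a..t - h} f) has_vector_derivative f (t - h)) (at t)"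
proof -
  have "((\<lambda>t. t - h) has_vector_derivative 1) (at t)"
    by (auto intro!: derivative_eq_intros)
  from vector_diff_chain_at[OF this integral_initial_derivative[OF assms]] show ?thesis
    by (simp add: o_def)
qed

lemma continuous_on_imp_pw_cont:
  fixes f :: "real \<Rightarrow> 'b::real_normed_vector"
  assumes "continuous_on {0..} f"
  shows "pw_cont 0 f"
  unfolding pw_cont_def
proof (intro conjI exI[of _ "{}"] allI impI)
  show "isCont f t" if "0 < t" for t
    using assms that by (metis continuous_on_interior greaterThan_iff interior_real_atLeast)
  show "bounded (f ` {0..b})" for b
    by (intro compact_imp_bounded compact_continuous_image continuous_on_subset[OF assms]) auto
qed simp

text \<open>The integrals increase with \<open>T\<close>, so they tend to their supremum;
  \<open>Q\<close> is extended real since the supremum may be infinite.\<close>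

lemma integral_nonneg_limit:
  fixes g :: "real \<Rightarrow> real"
  assumes g: "continuous_on {0..} g" "\<And>t. t \<ge> 0 \<Longrightarrow> g t \<ge> 0"
  obtains Q where "Q \<ge> 0" "((\<lambda>T. ereal (integral {0..T} g)) \<longlongrightarrow> Q) at_top"
proof -
  have int: "g integrable_on {0..T}" for T
    by (intro integrable_continuous_real continuous_on_subset[OF g(1)]) auto
  have mono: "integral {0..s} g \<le> integral {0..t} g" if "s \<le> t" for s t
    using that g(2) int by (intro integral_subset_le) auto
  define Q where "Q = (SUP T. ereal (integral {0..T} g))"
  have "((\<lambda>T. ereal (integral {0..T} g)) \<longlongrightarrow> Q) at_top"
  proof (rule increasing_tendsto)
    show "eventually (\<lambda>T. ereal (integral {0..T} g) \<le> Q) at_top"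
      unfolding Q_def by (intro always_eventually allI SUP_upper) simp
    fix y assume "y < Q"
    then obtain s where "y < ereal (integral {0..s} g)" by (auto simp: Q_def less_SUP_iff)
    then have "\<forall>t\<ge>s. y < ereal (integral {0..t} g)"
      using mono by (meson ereal_less_eq(3) order_less_le_trans)
    then show "eventually (\<lambda>T. y < ereal (integral {0..T} g)) at_top"
      unfolding eventually_at_top_linorder by blast
  qed
  moreover have "Q \<ge> 0"
    unfolding Q_def by (rule SUP_upper2[of 0]) auto
  ultimately show thesis by (intro that)
qed

subsection \<open>Distributed delays with exponential kernels\<close>

text \<open>Under the substitution \<open>r = t + \<theta>\<close> the kernel
  \<open>exp ((\<theta> + h) M)\<close> splits into \<open>exp ((h - t) M)\<close> and
  \<open>exp (r M)\<close>. This is the part of the integrand that is free of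
  \<open>t\<close>.\<close>

definition exp_weighted :: "real^'n^'n \<Rightarrow> real^'k^'n \<Rightarrow> (real \<Rightarrow> real^'k) \<Rightarrow> real \<Rightarrow> real^'n" where
  "exp_weighted M N x r = matrix_exp (r *\<^sub>R M) *v (N *v x r)"

definition delay_conv ::
  "real \<Rightarrow> real^'n^'n \<Rightarrow> real^'k^'n \<Rightarrow> (real \<Rightarrow> real^'k) \<Rightarrow> real \<Rightarrow> real^'n" where
  "delay_conv h M N x t =
     integral {-h..0} (\<lambda>\<theta>. (matrix_exp ((\<theta> + h) *\<^sub>R M) ** N) *v x (t + \<theta>))"

lemma pw_cont_exp_weighted: "pw_cont a x \<Longrightarrow> pw_cont a (exp_weighted M N x)"
  unfolding exp_weighted_def
  by (intro pw_cont_matrix_vector pw_cont_const_matrix_vector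
      continuous_imp_pw_cont[OF continuous_on_matrix_exp] continuous_on_id)

lemma isCont_exp_weighted:
  assumes "isCont x t" shows "isCont (exp_weighted M N x) t"
proof -
  have "isCont (\<lambda>r. matrix_exp (r *\<^sub>R M)) t"
    using matrix_exp_has_vector_derivative_at has_vector_derivative_continuous by blast
  then show ?thesis
    unfolding exp_weighted_def
    by (intro bounded_bilinear.continuous[OF bounded_bilinear_matrix_vector_mult]
        bounded_linear.continuous[OF matrix_vector_mul_bounded_linear] assms)
qed

lemma delay_integrand_integrable:
  assumes "pw_cont (-h) x" "t \<ge> 0"
  shows "(\<lambda>\<theta>. (matrix_exp ((\<theta> + h) *\<^sub>R M) ** N) *v x (t + \<theta>)) integrable_on {-h..0}"
proof (rule pw_cont_integrable)
  show "pw_cont (-h - t) (\<lambda>\<theta>. (matrix_exp ((\<theta> + h) *\<^sub>R M) ** N) *v x (t + \<theta>))"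
    by (intro pw_cont_matrix_vector pw_cont_shift assms continuous_imp_pw_cont
        continuous_on_matrix_mult continuous_on_matrix_exp continuous_intros)
qed (use assms(2) in simp)

lemma delay_conv_eq:
  fixes M :: "real^'n^'n" and N :: "real^'k^'n"
  assumes x: "pw_cont (-h) x" and "t \<ge> 0" "h > 0"
  shows "delay_conv h M N x t = matrix_exp ((h - t) *\<^sub>R M) *v
    (integral {-h..t} (exp_weighted M N x) - integral {-h..t - h} (exp_weighted M N x))"
proof -
  let ?q = "exp_weighted M N x"
  have q: "pw_cont (-h) ?q" by (rule pw_cont_exp_weighted[OF x])
  have int: "?q integrable_on {t - h..t}"
    using assms(2) by (intro pw_cont_integrable[OF q]) simp
  have "integral {-h..0} (\<lambda>\<theta>. (matrix_exp ((\<theta> + h) *\<^sub>R M) ** N) *v x (t + \<theta>))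
      = integral {t - h - t..t - t} (\<lambda>\<theta>. matrix_exp ((h - t) *\<^sub>R M) *v ?q (\<theta> + t))"
    unfolding exp_weighted_def matrix_vector_mul_assoc matrix_mul_assoc matrix_exp_add[symmetric]
    by (simp add: algebra_simps)
  also have "\<dots> = integral {t - h..t} (\<lambda>r. matrix_exp ((h - t) *\<^sub>R M) *v ?q r)"
    by (rule integral_shift_real_ivl)
  also have "\<dots> = matrix_exp ((h - t) *\<^sub>R M) *v integral {t - h..t} ?q"
    using integral_linear[OF int matrix_vector_mul_bounded_linear[of "matrix_exp ((h - t) *\<^sub>R M)"]]
    by (simp add: o_def)
  also have "integral {t - h..t} ?q = integral {-h..t} ?q - integral {-h..t - h} ?q"
    using assms by (intro integral_initial_diff[OF q, symmetric]) auto
  finally show ?thesis unfolding delay_conv_def .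
qed

lemma continuous_on_window_integral:
  fixes f :: "real \<Rightarrow> 'a::euclidean_space"
  assumes "pw_cont (-h) f" "h > 0"
  shows "continuous_on {0..} (\<lambda>t. integral {-h..t} f)"
    and "continuous_on {0..} (\<lambda>t. integral {-h..t - h} f)"
  using assms(2)
  by (auto intro!: continuous_on_compose2[OF continuous_on_integral_initial[OF assms(1)]]
      continuous_intros)

lemma continuous_on_delay_conv:
  fixes M :: "real^'n^'n" and N :: "real^'k^'n"
  assumes x: "pw_cont (-h) x" and "h > 0"
  shows "continuous_on {0..} (delay_conv h M N x)"
proof -
  have "continuous_on {0..} (\<lambda>t. matrix_exp ((h - t) *\<^sub>R M) *v
      (integral {-h..t} (exp_weighted M N x) - integral {-h..t - h} (exp_weighted M N x)))"
    by (intro continuous_on_matrix_vector_mult continuous_on_matrix_exp continuous_intros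
        continuous_on_window_integral pw_cont_exp_weighted assms)
  then show ?thesis
    by (rule continuous_on_eq) (simp add: delay_conv_eq[OF x _ assms(2)])
qed

text \<open>The moving end points contribute the kernel at \<open>\<theta> = 0\<close> and at
  \<open>\<theta> = -h\<close>, namely \<open>exp (h M) N\<close> and \<open>N\<close>; the
  prefactor \<open>exp ((h - t) M)\<close> contributes the term with \<open>- M\<close>.\<close>

lemma delay_conv_derivative:
  fixes M :: "real^'n^'n" and N :: "real^'k^'n"
  assumes x: "pw_cont (-h) x" and "h > 0" "t > 0" and c: "isCont x t" "isCont x (t - h)"
  shows "(delay_conv h M N x has_vector_derivative
    (matrix_exp (h *\<^sub>R M) ** N) *v x t - N *v x (t - h) - M *v delay_conv h M N x t) (at t)"
proof -
  let ?q = "exp_weighted M N x" and ?E = "\<lambda>t. matrix_exp ((h - t) *\<^sub>R M)"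
  let ?D = "\<lambda>t. integral {-h..t} ?q - integral {-h..t - h} ?q"
  have q: "pw_cont (-h) ?q" by (rule pw_cont_exp_weighted[OF x])
  have D: "(?D has_vector_derivative ?q t - ?q (t - h)) (at t)"
    using assms by (intro has_vector_derivative_diff integral_initial_derivative[OF q]
        integral_initial_shift_derivative[OF q] isCont_exp_weighted) auto
  have E: "(?E has_vector_derivative (-1) *\<^sub>R (M ** ?E t)) (at t)"
    by (rule matrix_exp_has_vector_derivative) (auto intro!: derivative_eq_intros)
  have deriv: "((\<lambda>t. ?E t *v ?D t) has_vector_derivative
      ?E t *v (?q t - ?q (t - h)) + ((-1) *\<^sub>R (M ** ?E t)) *v ?D t) (at t)"
    by (rule bounded_bilinear.has_vector_derivative[OF bounded_bilinear_matrix_vector_mult E D])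
  have "?E t *v ?q r = (matrix_exp ((h - t + r) *\<^sub>R M) ** N) *v x r" for r
    by (simp only: exp_weighted_def matrix_vector_mul_assoc matrix_exp_add matrix_mul_assoc)
  from this[of t] this[of "t - h"]
  have "?E t *v (?q t - ?q (t - h)) = (matrix_exp (h *\<^sub>R M) ** N) *v x t - N *v x (t - h)"
    by (simp add: matrix_vector_mult_diff_distrib)
  moreover have "((-1) *\<^sub>R (M ** ?E t)) *v ?D t = - (M *v delay_conv h M N x t)"
    using assms by (simp add: delay_conv_eq matrix_vector_minus_left matrix_vector_mul_assoc)
  ultimately have "((\<lambda>t. ?E t *v ?D t) has_vector_derivative
    (matrix_exp (h *\<^sub>R M) ** N) *v x t - N *v x (t - h) - M *v delay_conv h M N x t) (at t)"
    using deriv by simp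
  then show ?thesis
    by (rule has_vector_derivative_transform_within_open[where S = "{0<..}"])
      (use assms in \<open>auto simp: delay_conv_eq\<close>)
qed

lemma matrix_exp_bounded:
  fixes M :: "real^'n^'n"
  obtains C where "C \<ge> 0" "\<And>t. t \<in> {a..b} \<Longrightarrow> norm (matrix_exp (t *\<^sub>R M)) \<le> C"
proof -
  have "bounded ((\<lambda>t. matrix_exp (t *\<^sub>R M)) ` {a..b})"
    by (intro compact_imp_bounded compact_continuous_image continuous_on_matrix_exp continuous_intros)
      simp
  then obtain C where "C > 0" "\<And>t. t \<in> {a..b} \<Longrightarrow> norm (matrix_exp (t *\<^sub>R M)) \<le> C"
    unfolding bounded_pos by blast
  then show thesis using that[of C] by simp
qed

text \<open>\<open>C\<close> is uniform in \<open>x\<close> and \<open>t\<close>. Applied to a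
  difference of functions this gives a Lipschitz bound, applied to a decaying trajectory it gives
  decay.\<close>

lemma delay_conv_bound:
  fixes M :: "real^'n^'n" and N :: "real^'k^'n"
  assumes "h > 0"
  obtains C where "C \<ge> 0" "\<And>x t \<eta>. pw_cont (-h) x \<Longrightarrow> t \<ge> 0 \<Longrightarrow>
    (\<And>s. s \<in> {t - h..t} \<Longrightarrow> norm (x s) \<le> \<eta>) \<Longrightarrow> norm (delay_conv h M N x t) \<le> C * \<eta>"
proof -
  obtain B where B: "B \<ge> 0" "\<And>t. t \<in> {0..h} \<Longrightarrow> norm (matrix_exp (t *\<^sub>R M)) \<le> B"
    by (rule matrix_exp_bounded) blast
  obtain K where K: "K \<ge> 0" "\<And>(A :: real^'k^'n) v. norm (A *v v) \<le> norm A * norm v * K"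
    using bounded_bilinear.nonneg_bounded[OF bounded_bilinear_matrix_vector_mult] by blast
  obtain L where L: "L \<ge> 0" "\<And>(A :: real^'n^'n) (B :: real^'k^'n). norm (A ** B) \<le> norm A * norm B * L"
    using bounded_bilinear.nonneg_bounded[OF bounded_bilinear_matrix_mult] by blast
  have "norm (delay_conv h M N x t) \<le> (B * norm N * L * K * h) * \<eta>"
    if "pw_cont (-h) x" "t \<ge> 0" and \<eta>: "\<And>s. s \<in> {t - h..t} \<Longrightarrow> norm (x s) \<le> \<eta>" for x t \<eta>
  proof -
    have "norm (delay_conv h M N x t) \<le> (B * norm N * L * \<eta> * K) * (0 - - h)"
      unfolding delay_conv_def
    proof (rule integral_const_bound[OF delay_integrand_integrable[OF that(1,2)]])
      fix \<theta> assume \<theta>: "\<theta> \<in> {-h..0}"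
      have "norm (matrix_exp ((\<theta> + h) *\<^sub>R M) ** N) \<le> B * norm N * L"
        using B(2)[of "\<theta> + h"] \<theta> L(1) by (intro order_trans[OF L(2)] mult_right_mono) auto
      moreover have "norm (x (t + \<theta>)) \<le> \<eta>" using \<theta> by (intro \<eta>) auto
      ultimately show "norm ((matrix_exp ((\<theta> + h) *\<^sub>R M) ** N) *v x (t + \<theta>)) \<le> B * norm N * L * \<eta> * K"
        using K(1) B(1) L(1) by (intro order_trans[OF K(2)] mult_right_mono mult_mono) auto
    qed (use assms in auto)
    then show ?thesis by (simp add: ac_simps)
  qed
  moreover have "B * norm N * L * K * h \<ge> 0" using B K L assms by simp
  ultimately show thesis using that by blast
qed

lemma delay_conv_diff:
  assumes "pw_cont (-h) x" "pw_cont (-h) y" "t \<ge> 0"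
  shows "delay_conv h M N x t - delay_conv h M N y t = delay_conv h M N (\<lambda>s. x s - y s) t"
  unfolding delay_conv_def matrix_vector_mult_diff_distrib
  by (intro integral_diff[symmetric] delay_integrand_integrable assms)

lemma delay_conv_cong:
  assumes "\<And>s. s \<in> {t - h..t} \<Longrightarrow> x s = y s"
  shows "delay_conv h M N x t = delay_conv h M N y t"
  unfolding delay_conv_def by (intro integral_cong) (use assms in auto)

text \<open>\<open>delay_quad h M N A x t\<close> is the double integral over \<open>-h \<le> \<xi>, \<theta> \<le> 0\<close> of
  \<open>x(t+\<xi>) \<bullet> K(\<xi>,\<theta>) x(t+\<theta>)\<close>, where \<open>K(\<xi>,\<theta>) = A\<^sup>T exp((\<theta>-\<xi>)M) N\<close> for \<open>\<xi> \<le> \<theta>\<close> and \<open>K(\<xi>,\<theta>) = K(\<theta>,\<xi>)\<^sup>T\<close>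
  otherwise, written as twice the integral over the triangle \<open>\<xi> \<le> \<theta>\<close>. As the exponential splits into a function of
  \<open>\<xi>\<close> and a function of \<open>\<theta>\<close>, the inner integral is an increment of a primitive.\<close>

definition delay_quad ::
  "real \<Rightarrow> real^'n^'n \<Rightarrow> real^'k^'n \<Rightarrow> real^'k^'n \<Rightarrow> (real \<Rightarrow> real^'k) \<Rightarrow> real \<Rightarrow> real" where
  "delay_quad h M N A x t = 2 * integral {t - h..t} (\<lambda>r.
     (integral {-h..r} (exp_weighted (- transpose M) A x)
      - integral {-h..t - h} (exp_weighted (- transpose M) A x)) \<bullet> exp_weighted M N x r)"

lemma transpose_exp_neg:
  "transpose (matrix_exp (r *\<^sub>R (- transpose M))) = matrix_exp ((- r) *\<^sub>R M)"
  by (simp add: transpose_matrix_exp transpose_scaleR transpose_minus transpose_transpose)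

text \<open>Transposition turns the weight \<open>- transpose M\<close> into
  \<open>exp (- s M)\<close>, which merges with \<open>exp (r M)\<close>: the pairing depends on
  absolute time only through \<open>r - s\<close> and the values of \<open>x\<close>.\<close>

lemma exp_weighted_inner:
  "exp_weighted (- transpose M) A x s \<bullet> exp_weighted M N x r
    = (A *v x s) \<bullet> (matrix_exp ((r - s) *\<^sub>R M) *v (N *v x r))"
proof -
  have "exp_weighted (- transpose M) A x s \<bullet> exp_weighted M N x r
      = (A *v x s) \<bullet> ((matrix_exp ((- s) *\<^sub>R M) ** matrix_exp (r *\<^sub>R M)) *v (N *v x r))"
    unfolding exp_weighted_def inner_matrix_left[of "matrix_exp _"] transpose_exp_neg
    by (simp only: matrix_vector_mul_assoc matrix_mul_assoc)
  also have "matrix_exp ((- s) *\<^sub>R M) ** matrix_exp (r *\<^sub>R M) = matrix_exp ((r - s) *\<^sub>R M)"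
    by (simp add: matrix_exp_add[symmetric] del: scaleR_minus_left)
  finally show ?thesis .
qed

lemma pw_cont_integral_initial:
  fixes f :: "real \<Rightarrow> 'a::euclidean_space"
  assumes "pw_cont a f"
  shows "pw_cont a (\<lambda>t. integral {a..t} f)"
  unfolding pw_cont_def
proof (intro conjI exI[of _ "{}"] allI impI)
  show "finite ({} :: real set)" by simp
  show "isCont (\<lambda>t. integral {a..t} f) t" if "a < t" for t
    using continuous_on_integral_initial[OF assms] that
    by (metis continuous_on_interior greaterThan_iff interior_real_atLeast)
  show "bounded ((\<lambda>t. integral {a..t} f) ` {a..b})" for b
    by (intro compact_imp_bounded compact_continuous_image
        continuous_on_subset[OF continuous_on_integral_initial[OF assms]]) auto
qed

context
  fixes h :: real and M :: "real^'n^'n" and N A :: "real^'k^'n" and x :: "real \<Rightarrow> real^'k"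
  assumes h: "h > 0" and x: "pw_cont (-h) x"
begin

private abbreviation (input) "p \<equiv> exp_weighted (- transpose M) A x"
private abbreviation (input) "q \<equiv> exp_weighted M N x"
private abbreviation (input) "P t \<equiv> integral {-h..t} p"
private abbreviation (input) "Q t \<equiv> integral {-h..t} q"

lemma pw_cont_pq: "pw_cont (-h) p" "pw_cont (-h) q" "pw_cont (-h) (\<lambda>r. P r \<bullet> q r)"
  by (intro pw_cont_exp_weighted x pw_cont_bilinear[OF bounded_bilinear_inner] pw_cont_integral_initial)+

text \<open>The lower end \<open>t - h\<close> of the inner integral is constant in
  \<open>r\<close>; pulling it out leaves only primitives evaluated at \<open>t\<close> and
  \<open>t - h\<close>, which can be differentiated directly.\<close>

lemma delay_quad_eq:
  assumes "t \<ge> 0"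
  shows "delay_quad h M N A x t = 2 * (integral {-h..t} (\<lambda>r. P r \<bullet> q r)
     - integral {-h..t - h} (\<lambda>r. P r \<bullet> q r) - P (t - h) \<bullet> (Q t - Q (t - h)))"
proof -
  have le: "-h \<le> t - h" "t - h \<le> t" using assms h by auto
  have int: "(\<lambda>r. P r \<bullet> q r) integrable_on {t - h..t}" "q integrable_on {t - h..t}"
    using le by (auto intro!: pw_cont_integrable[OF pw_cont_pq(3)] pw_cont_integrable[OF pw_cont_pq(2)])
  have "integral {t - h..t} (\<lambda>r. (P r - P (t - h)) \<bullet> q r)
      = integral {t - h..t} (\<lambda>r. P r \<bullet> q r) - integral {t - h..t} (\<lambda>r. P (t - h) \<bullet> q r)"
    unfolding inner_diff_left
    using integrable_linear[OF int(2) bounded_linear_inner_right[of "P (t - h)"]] int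
    by (intro integral_diff) (auto simp: o_def)
  also have "integral {t - h..t} (\<lambda>r. P (t - h) \<bullet> q r) = P (t - h) \<bullet> integral {t - h..t} q"
    using integral_linear[OF int(2) bounded_linear_inner_right[of "P (t - h)"]] by (simp add: o_def)
  finally show ?thesis
    unfolding delay_quad_def integral_initial_diff[OF pw_cont_pq(2) le]
      integral_initial_diff[OF pw_cont_pq(3) le] by simp
qed

lemma continuous_on_delay_quad: "continuous_on {0..} (delay_quad h M N A x)"
proof -
  have "continuous_on {0..} (\<lambda>t. 2 * (integral {-h..t} (\<lambda>r. P r \<bullet> q r)
     - integral {-h..t - h} (\<lambda>r. P r \<bullet> q r) - P (t - h) \<bullet> (Q t - Q (t - h))))"
    by (intro continuous_intros continuous_on_window_integral pw_cont_pq h)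
  then show ?thesis by (rule continuous_on_eq) (simp add: delay_quad_eq)
qed

text \<open>As the kernel depends on the difference of its times, only the sides of the moving
  triangle contribute: \<open>r = t\<close> enters and \<open>s = t - h\<close> leaves. The terms
  along the diagonal need no separate treatment.\<close>

lemma delay_quad_derivative:
  assumes t: "t > 0" and c: "isCont x t" "isCont x (t - h)"
  shows "(delay_quad h M N A x has_vector_derivative
    2 * (((matrix_exp (h *\<^sub>R M) ** N) *v x t) \<bullet> delay_conv h (- transpose M) A x t)
    - 2 * ((A *v x (t - h)) \<bullet> delay_conv h M N x t)) (at t)"
proof -
  let ?G = "\<lambda>t. integral {-h..t} (\<lambda>r. P r \<bullet> q r)"
  let ?f = "\<lambda>t. 2 * (?G t - ?G (t - h) - P (t - h) \<bullet> (Q t - Q (t - h)))"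
  have isC: "isCont p t" "isCont q t" "isCont p (t - h)" "isCont q (t - h)"
    using c by (auto intro: isCont_exp_weighted)
  have "isCont P s" if "s > -h" for s
    using continuous_on_integral_initial[OF pw_cont_pq(1)] that
    by (metis continuous_on_interior greaterThan_iff interior_real_atLeast)
  then have isG: "isCont (\<lambda>r. P r \<bullet> q r) t" "isCont (\<lambda>r. P r \<bullet> q r) (t - h)"
    using isC t h by (auto intro!: continuous_intros)
  have d: "(P has_vector_derivative p t) (at t)" "(Q has_vector_derivative q t) (at t)"
    "((\<lambda>t. P (t - h)) has_vector_derivative p (t - h)) (at t)"
    "((\<lambda>t. Q (t - h)) has_vector_derivative q (t - h)) (at t)"
    "(?G has_vector_derivative P t \<bullet> q t) (at t)"
    "((\<lambda>t. ?G (t - h)) has_vector_derivative P (t - h) \<bullet> q (t - h)) (at t)"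
    using t h isC isG
    by (auto intro!: integral_initial_derivative integral_initial_shift_derivative pw_cont_pq)
  have "(?f has_vector_derivative 2 * (P t \<bullet> q t - P (t - h) \<bullet> q (t - h)
      - (P (t - h) \<bullet> (q t - q (t - h)) + p (t - h) \<bullet> (Q t - Q (t - h))))) (at t)"
    by (intro has_vector_derivative_mult_right has_vector_derivative_diff d
        bounded_bilinear.has_vector_derivative[OF bounded_bilinear_inner])
  moreover have "P t \<bullet> q t - P (t - h) \<bullet> q (t - h)
      - (P (t - h) \<bullet> (q t - q (t - h)) + p (t - h) \<bullet> (Q t - Q (t - h)))
      = (P t - P (t - h)) \<bullet> q t - p (t - h) \<bullet> (Q t - Q (t - h))"
    by (simp add: inner_diff_left inner_diff_right)
  moreover have "((matrix_exp (h *\<^sub>R M) ** N) *v x t) \<bullet> delay_conv h (- transpose M) A x t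
      = (P t - P (t - h)) \<bullet> q t"
  proof -
    \<comment> \<open>An identity matrix is inserted as a product of opposite exponentials: one
      factor completes the delay integral, the other crosses the inner product and rescales
      \<open>q t\<close> to the kernel value at \<open>\<theta> = 0\<close>.\<close>
    have "(P t - P (t - h)) \<bullet> q t
       = (matrix_exp ((- (h - t)) *\<^sub>R (- transpose M)) *v
           (matrix_exp ((h - t) *\<^sub>R (- transpose M)) *v (P t - P (t - h)))) \<bullet> q t"
      unfolding matrix_vector_mul_assoc matrix_exp_add[symmetric] by simp
    also have "\<dots> = delay_conv h (- transpose M) A x t \<bullet>
        (matrix_exp ((- (- (h - t))) *\<^sub>R M) *v (matrix_exp (t *\<^sub>R M) *v (N *v x t)))"
      using t h by (simp only: inner_matrix_left[of "matrix_exp ((- (h - t)) *\<^sub>R _)"] transpose_exp_neg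
          delay_conv_eq[OF x] less_imp_le exp_weighted_def)
    also have "matrix_exp ((- (- (h - t))) *\<^sub>R M) *v (matrix_exp (t *\<^sub>R M) *v (N *v x t))
        = (matrix_exp (h *\<^sub>R M) ** N) *v x t"
      unfolding matrix_vector_mul_assoc matrix_mul_assoc matrix_exp_add[symmetric] by simp
    finally show ?thesis by (simp add: inner_commute)
  qed
  moreover have "(A *v x (t - h)) \<bullet> delay_conv h M N x t = p (t - h) \<bullet> (Q t - Q (t - h))"
    using t h
    by (simp add: delay_conv_eq[OF x] exp_weighted_def[of "- transpose M"] inner_matrix_left
        transpose_exp_neg del: scaleR_minus_left scaleR_minus_right)
  ultimately have "(?f has_vector_derivative
      2 * (((matrix_exp (h *\<^sub>R M) ** N) *v x t) \<bullet> delay_conv h (- transpose M) A x t)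
      - 2 * ((A *v x (t - h)) \<bullet> delay_conv h M N x t)) (at t)"
    by simp
  then show ?thesis
    by (rule has_vector_derivative_transform_within_open[where S = "{0<..}"])
      (use t in \<open>auto simp: delay_quad_eq\<close>)
qed

end

text \<open>Either factor of the integrand may grow with time on its own, so the product is bounded
  instead: it contains only \<open>exp ((r - s) M)\<close> with \<open>r - s\<close> in
  \<open>[0, h]\<close>. The triangle is estimated by a square of side \<open>h\<close>, and the
  \<open>2\<close> is the factor in \<open>delay_quad\<close>.\<close>

lemma delay_quad_bound:
  fixes M :: "real^'n^'n" and N A :: "real^'k^'n"
  assumes h: "h > 0"
  obtains C where "C \<ge> 0" "\<And>x t \<eta>. pw_cont (-h) x \<Longrightarrow> t \<ge> 0 \<Longrightarrow>
    (\<And>s. s \<in> {t - h..t} \<Longrightarrow> norm (x s) \<le> \<eta>) \<Longrightarrow> \<bar>delay_quad h M N A x t\<bar> \<le> C * \<eta>\<^sup>2"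
proof -
  obtain B where B: "B \<ge> 0" "\<And>t. t \<in> {0..h} \<Longrightarrow> norm (matrix_exp (t *\<^sub>R M)) \<le> B"
    by (rule matrix_exp_bounded) blast
  obtain K where K: "K \<ge> 0" "\<And>(A :: real^'n^'n) v. norm (A *v v) \<le> norm A * norm v * K"
    using bounded_bilinear.nonneg_bounded[OF bounded_bilinear_matrix_vector_mult] by blast
  obtain L where L: "L \<ge> 0" "\<And>(A :: real^'k^'n) v. norm (A *v v) \<le> norm A * norm v * L"
    using bounded_bilinear.nonneg_bounded[OF bounded_bilinear_matrix_vector_mult] by blast
  define D where "D = (norm A * L) * (B * (norm N * L) * K)"
  have D: "D \<ge> 0" using B K L by (simp add: D_def)
  have "\<bar>delay_quad h M N A x t\<bar> \<le> (2 * D * h * h) * \<eta>\<^sup>2"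
    if x: "pw_cont (-h) x" and t: "t \<ge> 0" and \<eta>: "\<And>s. s \<in> {t - h..t} \<Longrightarrow> norm (x s) \<le> \<eta>" for x t \<eta>
  proof -
    let ?p = "exp_weighted (- transpose M) A x" and ?q = "exp_weighted M N x"
    let ?P = "\<lambda>t. integral {-h..t} ?p"
    have \<eta>0: "\<eta> \<ge> 0" using \<eta>[of t] h by (meson atLeastAtMost_iff diff_le_eq le_add_same_cancel1 less_imp_le norm_ge_zero order_refl order_trans)
    note pq = pw_cont_pq[OF h x]
    have le: "-h \<le> t - h" using t by simp
    have "\<bar>?p s \<bullet> ?q r\<bar> \<le> D * \<eta>\<^sup>2" if "s \<in> {t - h..t}" "r \<in> {t - h..t}" "s \<le> r" for s r
    proof -
      have lin: "norm (Z *v x u) \<le> norm Z * \<eta> * L" if "u \<in> {t - h..t}" for Z :: "real^'k^'n" and u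
        using L(1) \<eta>[OF that] by (intro order_trans[OF L(2)] mult_right_mono mult_left_mono) auto
      have "norm (matrix_exp ((r - s) *\<^sub>R M) *v (N *v x r)) \<le> B * (norm N * \<eta> * L) * K"
        using B(2)[of "r - s"] that K(1) B(1) lin[OF that(2), of N]
        by (intro order_trans[OF K(2)] mult_right_mono mult_mono) auto
      moreover have "norm (A *v x s) \<le> norm A * \<eta> * L" by (rule lin[OF that(1)])
      ultimately have "norm (A *v x s) * norm (matrix_exp ((r - s) *\<^sub>R M) *v (N *v x r))
          \<le> (norm A * \<eta> * L) * (B * (norm N * \<eta> * L) * K)"
        using L(1) \<eta>0 by (intro mult_mono) auto
      then show ?thesis
        unfolding exp_weighted_inner D_def
        by (intro order_trans[OF Cauchy_Schwarz_ineq2]) (simp add: power2_eq_square ac_simps)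
    qed note pq_bound = this
    have "\<bar>(?P r - ?P (t - h)) \<bullet> ?q r\<bar> \<le> D * \<eta>\<^sup>2 * h" if r: "r \<in> {t - h..t}" for r
    proof -
      have int: "?p integrable_on {t - h..r}" by (rule pw_cont_integrable[OF pq(1) le])
      have "(?P r - ?P (t - h)) \<bullet> ?q r = integral {t - h..r} ?p \<bullet> ?q r"
        using integral_initial_diff[OF pq(1)[of M A] le, of r] r by simp
      also have "\<dots> = integral {t - h..r} (\<lambda>s. ?p s \<bullet> ?q r)"
        using integral_linear[OF int bounded_linear_inner_left] by (simp add: o_def)
      also have "norm \<dots> \<le> D * \<eta>\<^sup>2 * (r - (t - h))"
        using r integrable_linear[OF int bounded_linear_inner_left[of "?q r"]]
        by (intro integral_const_bound) (auto simp: o_def intro!: pq_bound)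
      also have "\<dots> \<le> D * \<eta>\<^sup>2 * h"
        using r D by (intro mult_left_mono) auto
      finally show ?thesis by simp
    qed
    then have "norm (integral {t - h..t} (\<lambda>r. (?P r - ?P (t - h)) \<bullet> ?q r)) \<le> D * \<eta>\<^sup>2 * h * (t - (t - h))"
      using h le
      by (intro integral_const_bound pw_cont_integrable[of "-h"] pw_cont_bilinear[OF bounded_bilinear_inner]
          pw_cont_diff pw_cont_integral_initial pq continuous_imp_pw_cont continuous_intros) auto
    then show ?thesis unfolding delay_quad_def by (simp add: ac_simps abs_mult)
  qed
  moreover have "2 * D * h * h \<ge> 0" using D h by simp
  ultimately show thesis using that by blast
qed

lemma delay_quad_cong:
  assumes "\<And>s. s \<in> {-h..0} \<Longrightarrow> x s = y s"
  shows "delay_quad h M N A x 0 = delay_quad h M N A y 0"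
proof -
  have "integral {-h..r} (exp_weighted (- transpose M) A x) = integral {-h..r} (exp_weighted (- transpose M) A y)"
    if "r \<le> 0" for r
    by (rule integral_cong) (use assms that in \<open>auto simp: exp_weighted_def\<close>)
  then show ?thesis
    unfolding delay_quad_def using assms
    by (auto intro!: integral_cong simp: exp_weighted_def)
qed

subsection \<open>Linear retarded integral equations\<close>

text \<open>Integration against the growing weight gains a factor \<open>1 / l\<close>, which a
  large \<open>l\<close> makes contractive.\<close>

lemma integral_exp_bound:
  fixes g :: "real \<Rightarrow> 'a::euclidean_space"
  assumes "g integrable_on {0..t}" "\<And>s. s \<in> {0..t} \<Longrightarrow> norm (g s) \<le> K * exp (l * s)"
    and "t \<ge> 0" "l > 0" "K \<ge> 0"
  shows "norm (integral {0..t} g) \<le> K / l * exp (l * t)"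
proof -
  have "((\<lambda>s. K * exp (l * s)) has_integral K / l * exp (l * t) - K / l * exp (l * 0)) {0..t}"
    using assms(3,4)
    by (intro fundamental_theorem_of_calculus)
      (auto intro!: derivative_eq_intros simp: has_real_derivative_iff_has_vector_derivative[symmetric])
  then have "norm (integral {0..t} g) \<le> K / l * exp (l * t) - K / l * exp (l * 0)"
    using integral_norm_bound_integral[OF assms(1) _ assms(2)] by (metis has_integral_iff)
  also have "\<dots> \<le> K / l * exp (l * t)" using assms(4,5) by simp
  finally show ?thesis .
qed

text \<open>With \<open>\<eta> = 0\<close> the Lipschitz condition already forces
  \<open>f x t\<close> to depend on \<open>x\<close> over \<open>[t - h, t]\<close> only. The values
  are just piecewise continuous, as jumps of the initial function reappear one delay later;
  \<open>zero\<close> fixes the size of \<open>f\<close> at one function, and the Lipschitz bound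
  propagates it.\<close>

locale delay_functional =
  fixes h C :: real and f :: "(real \<Rightarrow> 'a::euclidean_space) \<Rightarrow> real \<Rightarrow> 'a"
  assumes h: "h > 0" and C: "C \<ge> 0"
    and pw: "\<And>x. pw_cont (-h) x \<Longrightarrow> pw_cont 0 (f x)"
    and lipschitz: "\<And>x y t \<eta>. pw_cont (-h) x \<Longrightarrow> pw_cont (-h) y \<Longrightarrow> t \<ge> 0 \<Longrightarrow>
      (\<And>s. s \<in> {t - h..t} \<Longrightarrow> norm (x s - y s) \<le> \<eta>) \<Longrightarrow> norm (f x t - f y t) \<le> C * \<eta>"
    and zero: "\<And>t. f (\<lambda>_. 0) t = 0"
begin

text \<open>Chosen so that \<open>C / rate\<close> is at most one half; the \<open>+ 1\<close>
  covers \<open>C = 0\<close>.\<close>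

definition rate :: real where "rate = 2 * C + 1"

lemma rate: "rate > 0" "C / rate \<le> 1 / 2"
  using C by (auto simp: rate_def field_simps)

text \<open>The contraction estimate. The delay costs nothing: over the window before
  \<open>s\<close> the weight is largest at \<open>s\<close>, and at negative times the functions
  agree.\<close>

lemma integral_diff_bound:
  assumes x: "pw_cont (-h) x" and y: "pw_cont (-h) y" and t: "t \<ge> 0" and B: "B \<ge> 0"
    and eq: "\<And>s. s \<in> {-h..<0} \<Longrightarrow> x s = y s"
    and le: "\<And>s. s \<in> {0..t} \<Longrightarrow> norm (x s - y s) \<le> B * exp (rate * s)"
  shows "norm (integral {0..t} (f x) - integral {0..t} (f y)) \<le> B / 2 * exp (rate * t)"
proof -
  have "norm (f x s - f y s) \<le> (C * B) * exp (rate * s)" if s: "s \<in> {0..t}" for s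
  proof -
    have "norm (x r - y r) \<le> B * exp (rate * s)" if r: "r \<in> {s - h..s}" for r
    proof (cases "r < 0")
      case True
      with r s have "x r = y r" by (intro eq) auto
      with B show ?thesis by simp
    next
      case False
      with r s have "norm (x r - y r) \<le> B * exp (rate * r)" by (intro le) auto
      also have "\<dots> \<le> B * exp (rate * s)"
        using r rate(1) B by (intro mult_left_mono) auto
      finally show ?thesis .
    qed
    then show ?thesis
      using lipschitz[OF x y, of s "B * exp (rate * s)"] s by (simp add: mult.assoc)
  qed
  moreover have int: "f x integrable_on {0..t}" "f y integrable_on {0..t}"
    by (rule pw_cont_integrable[OF pw[OF x] order_refl] pw_cont_integrable[OF pw[OF y] order_refl])+
  ultimately have "norm (integral {0..t} (\<lambda>s. f x s - f y s)) \<le> (C * B) / rate * exp (rate * t)"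
    using t C B rate(1) by (intro integral_exp_bound integrable_diff) auto
  also have "\<dots> = (C / rate) * (B * exp (rate * t))" by simp
  also have "\<dots> \<le> (1 / 2) * (B * exp (rate * t))"
    using rate(2) B by (intro mult_right_mono) auto
  finally show ?thesis using int by (simp add: integral_diff)
qed

text \<open>Where the weighted distance attains its maximum over \<open>[0, t]\<close>, the
  contraction estimate bounds the maximum by half of itself.\<close>

lemma unique:
  assumes x: "pw_cont (-h) x" "continuous_on {0..} x" and y: "pw_cont (-h) y" "continuous_on {0..} y"
    and eq: "\<And>s. s \<in> {-h..0} \<Longrightarrow> x s = y s"
    and xeq: "\<And>t. t \<ge> 0 \<Longrightarrow> x t = c + integral {0..t} (f x)"
    and yeq: "\<And>t. t \<ge> 0 \<Longrightarrow> y t = c + integral {0..t} (f y)"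
    and "t \<ge> 0"
  shows "x t = y t"
proof -
  let ?d = "\<lambda>s. exp (- rate * s) * norm (x s - y s)"
  have "continuous_on {0..t} ?d"
    by (intro continuous_intros continuous_on_subset[OF x(2)] continuous_on_subset[OF y(2)]) auto
  then obtain m where m: "m \<in> {0..t}" "\<And>s. s \<in> {0..t} \<Longrightarrow> ?d s \<le> ?d m"
    using continuous_attains_sup[of "{0..t}" ?d] \<open>t \<ge> 0\<close> by auto
  have expand: "norm (x s - y s) = ?d s * exp (rate * s)" for s
    by (simp add: exp_minus field_simps)
  have "norm (integral {0..m} (f x) - integral {0..m} (f y)) \<le> ?d m / 2 * exp (rate * m)"
  proof (rule integral_diff_bound[OF x(1) y(1)])
    show "norm (x s - y s) \<le> ?d m * exp (rate * s)" if "s \<in> {0..m}" for s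
    proof (subst expand)
      show "?d s * exp (rate * s) \<le> ?d m * exp (rate * s)"
        using m(1) that by (intro mult_right_mono m(2)) auto
    qed
  qed (use m(1) eq in auto)
  moreover have "x m - y m = integral {0..m} (f x) - integral {0..m} (f y)"
    using m(1) xeq[of m] yeq[of m] by simp
  ultimately have "norm (x m - y m) \<le> ?d m / 2 * exp (rate * m)"
    by (simp only:)
  then have "?d m * exp (rate * m) \<le> ?d m / 2 * exp (rate * m)"
    by (simp only: expand[of m, symmetric])
  then have "?d m \<le> ?d m / 2" by (simp only: mult_le_cancel_right_pos exp_gt_zero)
  then have "?d t \<le> 0" using m(2)[of t] \<open>t \<ge> 0\<close> by simp
  then show ?thesis by (simp add: mult_le_0_iff)
qed

text \<open>With the weight \<open>exp (- rate * t)\<close> the integral operator is a contraction on the bounded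
  continuous functions over the whole half line.\<close>

theorem exists_solution:
  assumes phi: "piecewise_continuous_on (-h) 0 \<phi>"
  obtains x where "pw_cont (-h) x" "continuous_on {0..} x" "\<And>s. s \<in> {-h..0} \<Longrightarrow> x s = \<phi> s"
    "\<And>t. t \<ge> 0 \<Longrightarrow> x t = \<phi> 0 + integral {0..t} (f x)"
proof -
  \<comment> \<open>\<open>X\<close> removes the weight and prepends \<open>\<phi>\<close>;
    \<open>T\<close> is the integral operator in weighted form, so a fixed point \<open>b\<close>
    yields the solution \<open>X b\<close>. Through \<open>max 0 t\<close> the image is constant at
    negative times, which allows the complete space of bounded continuous functions on the whole
    line.\<close>
  define X where "X b t = (if t < 0 then \<phi> t else exp (rate * t) *\<^sub>R b t)" for b :: "real \<Rightarrow> 'a" and t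
  define T where "T b t = exp (- rate * max 0 t) *\<^sub>R (\<phi> 0 + integral {0..max 0 t} (f (X b)))" for b t
  have Xcont: "continuous_on {0..} (X b)" if "continuous_on UNIV b" for b
  proof -
    have "continuous_on {0..} (\<lambda>t. exp (rate * t) *\<^sub>R b t)"
      by (intro continuous_intros continuous_on_subset[OF that]) auto
    then show ?thesis by (rule continuous_on_eq) (simp add: X_def)
  qed
  have Xpw: "pw_cont (-h) (X b)" if "continuous_on UNIV b" for b
    by (rule pw_cont_extension[OF h phi _ Xcont[OF that]]) (simp add: X_def)
  have Tcont: "continuous_on UNIV (T b)" if "continuous_on UNIV b" for b
    unfolding T_def
    by (intro continuous_intros continuous_on_compose2[OF
          continuous_on_integral_initial[OF pw[OF Xpw[OF that]]], of UNIV "max 0"]) auto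
  have Tdiff: "norm (T b t - T b' t) \<le> (1 / 2) * B"
    if "continuous_on UNIV b" "continuous_on UNIV b'" "\<And>t. norm (b t - b' t) \<le> B" for b b' t B
  proof -
    let ?t = "max 0 t"
    have B: "B \<ge> 0" using that(3)[of 0] order_trans[OF norm_ge_zero] by blast
    have "norm (X b s - X b' s) \<le> B * exp (rate * s)" if "s \<in> {0..?t}" for s
      using that \<open>\<And>t. norm (b t - b' t) \<le> B\<close>[of s]
      by (simp add: X_def scaleR_diff_right[symmetric] mult.commute)
    then have "norm (integral {0..?t} (f (X b)) - integral {0..?t} (f (X b'))) \<le> B / 2 * exp (rate * ?t)"
      using B by (intro integral_diff_bound Xpw that) (auto simp: X_def)
    moreover have "T b t - T b' t
        = exp (- rate * ?t) *\<^sub>R (integral {0..?t} (f (X b)) - integral {0..?t} (f (X b')))"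
      by (simp add: T_def algebra_simps)
    ultimately have "norm (T b t - T b' t) \<le> exp (- rate * ?t) * (B / 2 * exp (rate * ?t))"
      by simp
    also have "\<dots> = (1 / 2) * B" by (simp add: exp_minus)
    finally show ?thesis .
  qed
  \<comment> \<open>By the Lipschitz bound \<open>Tdiff\<close>, one bounded image makes all images
    bounded. The zero function is the simplest choice: its extension is \<open>\<phi>\<close>
    followed by zero.\<close>
  have T0: "norm (T (\<lambda>_. 0) t) \<le> norm (\<phi> 0) + C * D / rate"
    if D: "\<And>s. s \<in> {-h..0} \<Longrightarrow> norm (\<phi> s) \<le> D" for t D
  proof -
    let ?x = "X (\<lambda>_. 0)" and ?t = "max 0 t"
    have D0: "D \<ge> 0" using D[of 0] h order_trans[OF norm_ge_zero, of "\<phi> 0"] by auto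
    have x: "pw_cont (-h) ?x" by (rule Xpw) simp
    have "norm (f ?x s) \<le> (C * D) * exp (rate * s)" if "s \<in> {0..?t}" for s
    proof -
      have "norm (f ?x s - f (\<lambda>_. 0) s) \<le> C * D"
      proof (rule lipschitz[OF x])
        show "pw_cont (-h) (\<lambda>_. 0 :: 'a)" by (rule continuous_imp_pw_cont) simp
        show "norm (?x r - 0) \<le> D" if "r \<in> {s - h..s}" for r
          using that \<open>s \<in> {0..?t}\<close> D[of r] D0 by (auto simp: X_def)
      qed (use that in simp)
      also have "C * D * 1 \<le> (C * D) * exp (rate * s)"
        using that rate(1) C D0 by (intro mult_left_mono) auto
      finally show ?thesis by (simp add: zero)
    qed
    then have "norm (integral {0..?t} (f ?x)) \<le> (C * D) / rate * exp (rate * ?t)"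
      using rate(1) C D0 by (intro integral_exp_bound pw_cont_integrable[OF pw[OF x]]) auto
    then have "norm (\<phi> 0 + integral {0..?t} (f ?x))
        \<le> norm (\<phi> 0) * exp (rate * ?t) + (C * D) / rate * exp (rate * ?t)"
      using rate(1) mult_left_mono[of 1 "exp (rate * ?t)" "norm (\<phi> 0)"]
      by (intro order_trans[OF norm_triangle_ineq] add_mono) auto
    then have "norm (T (\<lambda>_. 0) t)
        \<le> exp (- rate * ?t) * (norm (\<phi> 0) * exp (rate * ?t) + (C * D) / rate * exp (rate * ?t))"
      unfolding T_def by simp
    also have "\<dots> = norm (\<phi> 0) + C * D / rate" by (simp add: exp_minus field_simps)
    finally show ?thesis .
  qed
  obtain D where D: "\<And>s. s \<in> {-h..0} \<Longrightarrow> norm (\<phi> s) \<le> D"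
    using piecewise_continuous_on_imp_bounded[OF phi] unfolding bounded_iff by blast
  have Tb: "T (apply_bcontfun b) \<in> bcontfun" for b
  proof (rule bcontfun_normI)
    show "continuous_on UNIV (T (apply_bcontfun b))" by (rule Tcont) simp
    fix t
    have "norm (T (apply_bcontfun b) t - T (\<lambda>_. 0) t) \<le> (1 / 2) * norm b"
      by (rule Tdiff) (auto simp: norm_bounded)
    with T0[OF D, of t] show "norm (T (apply_bcontfun b) t) \<le> (1 / 2) * norm b + (norm (\<phi> 0) + C * D / rate)"
      using norm_triangle_sub[of "T (apply_bcontfun b) t" "T (\<lambda>_. 0) t"] by simp
  qed
  define S where "S b = Bcontfun (T (apply_bcontfun b))" for b
  have S: "apply_bcontfun (S b) = T (apply_bcontfun b)" for b
    unfolding S_def by (rule Bcontfun_inverse[OF Tb])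
  have "dist (S b) (S b') \<le> (1 / 2) * dist b b'" for b b'
  proof (rule dist_bound)
    fix t show "dist (S b t) (S b' t) \<le> (1 / 2) * dist b b'"
      unfolding S dist_norm[of "T _ _"]
      by (rule Tdiff) (auto simp: dist_norm[symmetric] dist_bounded)
  qed
  then obtain b where b: "S b = b"
    using banach_fix_type[of "1/2" S] by auto
  define x where "x = X (apply_bcontfun b)"
  have bT: "apply_bcontfun b t = T (apply_bcontfun b) t" for t
    using S[of b] b by simp
  have xeq: "x t = \<phi> 0 + integral {0..t} (f x)" if "t \<ge> 0" for t
    using that bT[of t] by (simp add: x_def X_def[of _ t] T_def exp_minus max_def)
  show thesis
  proof (rule that)
    show "pw_cont (-h) x" "continuous_on {0..} x" unfolding x_def by (auto intro: Xpw Xcont)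
    show "x s = \<phi> s" if "s \<in> {-h..0}" for s
      \<comment> \<open>\<open>X\<close> does not prescribe the value at \<open>0\<close>; the
        integral equation at time \<open>0\<close> does.\<close>
      using that xeq[of 0] by (cases "s = 0") (auto simp: x_def X_def)
  qed (rule xeq)
qed

end

subsection \<open>The coupled equations\<close>

lemma symmetric_matrix_congruence:
  fixes B :: "real^'m^'n"
  assumes "symmetric_matrix A"
  shows "symmetric_matrix (B ** A ** transpose B)"
  using assms by (simp add: symmetric_matrix_def matrix_transpose_mul matrix_mul_assoc transpose_transpose)

lemma positive_definite_nonneg:
  "positive_definite R \<Longrightarrow> v \<bullet> (R *v v) \<ge> 0"
  by (cases "v = 0") (auto simp: positive_definite_def less_imp_le)

text \<open>Definiteness makes the kernel trivial, hence the matrix invertible, so that the choice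
  in \<open>matrix_inv\<close> is meaningful. The transposed inverse is again a left inverse and so
  coincides with the inverse.\<close>

lemma positive_definite_inverse:
  fixes R :: "real^'m^'m"
  assumes "positive_definite R"
  shows "matrix_inv R ** R = mat 1" "R ** matrix_inv R = mat 1" "symmetric_matrix (matrix_inv R)"
proof -
  have "x = 0" if "R *v x = 0" for x
    using assms that unfolding positive_definite_def by (metis inner_zero_right less_irrefl)
  then have "invertible R"
    by (auto simp: invertible_left_inverse matrix_left_invertible_ker)
  then have ex: "\<exists>A'. R ** A' = mat 1 \<and> A' ** R = mat 1"
    by (simp add: invertible_def)
  from someI_ex[OF ex] show inv: "matrix_inv R ** R = mat 1" "R ** matrix_inv R = mat 1"
    by (simp_all add: matrix_inv_def)
  have "transpose (matrix_inv R) ** R = mat 1"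
    using arg_cong[OF inv(2), of transpose] assms
    by (simp add: matrix_transpose_mul positive_definite_def symmetric_matrix_def transpose_mat)
  then have "transpose (matrix_inv R) ** (R ** matrix_inv R) = matrix_inv R"
    by (simp add: matrix_mul_assoc)
  then show "symmetric_matrix (matrix_inv R)"
    by (simp add: inv(2) symmetric_matrix_def)
qed

lemma game_R_positive_definite:
  assumes "well_formed_game G"
  shows "positive_definite (R1 G P1)" "positive_definite (R2 G P2)"
  using assms by (auto simp: well_formed_game_def)

text \<open>The weight cancels against one of its two inverses. Hence
  \<open>Dmat G i i - 2 *\<^sub>R Cmat G i\<close> is \<open>- Cmat G i\<close>, and the Riccati
  equation is the one of linear quadratic control.\<close>

lemma Dmat_diag:
  assumes "well_formed_game G"
  shows "Dmat G i i = Cmat G i"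
  using positive_definite_inverse[OF game_R_positive_definite(1)[OF assms]]
    positive_definite_inverse[OF game_R_positive_definite(2)[OF assms]]
  by (cases i) (simp_all add: matrix_mul_assoc[symmetric])

lemma symmetric_Cmat:
  assumes "well_formed_game G"
  shows "symmetric_matrix (Cmat G i)"
  using positive_definite_inverse[OF game_R_positive_definite(1)[OF assms]]
    positive_definite_inverse[OF game_R_positive_definite(2)[OF assms]]
  by (cases i) (simp_all add: symmetric_matrix_congruence)

lemma symmetric_Dmat:
  assumes "well_formed_game G"
  shows "symmetric_matrix (Dmat G i j)"
proof -
  have R: "transpose (R1 G i) = R1 G i" "transpose (R2 G i) = R2 G i"
    using assms by (auto simp: well_formed_game_def symmetric_matrix_def)
  have "transpose (matrix_inv (R1 G P1)) = matrix_inv (R1 G P1)"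
      "transpose (matrix_inv (R2 G P2)) = matrix_inv (R2 G P2)"
    using positive_definite_inverse(3)[OF game_R_positive_definite(1)[OF assms]]
      positive_definite_inverse(3)[OF game_R_positive_definite(2)[OF assms]]
    by (auto simp: symmetric_matrix_def)
  then show ?thesis
    by (cases j) (simp_all add: R symmetric_matrix_def matrix_transpose_mul matrix_mul_assoc transpose_transpose)
qed

lemma riccati_equation:
  assumes weight0: "Phi0 G i =
          N i + 2 *\<^sub>R (Pi0 i ** Cmat G (opp i) ** Pi0 (opp i))
          - Pi0 (opp i) ** Dmat G i (opp i) ** Pi0 (opp i) - 2 *\<^sub>R Pi1 i 0"
    and eq1: "E1 G Pi0 Pi1 i"
  shows "Pi0 i ** A0 G + transpose (A0 G) ** Pi0 i
          + Pi0 i ** (Dmat G i i - 2 *\<^sub>R Cmat G i) ** Pi0 i = - N i"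
  using eq1 unfolding E1_def weight0
  by (simp add: matrix_mult_diff_left matrix_mult_diff_right matrix_mult_scaleR_left
      matrix_mult_scaleR_right algebra_simps)

lemma has_vector_derivative_left_const:
  fixes A :: "real^'k^'m"
  assumes "(f has_vector_derivative f') net"
  shows "((\<lambda>t. A ** f t) has_vector_derivative A ** f') net"
  by (rule bounded_linear.has_vector_derivative[OF
        bounded_bilinear.bounded_linear_right[OF bounded_bilinear_matrix_mult] assms])

lemma has_vector_derivative_right_const:
  fixes A :: "real^'k^'m"
  assumes "(f has_vector_derivative f') net"
  shows "((\<lambda>t. f t ** A) has_vector_derivative f' ** A) net"
  by (rule bounded_linear.has_vector_derivative[OF
        bounded_bilinear.bounded_linear_left[OF bounded_bilinear_matrix_mult] assms])

text \<open>\<open>c - W T\<close> has a real limit, so the limit of the sum exists in the extended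
  reals even for infinite \<open>Q\<close>.\<close>

lemma has_performance_balance:
  assumes sol: "closed_loop_solution G v1 v2 \<phi> x" and W: "(W \<longlongrightarrow> 0) at_top"
    and bal: "\<And>T. T \<ge> 0 \<Longrightarrow>
      (running_cost G i x (\<lambda>t. v1 (state G x t)) (\<lambda>t. v2 (state G x t)) has_integral
        c - W T + q T) {0..T}"
    and q: "((\<lambda>T. ereal (q T)) \<longlongrightarrow> Q) at_top"
  shows "has_performance G i \<phi> v1 v2 (ereal c + Q)"
proof -
  let ?L = "running_cost G i x (\<lambda>t. v1 (state G x t)) (\<lambda>t. v2 (state G x t))"
  have "((\<lambda>T. ereal (c - W T)) \<longlongrightarrow> ereal (c - 0)) at_top"
    by (intro tendsto_intros W)
  then have "((\<lambda>T. ereal (c - W T) + ereal (q T)) \<longlongrightarrow> ereal (c - 0) + Q) at_top"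
    by (intro tendsto_add_ereal_general2 q) auto
  then have "((\<lambda>T. ereal (integral {0..T} ?L)) \<longlongrightarrow> ereal (c - 0) + Q) at_top"
  proof (rule Lim_transform_eventually)
    show "eventually (\<lambda>T. ereal (c - W T) + ereal (q T) = ereal (integral {0..T} ?L)) at_top"
      using eventually_ge_at_top[of 0]
      by eventually_elim (simp add: integral_unique[OF bal])
  qed
  moreover have "?L integrable_on {0..T}" if "T \<ge> 0" for T
    using bal[OF that] by (rule has_integral_integrable)
  ultimately show ?thesis
    unfolding has_performance_def Let_def using sol by auto
qed

text \<open>Weights and closed forms as pointwise equations, with the Riccati equation standing in
  for (E1), from which it is derived beforehand.\<close>

locale riccati_design =
  fixes G :: "('n::finite, 'm1::finite, 'm2::finite) delay_game"
    and N Pi0 :: "player \<Rightarrow> real^'n^'n"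
    and Pi1 :: "player \<Rightarrow> real \<Rightarrow> real^'n^'n"
    and Pi2 :: "player \<Rightarrow> real \<Rightarrow> real \<Rightarrow> real^'n^'n"
  assumes game: "well_formed_game G"
    and Pi0_pd: "positive_definite (Pi0 i)"
    and weight0: "Phi0 G i =
          N i + 2 *\<^sub>R (Pi0 i ** Cmat G (opp i) ** Pi0 (opp i))
          - Pi0 (opp i) ** Dmat G i (opp i) ** Pi0 (opp i) - 2 *\<^sub>R Pi1 i 0"
    and weight1: "\<theta> \<in> delay_interval G \<Longrightarrow> Phi1 G i \<theta> =
          - Pi2 i 0 \<theta> - Pi0 (opp i) ** Dmat G i (opp i) ** Pi1 (opp i) \<theta>
          + Pi0 i ** Cmat G (opp i) ** Pi1 (opp i) \<theta>
          + Pi0 (opp i) ** Cmat G (opp i) ** Pi1 i \<theta>"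
    and weight2: "\<xi> \<in> delay_interval G \<Longrightarrow> \<theta> \<in> delay_interval G \<Longrightarrow> Phi2 G i \<xi> \<theta> =
          - (transpose (Pi1 i \<xi>) ** (Dmat G i i - 2 *\<^sub>R Cmat G i) ** Pi1 i \<theta>)
          - transpose (Pi1 (opp i) \<xi>) ** Dmat G i (opp i) ** Pi1 (opp i) \<theta>
          + 2 *\<^sub>R (transpose (Pi1 (opp i) \<xi>) ** Cmat G (opp i) ** Pi1 i \<theta>)"
    and riccati: "Pi0 i ** A0 G + transpose (A0 G) ** Pi0 i
          + Pi0 i ** (Dmat G i i - 2 *\<^sub>R Cmat G i) ** Pi0 i = - N i"
    and Pi1_eq: "\<theta> \<in> delay_interval G \<Longrightarrow>
          Pi1 i \<theta> = matrix_exp ((\<theta> + delay G) *\<^sub>R Fmat G Pi0 i) ** Pi0 i ** A1 G"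
    and Pi2_le: "\<xi> \<in> delay_interval G \<Longrightarrow> \<theta> \<in> delay_interval G \<Longrightarrow> \<xi> \<le> \<theta> \<Longrightarrow>
          Pi2 i \<xi> \<theta> = Psi G Pi0 i \<xi> ** Pi1 i \<theta>"
    and Pi2_gt: "\<xi> \<in> delay_interval G \<Longrightarrow> \<theta> \<in> delay_interval G \<Longrightarrow> \<xi> > \<theta> \<Longrightarrow>
          Pi2 i \<xi> \<theta> = transpose (Pi1 i \<xi>) ** transpose (Psi G Pi0 i \<theta>)"
begin

abbreviation (input) "h \<equiv> delay G"
abbreviation (input) "I \<equiv> delay_interval G"
abbreviation (input) "F \<equiv> Fmat G Pi0"

lemma h: "h > 0"
  using game by (simp add: well_formed_game_def)

lemma mem_I: "\<theta> \<in> I \<longleftrightarrow> -h \<le> \<theta> \<and> \<theta> \<le> 0"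
  by (simp add: delay_interval_def)

lemma symmetric:
  "transpose (Pi0 i) = Pi0 i" "transpose (Cmat G i) = Cmat G i" "transpose (Dmat G i j) = Dmat G i j"
  using Pi0_pd symmetric_Cmat[OF game] symmetric_Dmat[OF game]
  by (auto simp: positive_definite_def symmetric_matrix_def)

lemma Psi_eq: "Psi G Pi0 i \<xi> = transpose (A1 G) ** matrix_exp ((- (\<xi> + h)) *\<^sub>R F i)"
  by (simp only: Psi_def scaleR_minus_left)

text \<open>The group law merges the exponentials and \<open>h\<close> drops out: the kernel is a
  function of \<open>\<theta> - \<xi>\<close>, which is the source of both its continuity and its
  transport equation.\<close>

lemma Psi_Pi1:
  assumes "\<theta> \<in> I"
  shows "Psi G Pi0 i \<xi> ** Pi1 i \<theta>
    = transpose (A1 G) ** matrix_exp ((\<theta> - \<xi>) *\<^sub>R F i) ** Pi0 i ** A1 G"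
proof -
  have "matrix_exp ((\<theta> - \<xi>) *\<^sub>R F i)
      = matrix_exp ((- (\<xi> + h)) *\<^sub>R F i) ** matrix_exp ((\<theta> + h) *\<^sub>R F i)"
    by (simp only: matrix_exp_add[symmetric]) (simp add: algebra_simps)
  then show ?thesis unfolding Psi_eq Pi1_eq[OF assms] by (simp add: matrix_mul_assoc)
qed

lemma transpose_Psi_Pi1:
  "transpose (Pi1 i \<xi>) ** transpose (Psi G Pi0 i \<theta>) = transpose (Psi G Pi0 i \<theta> ** Pi1 i \<xi>)"
  by (simp add: matrix_transpose_mul)

text \<open>The exponent vanishes on the diagonal and leaves
  \<open>transpose (A1 G) ** Pi0 i ** A1 G\<close>, symmetric with \<open>Pi0 i\<close>. So the two
  branches of \<open>Pi2\<close> meet continuously.\<close>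

lemma Psi_Pi1_diag:
  assumes "\<theta> \<in> I"
  shows "transpose (Psi G Pi0 i \<theta> ** Pi1 i \<theta>) = Psi G Pi0 i \<theta> ** Pi1 i \<theta>"
  using assms by (simp add: Psi_Pi1 matrix_transpose_mul symmetric matrix_mul_assoc transpose_transpose)

lemma Pi2_ge:
  assumes "\<xi> \<in> I" "\<theta> \<in> I" "\<xi> \<ge> \<theta>"
  shows "Pi2 i \<xi> \<theta> = transpose (Psi G Pi0 i \<theta> ** Pi1 i \<xi>)"
  using assms Pi2_gt[OF assms(1,2)] Pi2_le[OF assms(1,2)] Psi_Pi1_diag[OF assms(2)]
  by (cases "\<xi> = \<theta>") (simp_all add: transpose_Psi_Pi1)

lemma Pi2_symmetric:
  assumes "\<xi> \<in> I" "\<theta> \<in> I"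
  shows "transpose (Pi2 i \<xi> \<theta>) = Pi2 i \<theta> \<xi>"
  using assms by (cases "\<xi> \<le> \<theta>") (simp_all add: Pi2_ge Pi2_le transpose_transpose)

lemma continuous_on_Pi1: "continuous_on I (Pi1 i)"
proof -
  have "continuous_on I (\<lambda>\<theta>. matrix_exp ((\<theta> + h) *\<^sub>R F i) ** Pi0 i ** A1 G)"
    by (intro continuous_on_matrix_mult continuous_on_matrix_exp continuous_intros)
  then show ?thesis by (rule continuous_on_eq) (simp add: Pi1_eq)
qed

lemma continuous_on_Pi2: "continuous_on (I \<times> I) (\<lambda>(\<xi>, \<theta>). Pi2 i \<xi> \<theta>)"
proof -
  let ?g = "\<lambda>z. transpose (A1 G) ** matrix_exp ((snd z - fst z) *\<^sub>R F i) ** Pi0 i ** A1 G"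
  let ?g' = "\<lambda>z. transpose (transpose (A1 G) ** matrix_exp ((fst z - snd z) *\<^sub>R F i) ** Pi0 i ** A1 G)"
  let ?L = "{z \<in> I \<times> I. fst z \<le> snd z}" and ?U = "{z \<in> I \<times> I. snd z \<le> fst z}"
  have sq: "closed (I \<times> I)" by (intro closed_Times) (auto simp: delay_interval_def)
  have half: "closed {z :: real \<times> real. fst z \<le> snd z}" "closed {z :: real \<times> real. snd z \<le> fst z}"
    by (intro closed_Collect_le continuous_intros)+
  have "closed ((I \<times> I) \<inter> {z. fst z \<le> snd z})" "closed ((I \<times> I) \<inter> {z. snd z \<le> fst z})"
    using closed_Int[OF sq half(1)] closed_Int[OF sq half(2)] .
  then have "closed ?L" "closed ?U"
    by (simp_all add: Int_def)
  moreover have "continuous_on ?L (\<lambda>(\<xi>, \<theta>). Pi2 i \<xi> \<theta>)"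
  proof (rule continuous_on_eq)
    show "continuous_on ?L ?g"
      by (intro continuous_on_matrix_mult continuous_on_matrix_exp continuous_intros)
  qed (auto simp: Pi2_le Psi_Pi1)
  moreover have "continuous_on ?U (\<lambda>(\<xi>, \<theta>). Pi2 i \<xi> \<theta>)"
  proof (rule continuous_on_eq)
    show "continuous_on ?U ?g'"
      by (intro continuous_on_transpose continuous_on_matrix_mult continuous_on_matrix_exp continuous_intros)
  qed (auto simp: Pi2_ge Psi_Pi1)
  ultimately have "continuous_on (?L \<union> ?U) (\<lambda>(\<xi>, \<theta>). Pi2 i \<xi> \<theta>)"
    by (intro continuous_on_closed_Un)
  moreover have "?L \<union> ?U = I \<times> I" by auto
  ultimately show ?thesis by simp
qed

lemma regular: "regular_unknowns G Pi0 Pi1 Pi2"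
  unfolding regular_unknowns_def
  by (intro allI conjI ballI Pi0_pd continuous_on_Pi1 continuous_on_Pi2 Pi2_symmetric)

section \<open>Verification of (E2)-(E5)\<close>

lemma Pi1_derivative:
  assumes "\<theta> \<in> I"
  shows "(Pi1 i has_vector_derivative F i ** Pi1 i \<theta>) (at \<theta> within I)"
proof -
  have "((\<lambda>\<theta>. matrix_exp ((\<theta> + h) *\<^sub>R F i) ** Pi0 i ** A1 G) has_vector_derivative
      (1 *\<^sub>R (F i ** matrix_exp ((\<theta> + h) *\<^sub>R F i))) ** Pi0 i ** A1 G) (at \<theta> within I)"
    by (intro has_vector_derivative_right_const matrix_exp_has_vector_derivative)
      (auto intro!: derivative_eq_intros)
  then have "((\<lambda>\<theta>. matrix_exp ((\<theta> + h) *\<^sub>R F i) ** Pi0 i ** A1 G) has_vector_derivative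
      F i ** Pi1 i \<theta>) (at \<theta> within I)"
    by (simp add: Pi1_eq[OF assms] matrix_mul_assoc)
  then show ?thesis
    by (rule has_vector_derivative_transform[OF assms, rotated]) (simp add: Pi1_eq)
qed

lemma eq2: "E2 G Pi0 Pi1 Pi2 i"
  unfolding E2_def
proof
  fix \<theta> assume \<theta>: "\<theta> \<in> I"
  show "(Pi1 i has_vector_derivative
        (transpose (A0 G) ** Pi1 i \<theta> + Phi1 G i \<theta> + Pi2 i 0 \<theta>
         + Pi0 i ** Dmat G i i ** Pi1 i \<theta>
         + Pi0 (opp i) ** Dmat G i (opp i) ** Pi1 (opp i) \<theta>
         - 2 *\<^sub>R (Pi0 i ** Cmat G i ** Pi1 i \<theta>)
         - Pi0 i ** Cmat G (opp i) ** Pi1 (opp i) \<theta>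
         - Pi0 (opp i) ** Cmat G (opp i) ** Pi1 i \<theta>)) (at \<theta> within I)"
    by (rule has_vector_derivative_eq_rhs[OF Pi1_derivative[OF \<theta>]])
      (simp add: weight1[OF \<theta>] Fmat_def matrix_mult_diff_left matrix_mult_diff_right
        matrix_mult_scaleR_left matrix_mult_scaleR_right matrix_add_rdistrib' algebra_simps)
qed

lemma shifted_kernel_derivative:
  assumes "(g has_real_derivative c) (at s within S)"
  shows "((\<lambda>s. transpose (A1 G) ** matrix_exp (g s *\<^sub>R F i) ** Pi0 i ** A1 G) has_vector_derivative
    c *\<^sub>R (transpose (A1 G) ** (F i ** matrix_exp (g s *\<^sub>R F i)) ** Pi0 i ** A1 G)) (at s within S)"
proof -
  have "((\<lambda>s. transpose (A1 G) ** matrix_exp (g s *\<^sub>R F i) ** Pi0 i ** A1 G) has_vector_derivative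
    transpose (A1 G) ** (c *\<^sub>R (F i ** matrix_exp (g s *\<^sub>R F i))) ** Pi0 i ** A1 G) (at s within S)"
    by (intro has_vector_derivative_right_const has_vector_derivative_left_const
        matrix_exp_has_vector_derivative assms)
  then show ?thesis by (simp add: matrix_mult_scaleR_left matrix_mult_scaleR_right)
qed

text \<open>Off the diagonal \<open>Pi2 i \<xi> \<theta>\<close> depends on \<open>\<theta> - \<xi>\<close> only, so its transport derivative vanishes.\<close>

lemma Pi2_derivatives:
  assumes "\<xi> \<in> I" "\<theta> \<in> I" "\<xi> \<noteq> \<theta>"
  shows "\<exists>D. ((\<lambda>s. Pi2 i s \<theta>) has_vector_derivative D) (at \<xi> within I) \<and>
    ((\<lambda>s. Pi2 i \<xi> s) has_vector_derivative - D) (at \<theta> within I)"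
proof (cases "\<xi> < \<theta>")
  case True
  let ?D = "transpose (A1 G) ** (F i ** matrix_exp ((\<theta> - \<xi>) *\<^sub>R F i)) ** Pi0 i ** A1 G"
  have "((\<lambda>s. transpose (A1 G) ** matrix_exp ((\<theta> - s) *\<^sub>R F i) ** Pi0 i ** A1 G)
      has_vector_derivative (- 1) *\<^sub>R ?D) (at \<xi> within I)"
    by (rule shifted_kernel_derivative) (auto intro!: derivative_eq_intros)
  then have "((\<lambda>s. Pi2 i s \<theta>) has_vector_derivative (- 1) *\<^sub>R ?D) (at \<xi> within I)"
    \<comment> \<open>The radius \<open>\<theta> - \<xi>\<close> keeps the moving argument on the
      same side of the diagonal, so a single branch applies.\<close>
    by (rule has_vector_derivative_transform_within[where d = "\<theta> - \<xi>"])
      (use assms True in \<open>auto simp: dist_real_def Pi2_le Psi_Pi1\<close>)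
  moreover have "((\<lambda>s. transpose (A1 G) ** matrix_exp ((s - \<xi>) *\<^sub>R F i) ** Pi0 i ** A1 G)
      has_vector_derivative 1 *\<^sub>R ?D) (at \<theta> within I)"
    by (rule shifted_kernel_derivative) (auto intro!: derivative_eq_intros)
  then have "((\<lambda>s. Pi2 i \<xi> s) has_vector_derivative 1 *\<^sub>R ?D) (at \<theta> within I)"
    by (rule has_vector_derivative_transform_within[where d = "\<theta> - \<xi>"])
      (use assms True in \<open>auto simp: dist_real_def Pi2_le Psi_Pi1\<close>)
  ultimately show ?thesis by (intro exI[of _ "- ?D"]) simp
next
  case False
  let ?D = "transpose (A1 G) ** (F i ** matrix_exp ((\<xi> - \<theta>) *\<^sub>R F i)) ** Pi0 i ** A1 G"
  have "((\<lambda>s. transpose (transpose (A1 G) ** matrix_exp ((s - \<theta>) *\<^sub>R F i) ** Pi0 i ** A1 G))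
      has_vector_derivative transpose (1 *\<^sub>R ?D)) (at \<xi> within I)"
    by (intro bounded_linear.has_vector_derivative[OF bounded_linear_transpose]
        shifted_kernel_derivative) (auto intro!: derivative_eq_intros)
  then have "((\<lambda>s. Pi2 i s \<theta>) has_vector_derivative transpose (1 *\<^sub>R ?D)) (at \<xi> within I)"
    by (rule has_vector_derivative_transform_within[where d = "\<xi> - \<theta>"])
      (use assms False in \<open>auto simp: dist_real_def Pi2_ge Psi_Pi1\<close>)
  moreover have "((\<lambda>s. transpose (transpose (A1 G) ** matrix_exp ((\<xi> - s) *\<^sub>R F i) ** Pi0 i ** A1 G))
      has_vector_derivative transpose ((- 1) *\<^sub>R ?D)) (at \<theta> within I)"
    by (intro bounded_linear.has_vector_derivative[OF bounded_linear_transpose]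
        shifted_kernel_derivative) (auto intro!: derivative_eq_intros)
  then have "((\<lambda>s. Pi2 i \<xi> s) has_vector_derivative transpose ((- 1) *\<^sub>R ?D)) (at \<theta> within I)"
    by (rule has_vector_derivative_transform_within[where d = "\<xi> - \<theta>"])
      (use assms False in \<open>auto simp: dist_real_def Pi2_ge Psi_Pi1\<close>)
  ultimately show ?thesis by (intro exI[of _ "transpose ?D"]) (simp add: transpose_minus)
qed

lemma eq3: "E3 G Pi1 Pi2 i"
  unfolding E3_def
proof (intro ballI impI)
  fix \<xi> \<theta> assume I: "\<xi> \<in> I" "\<theta> \<in> I" "\<xi> \<noteq> \<theta>"
  obtain D where D: "((\<lambda>s. Pi2 i s \<theta>) has_vector_derivative D) (at \<xi> within I)"
    "((\<lambda>s. Pi2 i \<xi> s) has_vector_derivative - D) (at \<theta> within I)"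
    using Pi2_derivatives[OF I] by blast
  show "\<exists>D\<^sub>\<xi> D\<^sub>\<theta>. ((\<lambda>s. Pi2 i s \<theta>) has_vector_derivative D\<^sub>\<xi>) (at \<xi> within I) \<and>
      ((\<lambda>s. Pi2 i \<xi> s) has_vector_derivative D\<^sub>\<theta>) (at \<theta> within I) \<and>
      D\<^sub>\<xi> + D\<^sub>\<theta> = Phi2 G i \<xi> \<theta>
          + transpose (Pi1 i \<xi>) ** Dmat G i i ** Pi1 i \<theta>
          + transpose (Pi1 (opp i) \<xi>) ** Dmat G i (opp i) ** Pi1 (opp i) \<theta>
          - 2 *\<^sub>R (transpose (Pi1 i \<xi>) ** Cmat G i ** Pi1 i \<theta>)
          - 2 *\<^sub>R (transpose (Pi1 (opp i) \<xi>) ** Cmat G (opp i) ** Pi1 i \<theta>)"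
  proof (intro exI conjI)
    show "D + - D = Phi2 G i \<xi> \<theta>
          + transpose (Pi1 i \<xi>) ** Dmat G i i ** Pi1 i \<theta>
          + transpose (Pi1 (opp i) \<xi>) ** Dmat G i (opp i) ** Pi1 (opp i) \<theta>
          - 2 *\<^sub>R (transpose (Pi1 i \<xi>) ** Cmat G i ** Pi1 i \<theta>)
          - 2 *\<^sub>R (transpose (Pi1 (opp i) \<xi>) ** Cmat G (opp i) ** Pi1 i \<theta>)"
      by (simp add: weight2[OF I(1,2)] matrix_mult_diff_left matrix_mult_diff_right
          matrix_mult_scaleR_left matrix_mult_scaleR_right)
  qed (rule D)+
qed

text \<open>\<open>- h\<close> is the least point of the interval, so only the first branch occurs,
  and there the exponent in \<open>Psi\<close> is zero.\<close>

lemma eq4: "E4 G Pi1 Pi2 i"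
  unfolding E4_def using h by (auto simp: Pi2_le mem_I Psi_eq)

lemma eq5: "E5 G Pi0 Pi1 i"
  unfolding E5_def using h by (simp add: Pi1_eq mem_I)

end

subsection \<open>The value functional\<close>

lemma has_integral_matrix_vector:
  fixes A :: "real^'n^'m"
  assumes "(f has_integral y) S"
  shows "((\<lambda>t. A *v f t) has_integral A *v y) S"
  using has_integral_linear[OF assms matrix_vector_mul_bounded_linear[of A]] by (simp add: o_def)

lemma has_integral_inner_left:
  fixes f :: "real \<Rightarrow> 'a::euclidean_space"
  assumes "(f has_integral y) S"
  shows "((\<lambda>t. f t \<bullet> c) has_integral y \<bullet> c) S"
  using has_integral_linear[OF assms bounded_linear_inner_left[of c]] by (simp add: o_def)

lemma has_integral_inner_right:
  fixes f :: "real \<Rightarrow> 'a::euclidean_space"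
  assumes "(f has_integral y) S"
  shows "((\<lambda>t. c \<bullet> f t) has_integral c \<bullet> y) S"
  using has_integral_linear[OF assms bounded_linear_inner_right[of c]] by (simp add: o_def)

lemma inner_matrix_product:
  fixes P :: "real^'n^'m" and D :: "real^'k^'m" and Q :: "real^'l^'k"
  shows "a \<bullet> ((transpose P ** D ** Q) *v b) = (P *v a) \<bullet> (D *v (Q *v b))"
  by (simp add: inner_matrix_left matrix_vector_mul_assoc matrix_mul_assoc)

context riccati_design
begin

definition z :: "player \<Rightarrow> (real \<Rightarrow> real^'n) \<Rightarrow> real \<Rightarrow> real^'n" where
  "z i = delay_conv h (F i) (Pi0 i ** A1 G)"

text \<open>The integral of \<open>transpose (Psi G Pi0 i \<theta>)\<close> against the state. It
  arises twice: from \<open>Pi2 i 0 \<theta>\<close> inside \<open>Phi1\<close>, and from the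
  derivative of the quadratic part of \<open>V\<close>.\<close>

definition zeta :: "player \<Rightarrow> (real \<Rightarrow> real^'n) \<Rightarrow> real \<Rightarrow> real^'n" where
  "zeta i = delay_conv h (- transpose (F i)) (A1 G)"

text \<open>Half the gradient of \<open>V\<close> in the present value \<open>x t\<close>, with the
  rest of the state held fixed. Each feedback is a constant matrix times it.\<close>

definition costate :: "player \<Rightarrow> (real \<Rightarrow> real^'n) \<Rightarrow> real \<Rightarrow> real^'n" where
  "costate i x t = Pi0 i *v x t + z i x t"

text \<open>With these arguments the kernel of \<open>delay_quad\<close> is \<open>transpose (A1 G)
  ** matrix_exp ((\<theta> - \<xi>) *\<^sub>R F i) ** Pi0 i ** A1 G\<close> for
  \<open>\<xi> \<le> \<theta>\<close>, which by \<open>Psi_Pi1\<close> is that of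
  \<open>Pi2\<close>.\<close>

definition V :: "player \<Rightarrow> (real \<Rightarrow> real^'n) \<Rightarrow> real \<Rightarrow> real" where
  "V i x t = x t \<bullet> (Pi0 i *v x t) + 2 * (x t \<bullet> z i x t)
     + delay_quad h (F i) (Pi0 i ** A1 G) (A1 G) x t"

definition state_cost :: "player \<Rightarrow> (real \<Rightarrow> real^'n) \<Rightarrow> real \<Rightarrow> real" where
  "state_cost i x t =
     x t \<bullet> (Phi0 G i *v x t)
     + 2 * (x t \<bullet> integral I (\<lambda>\<theta>. Phi1 G i \<theta> *v x (t + \<theta>)))
     + integral I (\<lambda>\<theta>. integral I (\<lambda>\<xi>. x (t + \<xi>) \<bullet> (Phi2 G i \<xi> \<theta> *v x (t + \<theta>))))"

lemma running_cost_eq: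
  "running_cost G i x v1 v2 t
    = state_cost i x t + v1 t \<bullet> (R1 G i *v v1 t) + v2 t \<bullet> (R2 G i *v v2 t)"
  by (simp add: running_cost_def state_cost_def)

lemma Pi1_zero: "Pi1 i 0 = matrix_exp (h *\<^sub>R F i) ** (Pi0 i ** A1 G)"
  using h by (simp add: Pi1_eq mem_I matrix_mul_assoc)

section \<open>The delay integrals of the running cost in terms of \<open>z\<close> and
  \<open>zeta\<close>\<close>

lemma z_has_integral:
  assumes "pw_cont (-h) x" "t \<ge> 0"
  shows "((\<lambda>\<theta>. Pi1 i \<theta> *v x (t + \<theta>)) has_integral z i x t) I"
proof -
  have "((\<lambda>\<theta>. (matrix_exp ((\<theta> + h) *\<^sub>R F i) ** (Pi0 i ** A1 G)) *v x (t + \<theta>))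
      has_integral z i x t) I"
    unfolding z_def delay_conv_def delay_interval_def
    by (rule integrable_integral[OF delay_integrand_integrable[OF assms]])
  then show ?thesis
    by (rule has_integral_eq[rotated]) (simp add: Pi1_eq matrix_mul_assoc)
qed

lemma transpose_Psi:
  "transpose (Psi G Pi0 i \<theta>) = matrix_exp ((\<theta> + h) *\<^sub>R (- transpose (F i))) ** A1 G"
proof -
  have "transpose (matrix_exp ((- (\<theta> + h)) *\<^sub>R F i)) = matrix_exp ((\<theta> + h) *\<^sub>R (- transpose (F i)))"
    by (simp only: transpose_exp_neg[symmetric] transpose_transpose)
  then show ?thesis
    by (simp only: Psi_eq matrix_transpose_mul transpose_transpose)
qed

lemma zeta_has_integral:
  assumes "pw_cont (-h) x" "t \<ge> 0"
  shows "((\<lambda>\<theta>. transpose (Psi G Pi0 i \<theta>) *v x (t + \<theta>)) has_integral zeta i x t) I"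
  unfolding transpose_Psi zeta_def delay_conv_def delay_interval_def
  by (rule integrable_integral[OF delay_integrand_integrable[OF assms]])

lemma Phi1_has_integral:
  assumes x: "pw_cont (-h) x" "t \<ge> 0"
  shows "((\<lambda>\<theta>. Phi1 G i \<theta> *v x (t + \<theta>)) has_integral
    (- (transpose (Pi1 i 0) *v zeta i x t)
     - Pi0 (opp i) *v (Dmat G i (opp i) *v z (opp i) x t)
     + Pi0 i *v (Cmat G (opp i) *v z (opp i) x t)
     + Pi0 (opp i) *v (Cmat G (opp i) *v z i x t))) I"
proof -
  have sep: "((\<lambda>\<theta>. - (transpose (Pi1 i 0) *v (transpose (Psi G Pi0 i \<theta>) *v x (t + \<theta>)))
     - Pi0 (opp i) *v (Dmat G i (opp i) *v (Pi1 (opp i) \<theta> *v x (t + \<theta>)))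
     + Pi0 i *v (Cmat G (opp i) *v (Pi1 (opp i) \<theta> *v x (t + \<theta>)))
     + Pi0 (opp i) *v (Cmat G (opp i) *v (Pi1 i \<theta> *v x (t + \<theta>)))) has_integral
    (- (transpose (Pi1 i 0) *v zeta i x t)
     - Pi0 (opp i) *v (Dmat G i (opp i) *v z (opp i) x t)
     + Pi0 i *v (Cmat G (opp i) *v z (opp i) x t)
     + Pi0 (opp i) *v (Cmat G (opp i) *v z i x t))) I"
    by (intro has_integral_add has_integral_diff has_integral_neg has_integral_matrix_vector
        z_has_integral zeta_has_integral x)
  \<comment> \<open>At \<open>\<xi> = 0\<close> the second branch holds on the whole interval, the
    diagonal point included, so the factor in \<open>\<theta>\<close> separates.\<close>
  have "Pi2 i 0 \<theta> = transpose (Pi1 i 0) ** transpose (Psi G Pi0 i \<theta>)" if "\<theta> \<in> I" for \<theta>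
    using that h Pi2_ge[of 0 \<theta> i] by (simp add: transpose_Psi_Pi1 mem_I)
  then show ?thesis
    by (intro has_integral_eq[OF _ sep])
      (auto simp: weight1 matrix_vector_mult_add_rdistrib matrix_vector_mult_diff_rdistrib
        matrix_vector_mul_assoc matrix_mul_assoc matrix_vector_minus_left simp del: transpose_matrix_vector)
qed

text \<open>The weight is a sum of products separated in \<open>\<xi>\<close> and
  \<open>\<theta>\<close>, so the double integral factors into pairings of \<open>z i\<close> and
  \<open>z (opp i)\<close>; the sign of the first term comes from \<open>Dmat_diag\<close>.\<close>

lemma Phi2_integral:
  assumes x: "pw_cont (-h) x" "t \<ge> 0"
  shows "integral I (\<lambda>\<theta>. integral I (\<lambda>\<xi>. x (t + \<xi>) \<bullet> (Phi2 G i \<xi> \<theta> *v x (t + \<theta>))))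
    = z i x t \<bullet> (Cmat G i *v z i x t) - z (opp i) x t \<bullet> (Dmat G i (opp i) *v z (opp i) x t)
      + 2 * (z (opp i) x t \<bullet> (Cmat G (opp i) *v z i x t))"
proof -
  let ?p = "\<lambda>j \<theta>. Pi1 j \<theta> *v x (t + \<theta>)"
  let ?o = "opp i"
  have "integral I (\<lambda>\<xi>. x (t + \<xi>) \<bullet> (Phi2 G i \<xi> \<theta> *v x (t + \<theta>)))
      = z i x t \<bullet> (Cmat G i *v ?p i \<theta>) - z ?o x t \<bullet> (Dmat G i ?o *v ?p ?o \<theta>)
        + 2 * (z ?o x t \<bullet> (Cmat G ?o *v ?p i \<theta>))" if \<theta>: "\<theta> \<in> I" for \<theta>
  proof (rule integral_unique)
    have diag: "- (M ** (Dmat G i i - 2 *\<^sub>R Cmat G i) ** M') = M ** Cmat G i ** M'" for M M' :: "real^'n^'n"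
      by (simp add: Dmat_diag[OF game] scaleR_2 matrix_mult_minus_left matrix_mult_minus_right)
    have "((\<lambda>\<xi>. ?p i \<xi> \<bullet> (Cmat G i *v ?p i \<theta>) - ?p ?o \<xi> \<bullet> (Dmat G i ?o *v ?p ?o \<theta>)
        + 2 * (?p ?o \<xi> \<bullet> (Cmat G ?o *v ?p i \<theta>))) has_integral
      (z i x t \<bullet> (Cmat G i *v ?p i \<theta>) - z ?o x t \<bullet> (Dmat G i ?o *v ?p ?o \<theta>)
        + 2 * (z ?o x t \<bullet> (Cmat G ?o *v ?p i \<theta>)))) I"
      by (intro has_integral_add has_integral_diff has_integral_mult_right has_integral_inner_left
          z_has_integral x)
    then show "((\<lambda>\<xi>. x (t + \<xi>) \<bullet> (Phi2 G i \<xi> \<theta> *v x (t + \<theta>))) has_integral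
      (z i x t \<bullet> (Cmat G i *v ?p i \<theta>) - z ?o x t \<bullet> (Dmat G i ?o *v ?p ?o \<theta>)
        + 2 * (z ?o x t \<bullet> (Cmat G ?o *v ?p i \<theta>)))) I"
    proof (rule has_integral_eq[rotated])
      fix \<xi> assume \<xi>: "\<xi> \<in> I"
      show "?p i \<xi> \<bullet> (Cmat G i *v ?p i \<theta>) - ?p ?o \<xi> \<bullet> (Dmat G i ?o *v ?p ?o \<theta>)
        + 2 * (?p ?o \<xi> \<bullet> (Cmat G ?o *v ?p i \<theta>)) = x (t + \<xi>) \<bullet> (Phi2 G i \<xi> \<theta> *v x (t + \<theta>))"
        unfolding weight2[OF \<xi> \<theta>] diag
        by (simp only: matrix_vector_mult_add_rdistrib matrix_vector_mult_diff_rdistrib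
            scaleR_matrix_vector_assoc[symmetric] inner_add_right inner_diff_right inner_scaleR_right
            inner_matrix_product)
    qed
  qed
  then have "integral I (\<lambda>\<theta>. integral I (\<lambda>\<xi>. x (t + \<xi>) \<bullet> (Phi2 G i \<xi> \<theta> *v x (t + \<theta>))))
    = integral I (\<lambda>\<theta>. z i x t \<bullet> (Cmat G i *v ?p i \<theta>) - z ?o x t \<bullet> (Dmat G i ?o *v ?p ?o \<theta>)
        + 2 * (z ?o x t \<bullet> (Cmat G ?o *v ?p i \<theta>)))"
    by (rule integral_cong)
  also have "\<dots> = z i x t \<bullet> (Cmat G i *v z i x t) - z ?o x t \<bullet> (Dmat G i ?o *v z ?o x t)
      + 2 * (z ?o x t \<bullet> (Cmat G ?o *v z i x t))"
    by (rule integral_unique)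
      (intro has_integral_add has_integral_diff has_integral_mult_right has_integral_inner_right
          has_integral_matrix_vector z_has_integral x)
  finally show ?thesis .
qed

lemma V_derivative:
  assumes x: "pw_cont (-h) x" and t: "t > 0" "isCont x t" "isCont x (t - h)"
    and dx: "(x has_vector_derivative dx) (at t)"
  shows "(V i x has_vector_derivative
    2 * (dx \<bullet> costate i x t)
    + 2 * (x t \<bullet> (Pi1 i 0 *v x t - Pi0 i *v (A1 G *v x (t - h)) - F i *v z i x t))
    + 2 * ((Pi1 i 0 *v x t) \<bullet> zeta i x t) - 2 * ((A1 G *v x (t - h)) \<bullet> z i x t)) (at t)"
proof -
  have dz: "(z i x has_vector_derivative
      Pi1 i 0 *v x t - Pi0 i *v (A1 G *v x (t - h)) - F i *v z i x t) (at t)"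
    using delay_conv_derivative[OF x h t, of "F i" "Pi0 i ** A1 G"]
    by (simp add: z_def Pi1_zero matrix_vector_mul_assoc)
  have dq: "(delay_quad h (F i) (Pi0 i ** A1 G) (A1 G) x has_vector_derivative
      2 * ((Pi1 i 0 *v x t) \<bullet> zeta i x t) - 2 * ((A1 G *v x (t - h)) \<bullet> z i x t)) (at t)"
    using delay_quad_derivative[OF h x t, of "F i" "Pi0 i ** A1 G" "A1 G"]
    by (simp add: z_def zeta_def Pi1_zero)
  have dPx: "((\<lambda>t. Pi0 i *v x t) has_vector_derivative Pi0 i *v dx) (at t)"
    by (rule bounded_linear.has_vector_derivative[OF matrix_vector_mul_bounded_linear dx])
  have "(V i x has_vector_derivative
      (x t \<bullet> (Pi0 i *v dx) + dx \<bullet> (Pi0 i *v x t))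
      + 2 * (x t \<bullet> (Pi1 i 0 *v x t - Pi0 i *v (A1 G *v x (t - h)) - F i *v z i x t) + dx \<bullet> z i x t)
      + (2 * ((Pi1 i 0 *v x t) \<bullet> zeta i x t) - 2 * ((A1 G *v x (t - h)) \<bullet> z i x t))) (at t)"
    unfolding V_def
    by (intro has_vector_derivative_add has_vector_derivative_mult_right dq
        bounded_bilinear.has_vector_derivative[OF bounded_bilinear_inner] dx dz dPx)
  moreover have "x t \<bullet> (Pi0 i *v dx) = dx \<bullet> (Pi0 i *v x t)"
    by (metis inner_commute inner_matrix_left symmetric(1))
  ultimately show ?thesis
    by (simp add: costate_def inner_add_right algebra_simps)
qed

lemma continuous_on_z: "pw_cont (-h) x \<Longrightarrow> continuous_on {0..} (z i x)"
  unfolding z_def by (rule continuous_on_delay_conv[OF _ h])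

lemma continuous_on_costate:
  assumes "pw_cont (-h) x" "continuous_on {0..} x"
  shows "continuous_on {0..} (costate i x)"
  unfolding costate_def
  by (intro continuous_intros continuous_on_z assms
      bounded_linear.continuous_on[OF matrix_vector_mul_bounded_linear])

lemma continuous_on_V:
  assumes "pw_cont (-h) x" "continuous_on {0..} x"
  shows "continuous_on {0..} (V i x)"
  unfolding V_def
  by (intro continuous_intros continuous_on_z continuous_on_delay_quad assms h
      bounded_linear.continuous_on[OF matrix_vector_mul_bounded_linear])

text \<open>Completion of the square. The pointwise identity is where (E1)--(E5) enter: \<open>riccati\<close> cancels the
  terms quadratic in \<open>x(t)\<close>, the choice of the weights all others.\<close>

lemma square_completion:
  fixes B :: "real^'m^'n" and R :: "real^'m^'m"
  assumes x: "pw_cont (-h) x" and t: "t \<ge> 0"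
    and R: "positive_definite R" and C: "Cmat G i = B ** matrix_inv R ** transpose B"
    and dx: "dx = A0 G *v x t + A1 G *v x (t - h) + B *v u - Cmat G (opp i) *v costate (opp i) x t"
  defines "w \<equiv> u + (matrix_inv R ** transpose B) *v costate i x t"
  shows "state_cost i x t + u \<bullet> (R *v u)
      + costate (opp i) x t \<bullet> (Dmat G i (opp i) *v costate (opp i) x t)
    = w \<bullet> (R *v w)
      - (2 * (dx \<bullet> costate i x t)
    + 2 * (x t \<bullet> (Pi1 i 0 *v x t - Pi0 i *v (A1 G *v x (t - h)) - F i *v z i x t))
    + 2 * ((Pi1 i 0 *v x t) \<bullet> zeta i x t) - 2 * ((A1 G *v x (t - h)) \<bullet> z i x t))"
proof -
  let ?o = "opp i" and ?D = "Dmat G i (opp i)" and ?C = "Cmat G i" and ?E = "Cmat G (opp i)"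
  let ?X = "x t" and ?z = "z i x t" and ?y = "z (opp i) x t"
  \<comment> \<open>Each term becomes a bilinear expression in \<open>a\<close>, \<open>b\<close>,
    \<open>x t\<close> and the delay integrals, in which the cancellation is linear
    arithmetic.\<close>
  define a where "a = Pi0 i *v ?X"
  define b where "b = Pi0 ?o *v ?X"
  note Rinv = positive_definite_inverse[OF R]
  have symR: "transpose R = R" "transpose (matrix_inv R) = matrix_inv R"
    using R Rinv(3) by (auto simp: positive_definite_def symmetric_matrix_def)
  have symP: "?X \<bullet> (Pi0 j *v v) = (Pi0 j *v ?X) \<bullet> v" for j v
    by (simp add: inner_matrix_left symmetric)
  have symC: "(Cmat G j *v v) \<bullet> v' = v \<bullet> (Cmat G j *v v')" for j v v'
    by (simp add: inner_matrix_left symmetric)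
  have symD: "(Dmat G i j *v v) \<bullet> v' = v \<bullet> (Dmat G i j *v v')" for j v v'
    by (simp add: inner_matrix_left symmetric)
  have diag: "Dmat G i i - 2 *\<^sub>R ?C = - ?C"
    by (simp add: Dmat_diag[OF game] scaleR_2)
  have w: "w \<bullet> (R *v w) = u \<bullet> (R *v u) + 2 * ((B *v u) \<bullet> costate i x t)
      + costate i x t \<bullet> (?C *v costate i x t)"
  proof -
    let ?Y = "costate i x t"
    define k where "k = (matrix_inv R ** transpose B) *v ?Y"
    have Rk: "R *v k = transpose B *v ?Y"
      by (simp add: k_def matrix_vector_mul_assoc matrix_mul_assoc Rinv)
    have "w \<bullet> (R *v w) = u \<bullet> (R *v u) + u \<bullet> (R *v k) + k \<bullet> (R *v u) + k \<bullet> (R *v k)"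
      by (simp add: w_def k_def[symmetric] inner_add_left inner_add_right matrix_vector_right_distrib)
    also have "k \<bullet> (R *v u) = u \<bullet> (R *v k)"
      by (metis inner_commute inner_matrix_left symR(1))
    also have "u \<bullet> (R *v k) = (B *v u) \<bullet> ?Y"
      by (simp add: Rk inner_matrix_left)
    also have "k \<bullet> (R *v k) = ?Y \<bullet> (?C *v ?Y)"
      unfolding Rk C by (simp add: k_def inner_commute inner_matrix_left matrix_vector_mul_assoc
          matrix_mul_assoc matrix_transpose_mul symR transpose_transpose del: transpose_matrix_vector)
    finally show ?thesis by simp
  qed
  have NX: "?X \<bullet> (N i *v ?X) = a \<bullet> (?C *v a) - 2 * ((A0 G *v ?X) \<bullet> a)"
  proof -
    have "N i = Pi0 i ** ?C ** Pi0 i - Pi0 i ** A0 G - transpose (A0 G) ** Pi0 i"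
      using riccati[of i] unfolding diag
      by (simp add: matrix_mult_minus_left matrix_mult_minus_right algebra_simps)
    then have "?X \<bullet> (N i *v ?X) = ?X \<bullet> (Pi0 i *v (?C *v a)) - ?X \<bullet> (Pi0 i *v (A0 G *v ?X))
        - ?X \<bullet> (transpose (A0 G) *v a)"
      by (simp add: a_def matrix_vector_mult_diff_rdistrib inner_diff_right matrix_vector_mul_assoc matrix_mul_assoc)
    also have "?X \<bullet> (transpose (A0 G) *v a) = (A0 G *v ?X) \<bullet> a"
      by (simp add: inner_matrix_left)
    finally show ?thesis by (simp add: symP a_def[symmetric] inner_commute)
  qed
  have Phi0X: "?X \<bullet> (Phi0 G i *v ?X) = a \<bullet> (?C *v a) - 2 * ((A0 G *v ?X) \<bullet> a)
      + 2 * (a \<bullet> (?E *v b)) - b \<bullet> (?D *v b) - 2 * (?X \<bullet> (Pi1 i 0 *v ?X))"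
  proof -
    have "?X \<bullet> (Phi0 G i *v ?X) = ?X \<bullet> (N i *v ?X) + 2 * (?X \<bullet> (Pi0 i *v (?E *v b)))
        - ?X \<bullet> (Pi0 ?o *v (?D *v b)) - 2 * (?X \<bullet> (Pi1 i 0 *v ?X))"
      unfolding weight0[of i]
      by (simp add: b_def matrix_vector_mult_add_rdistrib matrix_vector_mult_diff_rdistrib
          scaleR_matrix_vector_assoc[symmetric] inner_add_right inner_diff_right
          matrix_vector_mul_assoc matrix_mul_assoc)
    then show ?thesis by (simp add: NX symP a_def[symmetric] b_def[symmetric])
  qed
  have Phi1X: "?X \<bullet> integral I (\<lambda>\<theta>. Phi1 G i \<theta> *v x (t + \<theta>))
      = - ((Pi1 i 0 *v ?X) \<bullet> zeta i x t) - b \<bullet> (?D *v ?y) + a \<bullet> (?E *v ?y) + b \<bullet> (?E *v ?z)"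
    unfolding integral_unique[OF Phi1_has_integral[OF x t]]
    by (simp add: inner_add_right inner_diff_right symP a_def[symmetric] b_def[symmetric]
        inner_matrix_left[of "Pi1 i 0"])
  have FX: "?X \<bullet> (F i *v ?z) = (A0 G *v ?X) \<bullet> ?z - a \<bullet> (?C *v ?z)"
  proof -
    have "F i *v ?z = transpose (A0 G) *v ?z - Pi0 i *v (?C *v ?z)"
      unfolding Fmat_def diag
      by (simp add: matrix_mult_minus_right matrix_vector_mult_diff_rdistrib matrix_vector_mul_assoc)
    then show ?thesis
      by (simp add: inner_diff_right symP a_def[symmetric] inner_matrix_left[of "A0 G"])
  qed
  \<comment> \<open>Mixed terms occur in both orders; symmetry of \<open>Cmat\<close> and
    \<open>Dmat\<close> brings them to one order so that they can cancel.\<close>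
  have comm: "b \<bullet> (?D *v ?y) = ?y \<bullet> (?D *v b)" "a \<bullet> (?C *v ?z) = ?z \<bullet> (?C *v a)"
    "b \<bullet> (?E *v ?z) = ?z \<bullet> (?E *v b)" "?y \<bullet> (?E *v ?z) = ?z \<bullet> (?E *v ?y)"
    by (metis inner_commute symC symD)+
  show ?thesis
    unfolding w state_cost_def Phi0X Phi1X Phi2_integral[OF x t] inner_diff_right FX symP dx
      costate_def a_def[symmetric] b_def[symmetric]
    by (simp add: inner_add_left inner_add_right inner_diff_left inner_diff_right
        matrix_vector_right_distrib comm inner_commute[of _ a] inner_commute[of _ ?z])
qed

text \<open>\<open>B\<close>, \<open>R\<close> and \<open>v\<close> stand for the data of whichever
  player deviates, and the opponent appears only through its costate; both players' balances are
  instances.\<close>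

lemma energy_balance:
  fixes B :: "real^'m^'n" and R :: "real^'m^'m" and v :: "real \<Rightarrow> real^'m"
  assumes x: "pw_cont (-h) x" "continuous_on {0..} x" and v: "continuous_on {0..} v"
    and R: "positive_definite R" and C: "Cmat G i = B ** matrix_inv R ** transpose B"
    and S: "finite S" and dx: "\<And>t. t \<in> {0..} - S \<Longrightarrow> (x has_vector_derivative
      (A0 G *v x t + A1 G *v x (t - h) + B *v v t - Cmat G (opp i) *v costate (opp i) x t))
      (at t within {0..})"
    and T: "T \<ge> 0"
  defines "w \<equiv> \<lambda>t. v t + (matrix_inv R ** transpose B) *v costate i x t"
  shows "((\<lambda>t. state_cost i x t + v t \<bullet> (R *v v t)
      + costate (opp i) x t \<bullet> (Dmat G i (opp i) *v costate (opp i) x t))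
    has_integral V i x 0 - V i x T + integral {0..T} (\<lambda>t. w t \<bullet> (R *v w t))) {0..T}"
proof -
  let ?dx = "\<lambda>t. A0 G *v x t + A1 G *v x (t - h) + B *v v t - Cmat G (opp i) *v costate (opp i) x t"
  let ?dV = "\<lambda>t. 2 * (?dx t \<bullet> costate i x t)
    + 2 * (x t \<bullet> (Pi1 i 0 *v x t - Pi0 i *v (A1 G *v x (t - h)) - F i *v z i x t))
    + 2 * ((Pi1 i 0 *v x t) \<bullet> zeta i x t) - 2 * ((A1 G *v x (t - h)) \<bullet> z i x t)"
  obtain S' where S': "finite S'" "\<forall>t>-h. t \<notin> S' \<longrightarrow> isCont x t"
    using x(1) unfolding pw_cont_def by blast
  have dV: "(?dV has_integral V i x T - V i x 0) {0..T}"
  proof (rule fundamental_theorem_of_calculus_interior_strong[OF _ T])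
    \<comment> \<open>Excluded are the exceptional times of the equation, the discontinuities of
      \<open>x\<close>, and the times at which the delayed argument hits one.\<close>
    show "finite (S \<union> S' \<union> (\<lambda>s. s + h) ` S')" using S S'(1) by simp
    show "continuous_on {0..T} (V i x)"
      by (rule continuous_on_subset[OF continuous_on_V[OF x]]) auto
    fix t assume t: "t \<in> {0<..<T} - (S \<union> S' \<union> (\<lambda>s. s + h) ` S')"
    then have "t - h \<notin> S'" by (metis DiffD2 UnCI diff_add_cancel imageI)
    then have "isCont x t" "isCont x (t - h)" using t h S'(2) by auto
    moreover have "(x has_vector_derivative ?dx t) (at t)"
      using dx[of t] t by (simp add: at_within_interior[of t "{0..}"])
    ultimately show "(V i x has_vector_derivative ?dV t) (at t)"
      using t by (intro V_derivative x) auto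
  qed
  have "continuous_on {0..} w"
    unfolding w_def
    by (intro continuous_intros v continuous_on_costate x
        bounded_linear.continuous_on[OF matrix_vector_mul_bounded_linear])
  then have Rw: "continuous_on {0..} (\<lambda>t. w t \<bullet> (R *v w t))"
    by (intro continuous_intros bounded_linear.continuous_on[OF matrix_vector_mul_bounded_linear])
  have "(\<lambda>t. w t \<bullet> (R *v w t)) integrable_on {0..T}"
    by (intro integrable_continuous_real continuous_on_subset[OF Rw]) auto
  then have wR: "((\<lambda>t. w t \<bullet> (R *v w t)) has_integral integral {0..T} (\<lambda>t. w t \<bullet> (R *v w t))) {0..T}"
    by (rule integrable_integral)
  \<comment> \<open>\<open>?dV\<close> is the explicit formula, not the derivative as such, so the
    identity holds at the exceptional times as well.\<close>
  have "w t \<bullet> (R *v w t) - ?dV t = state_cost i x t + v t \<bullet> (R *v v t)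
      + costate (opp i) x t \<bullet> (Dmat G i (opp i) *v costate (opp i) x t)" if "t \<in> {0..T}" for t
    unfolding w_def using that by (intro square_completion[symmetric] x R C refl) auto
  then have "((\<lambda>t. state_cost i x t + v t \<bullet> (R *v v t)
      + costate (opp i) x t \<bullet> (Dmat G i (opp i) *v costate (opp i) x t)) has_integral
      integral {0..T} (\<lambda>t. w t \<bullet> (R *v w t)) - (V i x T - V i x 0)) {0..T}"
    by (rule has_integral_eq[OF _ has_integral_diff[OF wR dV]])
  then show ?thesis by (simp add: algebra_simps)
qed

section \<open>Decay of the value functional along stable trajectories\<close>

lemma V_bound:
  obtains K where "K \<ge> 0" "\<And>x t \<eta>. pw_cont (-h) x \<Longrightarrow> t \<ge> 0 \<Longrightarrow>
    (\<And>s. s \<in> {t - h..t} \<Longrightarrow> norm (x s) \<le> \<eta>) \<Longrightarrow> \<bar>V i x t\<bar> \<le> K * \<eta>\<^sup>2"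
proof -
  obtain Cz where Cz: "Cz \<ge> 0" "\<And>x t \<eta>. pw_cont (-h) x \<Longrightarrow> t \<ge> 0 \<Longrightarrow>
    (\<And>s. s \<in> {t - h..t} \<Longrightarrow> norm (x s) \<le> \<eta>) \<Longrightarrow> norm (z i x t) \<le> Cz * \<eta>"
    unfolding z_def by (rule delay_conv_bound[OF h]) blast
  obtain Cq where Cq: "Cq \<ge> 0" "\<And>x t \<eta>. pw_cont (-h) x \<Longrightarrow> t \<ge> 0 \<Longrightarrow>
    (\<And>s. s \<in> {t - h..t} \<Longrightarrow> norm (x s) \<le> \<eta>) \<Longrightarrow>
    \<bar>delay_quad h (F i) (Pi0 i ** A1 G) (A1 G) x t\<bar> \<le> Cq * \<eta>\<^sup>2"
    by (rule delay_quad_bound[OF h]) blast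
  let ?P = "onorm ((*v) (Pi0 i))"
  have P: "?P \<ge> 0" by (rule onorm_pos_le[OF matrix_vector_mul_bounded_linear])
  have "\<bar>V i x t\<bar> \<le> (?P + 2 * Cz + Cq) * \<eta>\<^sup>2"
    if x: "pw_cont (-h) x" "t \<ge> 0" and \<eta>: "\<And>s. s \<in> {t - h..t} \<Longrightarrow> norm (x s) \<le> \<eta>" for x t \<eta>
  proof -
    have xt: "norm (x t) \<le> \<eta>" using h by (intro \<eta>) simp
    have "norm (Pi0 i *v x t) \<le> ?P * \<eta>"
      by (rule order_trans[OF onorm[OF matrix_vector_mul_bounded_linear] mult_left_mono[OF xt P]])
    then have "\<bar>x t \<bullet> (Pi0 i *v x t)\<bar> \<le> \<eta> * (?P * \<eta>)"
      using xt order_trans[OF norm_ge_zero xt]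
      by (intro order_trans[OF Cauchy_Schwarz_ineq2] mult_mono) auto
    moreover have "\<bar>x t \<bullet> z i x t\<bar> \<le> \<eta> * (Cz * \<eta>)"
      using xt order_trans[OF norm_ge_zero xt] Cz(2)[OF x \<eta>]
      by (intro order_trans[OF Cauchy_Schwarz_ineq2] mult_mono) auto
    moreover have "\<bar>delay_quad h (F i) (Pi0 i ** A1 G) (A1 G) x t\<bar> \<le> Cq * \<eta>\<^sup>2"
      using Cq(2)[OF x \<eta>] .
    ultimately show ?thesis
      unfolding V_def by (simp add: algebra_simps power2_eq_square)
  qed
  moreover have "?P + 2 * Cz + Cq \<ge> 0" using P Cz(1) Cq(1) by simp
  ultimately show thesis using that by blast
qed

lemma V_tendsto_zero:
  assumes x: "pw_cont (-h) x" and lim: "(x \<longlongrightarrow> 0) at_top"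
  shows "(V i x \<longlongrightarrow> 0) at_top"
proof (rule tendstoI)
  fix e :: real assume e: "e > 0"
  obtain K where K: "K \<ge> 0" "\<And>x t \<eta>. pw_cont (-h) x \<Longrightarrow> t \<ge> 0 \<Longrightarrow>
    (\<And>s. s \<in> {t - h..t} \<Longrightarrow> norm (x s) \<le> \<eta>) \<Longrightarrow> \<bar>V i x t\<bar> \<le> K * \<eta>\<^sup>2"
    by (rule V_bound) blast
  \<comment> \<open>Dividing by \<open>K + 1\<close> makes \<open>K * \<eta>\<^sup>2 < e\<close>
    strict and is safe for \<open>K = 0\<close>.\<close>
  define \<eta> where "\<eta> = sqrt (e / (K + 1))"
  have \<eta>: "\<eta> > 0" "K * \<eta>\<^sup>2 < e" using e K(1) by (auto simp: \<eta>_def field_simps)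
  have "eventually (\<lambda>t. dist (x t) 0 < \<eta>) at_top" using tendstoD[OF lim \<eta>(1)] .
  then obtain T where T: "\<And>t. t \<ge> T \<Longrightarrow> norm (x t) < \<eta>"
    unfolding eventually_at_top_linorder by auto
  \<comment> \<open>Beyond \<open>T + h\<close> the whole window \<open>[t - h, t]\<close> lies past
    \<open>T\<close>.\<close>
  have "dist (V i x t) 0 < e" if "t \<ge> max 0 (T + h)" for t
  proof -
    have "\<bar>V i x t\<bar> \<le> K * \<eta>\<^sup>2"
      using that by (intro K(2) x less_imp_le[OF T]) auto
    with \<eta>(2) show ?thesis by simp
  qed
  then show "eventually (\<lambda>t. dist (V i x t) 0 < e) at_top"
    unfolding eventually_at_top_linorder by blast
qed

text \<open>Makes the starting value a function of \<open>\<phi>\<close> alone, hence the same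
  constant for the equilibrium and for every deviation.\<close>

lemma V_cong:
  assumes "\<And>\<theta>. \<theta> \<in> I \<Longrightarrow> x \<theta> = y \<theta>"
  shows "V i x 0 = V i y 0"
proof -
  have xy: "x s = y s" if "s \<in> {-h..0}" for s using assms that by (simp add: mem_I)
  have "z i x 0 = z i y 0" unfolding z_def by (rule delay_conv_cong) (simp add: xy)
  moreover have "delay_quad h M N' A x 0 = delay_quad h M N' A y 0" for M N' A :: "real^'n^'n"
    by (rule delay_quad_cong) (rule xy)
  ultimately show ?thesis unfolding V_def using xy[of 0] h by simp
qed

subsection \<open>The closed loop\<close>

lemma closed_loop_solution_pw_cont:
  assumes "initial_function G \<phi>" "closed_loop_solution G u1 u2 \<phi> x"
  shows "pw_cont (-h) x" "continuous_on {0..} x"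
proof -
  show "continuous_on {0..} x" using assms(2) by (simp add: closed_loop_solution_def)
  then show "pw_cont (-h) x"
    using assms by (intro pw_cont_extension[OF h])
      (auto simp: initial_function_def closed_loop_solution_def mem_I)
qed

lemma state_feedback:
  assumes "pw_cont (-h) x" "t \<ge> 0"
  shows "feedback1 G Pi0 Pi1 (state G x t) = - ((matrix_inv (R1 G P1) ** transpose (B1 G)) *v costate P1 x t)"
    and "feedback2 G Pi0 Pi1 (state G x t) = - ((matrix_inv (R2 G P2) ** transpose (B2 G)) *v costate P2 x t)"
proof -
  have "integral I (\<lambda>\<theta>. Pi1 i \<theta> *v state G x t \<theta>) = z i x t" for i
    by (rule trans[OF integral_cong integral_unique[OF z_has_integral[OF assms]]])
      (simp add: state_def)
  moreover have "state G x t 0 = x t" using h by (simp add: state_def mem_I)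
  ultimately show
    "feedback1 G Pi0 Pi1 (state G x t) = - ((matrix_inv (R1 G P1) ** transpose (B1 G)) *v costate P1 x t)"
    "feedback2 G Pi0 Pi1 (state G x t) = - ((matrix_inv (R2 G P2) ** transpose (B2 G)) *v costate P2 x t)"
    by (simp_all add: feedback1_def feedback2_def costate_def matrix_vector_right_distrib
        matrix_vector_mul_assoc del: transpose_matrix_vector)
qed

lemma feedback_effect:
  assumes "pw_cont (-h) x" "t \<ge> 0"
  shows "B1 G *v feedback1 G Pi0 Pi1 (state G x t) = - (Cmat G P1 *v costate P1 x t)"
    and "B2 G *v feedback2 G Pi0 Pi1 (state G x t) = - (Cmat G P2 *v costate P2 x t)"
  by (simp_all add: state_feedback[OF assms] matrix_vector_minus_right matrix_vector_mul_assoc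
      matrix_mul_assoc)

section \<open>Well-posedness of the closed loop under both feedback laws\<close>

definition closed_field :: "(real \<Rightarrow> real^'n) \<Rightarrow> real \<Rightarrow> real^'n" where
  "closed_field x t = A0 G *v x t + A1 G *v x (t - h)
     - Cmat G P1 *v costate P1 x t - Cmat G P2 *v costate P2 x t"

lemma closed_field_eq:
  assumes "pw_cont (-h) x" "t \<ge> 0"
  shows "A0 G *v x t + A1 G *v x (t - h) + B1 G *v feedback1 G Pi0 Pi1 (state G x t)
     + B2 G *v feedback2 G Pi0 Pi1 (state G x t) = closed_field x t"
  by (simp add: closed_field_def feedback_effect[OF assms])

text \<open>The field is linear in the trajectory, so operator norms and the uniform bound on
  \<open>delay_conv\<close>, applied to \<open>x - y\<close>, give the Lipschitz constant.\<close>

lemma delay_functional_closed_field: "\<exists>K. delay_functional h K closed_field"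
proof -
  have cost: "\<exists>K\<ge>0. \<forall>x y t \<eta>. pw_cont (-h) x \<longrightarrow> pw_cont (-h) y \<longrightarrow> t \<ge> 0 \<longrightarrow>
      (\<forall>s\<in>{t - h..t}. norm (x s - y s) \<le> \<eta>) \<longrightarrow> norm (costate i x t - costate i y t) \<le> K * \<eta>" for i
  proof -
    obtain Cz where Cz: "Cz \<ge> 0" "\<And>x t \<eta>. pw_cont (-h) x \<Longrightarrow> t \<ge> 0 \<Longrightarrow>
      (\<And>s. s \<in> {t - h..t} \<Longrightarrow> norm (x s) \<le> \<eta>) \<Longrightarrow>
      norm (delay_conv h (F i) (Pi0 i ** A1 G) x t) \<le> Cz * \<eta>"
      by (rule delay_conv_bound[OF h]) blast
    let ?P = "onorm ((*v) (Pi0 i))"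
    have P: "?P \<ge> 0" by (rule onorm_pos_le[OF matrix_vector_mul_bounded_linear])
    have "norm (costate i x t - costate i y t) \<le> (?P + Cz) * \<eta>"
      if x: "pw_cont (-h) x" and y: "pw_cont (-h) y" and t: "t \<ge> 0"
        and \<eta>: "\<forall>s\<in>{t - h..t}. norm (x s - y s) \<le> \<eta>" for x y t \<eta>
    proof -
      have P\<eta>: "norm (Pi0 i *v (x t - y t)) \<le> ?P * \<eta>"
        using \<eta> h
        by (intro order_trans[OF onorm[OF matrix_vector_mul_bounded_linear] mult_left_mono[OF _ P]]) auto
      have z\<eta>: "norm (z i x t - z i y t) \<le> Cz * \<eta>"
        unfolding z_def delay_conv_diff[OF x y t] using \<eta> by (intro Cz(2) pw_cont_diff x y t) auto
      have "costate i x t - costate i y t = Pi0 i *v (x t - y t) + (z i x t - z i y t)"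
        by (simp add: costate_def matrix_vector_mult_diff_distrib)
      then show ?thesis
        using order_trans[OF norm_triangle_ineq add_mono[OF P\<eta> z\<eta>]] by (simp add: distrib_right)
    qed
    then show ?thesis
      using add_nonneg_nonneg[OF P Cz(1)] by (intro exI[of _ "?P + Cz"] conjI allI impI)
  qed
  obtain K1 where K1: "K1 \<ge> 0" "\<forall>x y t \<eta>. pw_cont (-h) x \<longrightarrow> pw_cont (-h) y \<longrightarrow> t \<ge> 0 \<longrightarrow>
      (\<forall>s\<in>{t - h..t}. norm (x s - y s) \<le> \<eta>) \<longrightarrow> norm (costate P1 x t - costate P1 y t) \<le> K1 * \<eta>"
    using cost[of P1] by (elim exE conjE)
  obtain K2 where K2: "K2 \<ge> 0" "\<forall>x y t \<eta>. pw_cont (-h) x \<longrightarrow> pw_cont (-h) y \<longrightarrow> t \<ge> 0 \<longrightarrow>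
      (\<forall>s\<in>{t - h..t}. norm (x s - y s) \<le> \<eta>) \<longrightarrow> norm (costate P2 x t - costate P2 y t) \<le> K2 * \<eta>"
    using cost[of P2] by (elim exE conjE)
  let ?n = "\<lambda>M :: real^'n^'n. onorm ((*v) M)"
  have n: "?n M \<ge> 0" for M by (rule onorm_pos_le[OF matrix_vector_mul_bounded_linear])
  have nle: "norm (M *v v) \<le> ?n M * c" if "norm v \<le> c" for M v c
    by (rule order_trans[OF onorm[OF matrix_vector_mul_bounded_linear] mult_left_mono[OF that n]])
  define K where "K = ?n (A0 G) + ?n (A1 G) + ?n (Cmat G P1) * K1 + ?n (Cmat G P2) * K2"
  have "delay_functional h K closed_field"
  proof
    show "h > 0" by (rule h)
    show "K \<ge> 0" using n K1(1) K2(1) by (simp add: K_def)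
  next
    fix x :: "real \<Rightarrow> real^'n" assume x: "pw_cont (-h) x"
    have x0: "pw_cont 0 x" using h by (intro pw_cont_mono[OF x]) simp
    have xh: "pw_cont 0 (\<lambda>t. x (t - h))" using pw_cont_shift[OF x, of "-h"] by simp
    have cost: "pw_cont 0 (costate i x)" for i
      unfolding costate_def
      by (intro pw_cont_add pw_cont_const_matrix_vector x0 continuous_on_imp_pw_cont continuous_on_z x)
    show "pw_cont 0 (closed_field x)"
      unfolding closed_field_def
      by (intro pw_cont_add pw_cont_diff pw_cont_const_matrix_vector x0 xh cost)
  next
    fix x y :: "real \<Rightarrow> real^'n" and t \<eta> :: real
    assume x: "pw_cont (-h) x" "pw_cont (-h) y" "t \<ge> 0"
      and \<eta>: "\<And>s. s \<in> {t - h..t} \<Longrightarrow> norm (x s - y s) \<le> \<eta>"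
    have A: "norm (A0 G *v (x t - y t)) \<le> ?n (A0 G) * \<eta>"
      "norm (A1 G *v (x (t - h) - y (t - h))) \<le> ?n (A1 G) * \<eta>"
      using h x(3) by (auto intro!: nle \<eta>)
    have C1: "norm (Cmat G P1 *v (costate P1 x t - costate P1 y t)) \<le> ?n (Cmat G P1) * (K1 * \<eta>)"
      by (intro nle K1(2)[rule_format] x \<eta>)
    have C2: "norm (Cmat G P2 *v (costate P2 x t - costate P2 y t)) \<le> ?n (Cmat G P2) * (K2 * \<eta>)"
      by (intro nle K2(2)[rule_format] x \<eta>)
    have eq: "closed_field x t - closed_field y t
      = A0 G *v (x t - y t) + A1 G *v (x (t - h) - y (t - h))
      - Cmat G P1 *v (costate P1 x t - costate P1 y t) - Cmat G P2 *v (costate P2 x t - costate P2 y t)"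
      by (simp add: closed_field_def matrix_vector_mult_diff_distrib)
    have tri: "norm (a + b - c - d) \<le> norm a + norm b + norm c + norm d" for a b c d :: "real^'n"
      using norm_triangle_ineq4[of "a + b - c" d] norm_triangle_ineq4[of "a + b" c]
        norm_triangle_ineq[of a b] by linarith
    have "norm (closed_field x t - closed_field y t)
        \<le> ?n (A0 G) * \<eta> + ?n (A1 G) * \<eta> + ?n (Cmat G P1) * (K1 * \<eta>) + ?n (Cmat G P2) * (K2 * \<eta>)"
      unfolding eq by (rule order_trans[OF tri add_mono[OF add_mono[OF add_mono[OF A] C1] C2]])
    then show "norm (closed_field x t - closed_field y t) \<le> K * \<eta>"
      by (simp add: K_def algebra_simps)
  next
    show "closed_field (\<lambda>_. 0) t = 0" for t
      by (simp add: closed_field_def costate_def z_def delay_conv_def)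
  qed
  then show ?thesis ..
qed

abbreviation (input) "u1 \<equiv> feedback1 G Pi0 Pi1"
abbreviation (input) "u2 \<equiv> feedback2 G Pi0 Pi1"

lemma closed_loop_integral_equation:
  assumes "initial_function G \<phi>" "closed_loop_solution G u1 u2 \<phi> x" "t \<ge> 0"
  shows "x t = \<phi> 0 + integral {0..t} (closed_field x)"
proof -
  note x = closed_loop_solution_pw_cont[OF assms(1,2)]
  obtain S where S: "finite S" "\<And>t. t \<in> {0..} - S \<Longrightarrow> (x has_vector_derivative
      (A0 G *v x t + A1 G *v x (t - h) + B1 G *v u1 (state G x t) + B2 G *v u2 (state G x t)))
      (at t within {0..})" and x0: "x 0 = \<phi> 0"
    using assms(2) h by (auto simp: closed_loop_solution_def mem_I)
  have "(closed_field x has_integral x t - x 0) {0..t}"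
  proof (rule fundamental_theorem_of_calculus_interior_strong[OF S(1) assms(3)])
    show "continuous_on {0..t} x" by (rule continuous_on_subset[OF x(2)]) auto
    fix s assume s: "s \<in> {0<..<t} - S"
    then show "(x has_vector_derivative closed_field x s) (at s)"
      using S(2)[of s] by (simp add: at_within_interior[of s "{0..}"] closed_field_eq[OF x(1)])
  qed
  then show ?thesis using x0 by (simp add: has_integral_iff)
qed

lemma closed_loop_exists:
  assumes "initial_function G \<phi>"
  shows "\<exists>x. closed_loop_solution G u1 u2 \<phi> x"
proof -
  obtain K where "delay_functional h K closed_field" using delay_functional_closed_field ..
  then interpret delay_functional h K closed_field .
  obtain x where x: "pw_cont (-h) x" "continuous_on {0..} x" "\<And>s. s \<in> {-h..0} \<Longrightarrow> x s = \<phi> s"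
    "\<And>t. t \<ge> 0 \<Longrightarrow> x t = \<phi> 0 + integral {0..t} (closed_field x)"
    using assms unfolding initial_function_def by (rule exists_solution) blast
  have f: "pw_cont 0 (closed_field x)" by (rule pw[OF x(1)])
  then obtain S where S: "finite S" "\<forall>t>0. t \<notin> S \<longrightarrow> isCont (closed_field x) t"
    unfolding pw_cont_def by blast
  \<comment> \<open>Differentiating the integral equation needs continuity of the field at an
    interior time; this is why \<open>0\<close> is excluded along with the points of
    \<open>S\<close>.\<close>
  have "(x has_vector_derivative (A0 G *v x t + A1 G *v x (t - h) + B1 G *v u1 (state G x t)
      + B2 G *v u2 (state G x t))) (at t within {0..})" if t: "t \<in> {0..} - insert 0 S" for t
  proof -
    have t0: "t > 0" "isCont (closed_field x) t" using t S(2) by auto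
    have "((\<lambda>t. \<phi> 0 + integral {0..t} (closed_field x)) has_vector_derivative 0 + closed_field x t) (at t)"
      by (intro has_vector_derivative_add has_vector_derivative_const
          integral_initial_derivative f t0)
    then have "(x has_vector_derivative 0 + closed_field x t) (at t)"
      by (rule has_vector_derivative_transform_within_open[where S = "{0<..}"])
        (use t0 x(4) in auto)
    then show ?thesis
      using t0 by (simp add: closed_field_eq[OF x(1)] has_vector_derivative_at_within)
  qed
  then have "closed_loop_solution G u1 u2 \<phi> x"
    unfolding closed_loop_solution_def using x(2,3) finite.insertI[OF S(1), of 0] mem_I by auto
  then show "\<exists>x. closed_loop_solution G u1 u2 \<phi> x" by (rule exI[where x = x])
qed

lemma closed_loop_unique:
  assumes phi: "initial_function G \<phi>" and x: "closed_loop_solution G u1 u2 \<phi> x"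
    and y: "closed_loop_solution G u1 u2 \<phi> y" and t: "t \<ge> -h"
  shows "x t = y t"
proof (cases "t \<ge> 0")
  case True
  obtain K where "delay_functional h K closed_field" using delay_functional_closed_field ..
  then interpret delay_functional h K closed_field .
  show ?thesis
  proof (rule unique[OF closed_loop_solution_pw_cont[OF phi x] closed_loop_solution_pw_cont[OF phi y]
        _ closed_loop_integral_equation[OF phi x] closed_loop_integral_equation[OF phi y] True])
    show "x s = y s" if "s \<in> {-h..0}" for s
      using x y that by (simp add: closed_loop_solution_def mem_I)
  qed
next
  case False
  then show ?thesis using x y t by (simp add: closed_loop_solution_def mem_I)
qed

lemma continuous_on_feedback:
  assumes "pw_cont (-h) x" "continuous_on {0..} x"
  shows "continuous_on {0..} (\<lambda>t. u1 (state G x t))" "continuous_on {0..} (\<lambda>t. u2 (state G x t))"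
proof -
  have "continuous_on {0..} (\<lambda>t. - (M *v costate i x t))" for i and M :: "real^'n^'k"
    by (intro continuous_intros continuous_on_costate assms
        bounded_linear.continuous_on[OF matrix_vector_mul_bounded_linear])
  note c = this
  show "continuous_on {0..} (\<lambda>t. u1 (state G x t))" "continuous_on {0..} (\<lambda>t. u2 (state G x t))"
    by (rule continuous_on_eq[OF c], simp add: state_feedback[OF assms(1)])+
qed

text \<open>Stability is assumed; the other requirements of admissibility hold for every initial
  function by the linear integral equation.\<close>

lemma admissible_feedback:
  assumes "asymptotically_stable G u1 u2"
  shows "admissible G u1 u2"
  unfolding admissible_def
proof (intro conjI allI impI assms)
  fix \<phi> assume phi: "initial_function G \<phi>"
  show "\<exists>x. closed_loop_solution G u1 u2 \<phi> x" by (rule closed_loop_exists[OF phi])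
  fix x assume x: "closed_loop_solution G u1 u2 \<phi> x"
  show "x t = y t" if "closed_loop_solution G u1 u2 \<phi> y" "t \<ge> - delay G" for y t
    by (rule closed_loop_unique[OF phi x that])
  show "continuous_on {0..} (\<lambda>t. u1 (state G x t))" "continuous_on {0..} (\<lambda>t. u2 (state G x t))"
    by (rule continuous_on_feedback[OF closed_loop_solution_pw_cont[OF phi x]])+
qed

subsection \<open>Optimality of the strategies\<close>

text \<open>The control weight between two feedback gains is \<open>Dmat\<close> by definition. For
  the player that does not deviate, this is the extra quadratic term of
  \<open>energy_balance\<close>.\<close>

lemma opponent_cost:
  assumes "pw_cont (-h) x" "t \<ge> 0"
  shows "u1 (state G x t) \<bullet> (R1 G i *v u1 (state G x t)) = costate P1 x t \<bullet> (Dmat G i P1 *v costate P1 x t)"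
    and "u2 (state G x t) \<bullet> (R2 G i *v u2 (state G x t)) = costate P2 x t \<bullet> (Dmat G i P2 *v costate P2 x t)"
  using positive_definite_inverse(3)[OF game_R_positive_definite(1)[OF game]]
    positive_definite_inverse(3)[OF game_R_positive_definite(2)[OF game]]
  by (simp_all add: state_feedback[OF assms] matrix_vector_minus_right inner_matrix_left
      matrix_vector_mul_assoc matrix_mul_assoc matrix_transpose_mul transpose_transpose
      symmetric_matrix_def del: transpose_matrix_vector)

text \<open>The opponent keeps its feedback law, not its open-loop control: along the deviated
  trajectory it plays minus its gain times the costate of that same trajectory, as
  \<open>energy_balance\<close> requires.\<close>

lemma player1_balance:
  assumes phi: "initial_function G \<phi>" and sol: "closed_loop_solution G w u2 \<phi> x"
    and w: "continuous_on {0..} (\<lambda>t. w (state G x t))" and T: "T \<ge> 0"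
  defines "d \<equiv> \<lambda>t. w (state G x t) - u1 (state G x t)"
  shows "(running_cost G P1 x (\<lambda>t. w (state G x t)) (\<lambda>t. u2 (state G x t)) has_integral
    V P1 \<phi> 0 - V P1 x T + integral {0..T} (\<lambda>t. d t \<bullet> (R1 G P1 *v d t))) {0..T}"
proof -
  note x = closed_loop_solution_pw_cont[OF phi sol]
  obtain S where S: "finite S" "\<And>t. t \<in> {0..} - S \<Longrightarrow> (x has_vector_derivative
      (A0 G *v x t + A1 G *v x (t - h) + B1 G *v w (state G x t) + B2 G *v u2 (state G x t)))
      (at t within {0..})"
    using sol by (auto simp: closed_loop_solution_def)
  let ?w = "\<lambda>t. w (state G x t) + (matrix_inv (R1 G P1) ** transpose (B1 G)) *v costate P1 x t"
  have bal: "((\<lambda>t. state_cost P1 x t + w (state G x t) \<bullet> (R1 G P1 *v w (state G x t))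
      + costate (opp P1) x t \<bullet> (Dmat G P1 (opp P1) *v costate (opp P1) x t))
    has_integral V P1 x 0 - V P1 x T + integral {0..T} (\<lambda>t. ?w t \<bullet> (R1 G P1 *v ?w t))) {0..T}"
  proof (rule energy_balance[OF x w game_R_positive_definite(1)[OF game] _ S(1) _ T])
    fix t assume t: "t \<in> {0..} - S"
    show "(x has_vector_derivative (A0 G *v x t + A1 G *v x (t - h) + B1 G *v w (state G x t)
        - Cmat G (opp P1) *v costate (opp P1) x t)) (at t within {0..})"
      using S(2)[OF t] t by (simp add: feedback_effect[OF x(1)])
  qed simp
  have int: "integral {0..T} (\<lambda>t. ?w t \<bullet> (R1 G P1 *v ?w t)) = integral {0..T} (\<lambda>t. d t \<bullet> (R1 G P1 *v d t))"
    by (rule integral_cong) (simp add: d_def state_feedback[OF x(1)])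
  have V0: "V P1 x 0 = V P1 \<phi> 0"
    using sol by (intro V_cong) (simp add: closed_loop_solution_def)
  show ?thesis
    by (rule has_integral_eq[OF _ bal[unfolded int V0]]) (simp add: running_cost_eq opponent_cost[OF x(1)])
qed

text \<open>The mirror image of \<open>player1_balance\<close>; it is stated separately because the
  two controls have different types.\<close>

lemma player2_balance:
  assumes phi: "initial_function G \<phi>" and sol: "closed_loop_solution G u1 w \<phi> x"
    and w: "continuous_on {0..} (\<lambda>t. w (state G x t))" and T: "T \<ge> 0"
  defines "d \<equiv> \<lambda>t. w (state G x t) - u2 (state G x t)"
  shows "(running_cost G P2 x (\<lambda>t. u1 (state G x t)) (\<lambda>t. w (state G x t)) has_integral
    V P2 \<phi> 0 - V P2 x T + integral {0..T} (\<lambda>t. d t \<bullet> (R2 G P2 *v d t))) {0..T}"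
proof -
  note x = closed_loop_solution_pw_cont[OF phi sol]
  obtain S where S: "finite S" "\<And>t. t \<in> {0..} - S \<Longrightarrow> (x has_vector_derivative
      (A0 G *v x t + A1 G *v x (t - h) + B1 G *v u1 (state G x t) + B2 G *v w (state G x t)))
      (at t within {0..})"
    using sol by (auto simp: closed_loop_solution_def)
  let ?w = "\<lambda>t. w (state G x t) + (matrix_inv (R2 G P2) ** transpose (B2 G)) *v costate P2 x t"
  have bal: "((\<lambda>t. state_cost P2 x t + w (state G x t) \<bullet> (R2 G P2 *v w (state G x t))
      + costate (opp P2) x t \<bullet> (Dmat G P2 (opp P2) *v costate (opp P2) x t))
    has_integral V P2 x 0 - V P2 x T + integral {0..T} (\<lambda>t. ?w t \<bullet> (R2 G P2 *v ?w t))) {0..T}"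
  proof (rule energy_balance[OF x w game_R_positive_definite(2)[OF game] _ S(1) _ T])
    fix t assume t: "t \<in> {0..} - S"
    show "(x has_vector_derivative (A0 G *v x t + A1 G *v x (t - h) + B2 G *v w (state G x t)
        - Cmat G (opp P2) *v costate (opp P2) x t)) (at t within {0..})"
      using S(2)[OF t] t by (simp add: feedback_effect[OF x(1)] algebra_simps)
  qed simp
  have int: "integral {0..T} (\<lambda>t. ?w t \<bullet> (R2 G P2 *v ?w t)) = integral {0..T} (\<lambda>t. d t \<bullet> (R2 G P2 *v d t))"
    by (rule integral_cong) (simp add: d_def state_feedback[OF x(1)])
  have V0: "V P2 x 0 = V P2 \<phi> 0"
    using sol by (intro V_cong) (simp add: closed_loop_solution_def)
  show ?thesis
    by (rule has_integral_eq[OF _ bal[unfolded int V0]]) (simp add: running_cost_eq opponent_cost[OF x(1)] ac_simps)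
qed

text \<open>Without deviation the square vanishes and the cost is \<open>V i \<phi> 0\<close>; a
  deviation adds the limit \<open>Q \<ge> 0\<close>.\<close>

theorem nash:
  assumes stable: "asymptotically_stable G u1 u2"
  shows "nash_strategies G u1 u2"
  unfolding nash_strategies_def
proof (intro conjI allI impI)
  show adm: "admissible G u1 u2" by (rule admissible_feedback[OF stable])
  fix \<phi> assume phi: "initial_function G \<phi>"
  \<comment> \<open>Admissibility of the deviating pair includes its own asymptotic stability, so
    \<open>V\<close> also decays along deviated trajectories.\<close>
  have limit: "(V i x \<longlongrightarrow> 0) at_top"
    if "admissible G v1 v2" "closed_loop_solution G v1 v2 \<phi> x" for v1 v2 x i
    using that phi closed_loop_solution_pw_cont[OF phi that(2)]
    by (intro V_tendsto_zero) (auto simp: admissible_def asymptotically_stable_def)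
  have cont: "continuous_on {0..} (\<lambda>t. v1 (state G x t))" "continuous_on {0..} (\<lambda>t. v2 (state G x t))"
    if "admissible G v1 v2" "closed_loop_solution G v1 v2 \<phi> x" for v1 v2 x
    using that phi by (auto simp: admissible_def)
  have ex: "\<exists>x. closed_loop_solution G v1 v2 \<phi> x" if "admissible G v1 v2" for v1 v2
    using that phi by (auto simp: admissible_def)
  obtain x where x: "closed_loop_solution G u1 u2 \<phi> x" using ex[OF adm] ..
  have zero: "((\<lambda>T. ereal ((\<lambda>_. 0) T)) \<longlongrightarrow> 0) at_top" by (simp add: zero_ereal_def)
  show "\<exists>J::real. has_performance G P1 \<phi> u1 u2 (ereal J) \<and>
      (\<forall>w. admissible G w u2 \<longrightarrow> (\<exists>J'. has_performance G P1 \<phi> w u2 J' \<and> ereal J \<le> J'))"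
  proof (intro exI[of _ "V P1 \<phi> 0"] conjI allI impI)
    have "has_performance G P1 \<phi> u1 u2 (ereal (V P1 \<phi> 0) + 0)"
      by (rule has_performance_balance[OF x limit[OF adm x] _ zero])
        (use player1_balance[OF phi x cont(1)[OF adm x]] in simp)
    then show "has_performance G P1 \<phi> u1 u2 (ereal (V P1 \<phi> 0))" by simp
  next
    fix w assume w: "admissible G w u2"
    obtain y where y: "closed_loop_solution G w u2 \<phi> y" using ex[OF w] ..
    let ?d = "\<lambda>t. w (state G y t) - u1 (state G y t)"
    note c = cont[OF w y] continuous_on_feedback[OF closed_loop_solution_pw_cont[OF phi y]]
    have "continuous_on {0..} (\<lambda>t. ?d t \<bullet> (R1 G P1 *v ?d t))"
      by (intro continuous_intros c bounded_linear.continuous_on[OF matrix_vector_mul_bounded_linear])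
    then obtain Q where Q: "Q \<ge> 0"
      "((\<lambda>T. ereal (integral {0..T} (\<lambda>t. ?d t \<bullet> (R1 G P1 *v ?d t)))) \<longlongrightarrow> Q) at_top"
      by (rule integral_nonneg_limit) (auto intro: positive_definite_nonneg game_R_positive_definite game)
    have "has_performance G P1 \<phi> w u2 (ereal (V P1 \<phi> 0) + Q)"
      by (rule has_performance_balance[OF y limit[OF w y] player1_balance[OF phi y c(1)] Q(2)])
    with Q(1) show "\<exists>J'. has_performance G P1 \<phi> w u2 J' \<and> ereal (V P1 \<phi> 0) \<le> J'"
      by (intro exI[of _ "ereal (V P1 \<phi> 0) + Q"]) (simp add: ereal_le_add_self)
  qed
  show "\<exists>J::real. has_performance G P2 \<phi> u1 u2 (ereal J) \<and>
      (\<forall>w. admissible G u1 w \<longrightarrow> (\<exists>J'. has_performance G P2 \<phi> u1 w J' \<and> ereal J \<le> J'))"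
  proof (intro exI[of _ "V P2 \<phi> 0"] conjI allI impI)
    have "has_performance G P2 \<phi> u1 u2 (ereal (V P2 \<phi> 0) + 0)"
      by (rule has_performance_balance[OF x limit[OF adm x] _ zero])
        (use player2_balance[OF phi x cont(2)[OF adm x]] in simp)
    then show "has_performance G P2 \<phi> u1 u2 (ereal (V P2 \<phi> 0))" by simp
  next
    fix w assume w: "admissible G u1 w"
    obtain y where y: "closed_loop_solution G u1 w \<phi> y" using ex[OF w] ..
    let ?d = "\<lambda>t. w (state G y t) - u2 (state G y t)"
    note c = cont[OF w y] continuous_on_feedback[OF closed_loop_solution_pw_cont[OF phi y]]
    have "continuous_on {0..} (\<lambda>t. ?d t \<bullet> (R2 G P2 *v ?d t))"
      by (intro continuous_intros c bounded_linear.continuous_on[OF matrix_vector_mul_bounded_linear])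
    then obtain Q where Q: "Q \<ge> 0"
      "((\<lambda>T. ereal (integral {0..T} (\<lambda>t. ?d t \<bullet> (R2 G P2 *v ?d t)))) \<longlongrightarrow> Q) at_top"
      by (rule integral_nonneg_limit) (auto intro: positive_definite_nonneg game_R_positive_definite game)
    have "has_performance G P2 \<phi> u1 w (ereal (V P2 \<phi> 0) + Q)"
      by (rule has_performance_balance[OF y limit[OF w y] player2_balance[OF phi y c(2)] Q(2)])
    with Q(1) show "\<exists>J'. has_performance G P2 \<phi> u1 w J' \<and> ereal (V P2 \<phi> 0) \<le> J'"
      by (intro exI[of _ "ereal (V P2 \<phi> 0) + Q"]) (simp add: ereal_le_add_self)
  qed
qed

end

text \<open>The weights themselves contain \<open>Pi1\<close> and \<open>Pi2\<close>, so these are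
  fixed in advance and the closed forms enter as the premise of an implication. Stability is a
  premise of the Nash part alone.\<close>

theorem theorem5:
  fixes G :: "('n::finite, 'm1::finite, 'm2::finite) delay_game"
    and N Pi0 :: "player \<Rightarrow> real^'n^'n"
    and Pi1 :: "player \<Rightarrow> real \<Rightarrow> real^'n^'n"
    and Pi2 :: "player \<Rightarrow> real \<Rightarrow> real \<Rightarrow> real^'n^'n"
  assumes game: "well_formed_game G"
    and Pi0_pd: "\<forall>i. positive_definite (Pi0 i)"
    and N_pd: "\<forall>i. positive_definite (N i)"
    and weight0: "\<forall>i. Phi0 G i =
          N i + 2 *\<^sub>R (Pi0 i ** Cmat G (opp i) ** Pi0 (opp i))
          - Pi0 (opp i) ** Dmat G i (opp i) ** Pi0 (opp i) - 2 *\<^sub>R Pi1 i 0"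
    and weight1: "\<forall>i. \<forall>\<theta>\<in>delay_interval G. Phi1 G i \<theta> =
          - Pi2 i 0 \<theta> - Pi0 (opp i) ** Dmat G i (opp i) ** Pi1 (opp i) \<theta>
          + Pi0 i ** Cmat G (opp i) ** Pi1 (opp i) \<theta>
          + Pi0 (opp i) ** Cmat G (opp i) ** Pi1 i \<theta>"
    and weight2: "\<forall>i. \<forall>\<xi>\<in>delay_interval G. \<forall>\<theta>\<in>delay_interval G. Phi2 G i \<xi> \<theta> =
          - (transpose (Pi1 i \<xi>) ** (Dmat G i i - 2 *\<^sub>R Cmat G i) ** Pi1 i \<theta>)
          - transpose (Pi1 (opp i) \<xi>) ** Dmat G i (opp i) ** Pi1 (opp i) \<theta>
          + 2 *\<^sub>R (transpose (Pi1 (opp i) \<xi>) ** Cmat G (opp i) ** Pi1 i \<theta>)"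
    and eq1: "\<forall>i. E1 G Pi0 Pi1 i"
  shows
    "(\<forall>i. Pi0 i ** A0 G + transpose (A0 G) ** Pi0 i
          + Pi0 i ** (Dmat G i i - 2 *\<^sub>R Cmat G i) ** Pi0 i = - N i) \<and>
     ((\<forall>i. \<forall>\<theta>\<in>delay_interval G.
          Pi1 i \<theta> = matrix_exp ((\<theta> + delay G) *\<^sub>R Fmat G Pi0 i) ** Pi0 i ** A1 G) \<and>
      (\<forall>i. \<forall>\<xi>\<in>delay_interval G. \<forall>\<theta>\<in>delay_interval G.
          (\<xi> \<le> \<theta> \<longrightarrow> Pi2 i \<xi> \<theta> = Psi G Pi0 i \<xi> ** Pi1 i \<theta>) \<and>
          (\<xi> > \<theta> \<longrightarrow> Pi2 i \<xi> \<theta> = transpose (Pi1 i \<xi>) ** transpose (Psi G Pi0 i \<theta>)))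
      \<longrightarrow>
      regular_unknowns G Pi0 Pi1 Pi2 \<and>
      (\<forall>i. E2 G Pi0 Pi1 Pi2 i \<and> E3 G Pi1 Pi2 i \<and> E4 G Pi1 Pi2 i \<and> E5 G Pi0 Pi1 i) \<and>
      (asymptotically_stable G (feedback1 G Pi0 Pi1) (feedback2 G Pi0 Pi1) \<longrightarrow>
       nash_strategies G (feedback1 G Pi0 Pi1) (feedback2 G Pi0 Pi1)))"
proof (intro conjI impI)
  have ric: "Pi0 i ** A0 G + transpose (A0 G) ** Pi0 i
      + Pi0 i ** (Dmat G i i - 2 *\<^sub>R Cmat G i) ** Pi0 i = - N i" for i
    by (rule riccati_equation[OF weight0[rule_format] eq1[rule_format]])
  then show "\<forall>i. Pi0 i ** A0 G + transpose (A0 G) ** Pi0 i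
      + Pi0 i ** (Dmat G i i - 2 *\<^sub>R Cmat G i) ** Pi0 i = - N i" ..
  assume sol: "(\<forall>i. \<forall>\<theta>\<in>delay_interval G.
          Pi1 i \<theta> = matrix_exp ((\<theta> + delay G) *\<^sub>R Fmat G Pi0 i) ** Pi0 i ** A1 G) \<and>
      (\<forall>i. \<forall>\<xi>\<in>delay_interval G. \<forall>\<theta>\<in>delay_interval G.
          (\<xi> \<le> \<theta> \<longrightarrow> Pi2 i \<xi> \<theta> = Psi G Pi0 i \<xi> ** Pi1 i \<theta>) \<and>
          (\<xi> > \<theta> \<longrightarrow> Pi2 i \<xi> \<theta> = transpose (Pi1 i \<xi>) ** transpose (Psi G Pi0 i \<theta>)))"
  interpret riccati_design G N Pi0 Pi1 Pi2
    by unfold_locales (use assms sol ric in blast)+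
  show "regular_unknowns G Pi0 Pi1 Pi2" by (rule regular)
  show "\<forall>i. E2 G Pi0 Pi1 Pi2 i \<and> E3 G Pi1 Pi2 i \<and> E4 G Pi1 Pi2 i \<and> E5 G Pi0 Pi1 i"
    by (intro allI conjI eq2 eq3 eq4 eq5)
  show "nash_strategies G (feedback1 G Pi0 Pi1) (feedback2 G Pi0 Pi1)"
    if "asymptotically_stable G (feedback1 G Pi0 Pi1) (feedback2 G Pi0 Pi1)"
    using that by (rule nash)
qed

end
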